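(* Let $q\in\mathbb{Z}_{>0}$, let $\alpha(q):=\{\alpha_1,\dots,\alpha_q\}\subset\widehat{\mathbb{C}}$ be a set of distinct points and let $\mu_1,\dots,\mu_q\in\mathbb{Z}_{\ge 2}\cup\{\infty\}$. For a Riemann surface $\Sigma$ and a holomorphic map $g:\Sigma\to\widehat{\mathbb{C}}$, say that $g$ satisfies the property $P_{\alpha(q)}$ if either each $\alpha_j$ ($1\le j\le q$) is a totally ramified value of $g$ of order at least $\mu_j$, or $g$ is constant on $\Sigma$. Then $P_{\alpha(q)}$ is a closed property. Furthermore, $P_{\alpha(q)}$ is a compact property if $$\gamma:=\sum_{j=1}^q\left(1-\frac{1}{\mu_j}\right)>2 .$$
   Context: Riemann surfaces are connected. $\widehat{\mathbb{C}}=\mathbb{C}\cup\{\infty\}$, and $1/\infty:=0$. Totally ramified values: Let $\mu\in\mathbb{Z}_{\ge2}\cup\{\infty\}$ and let $g:\Sigma\to\widehat{\mathbb{C}}$ be a holomorphic map on a Riemann surface $\Sigma$. A point $\alpha\in\widehat{\mathbb{C}}$ is a totally ramified value of $g$ of order $\mu$ if the equation $g=\alpha$ has no root of multiplicity less than $\mu$ on $\Sigma$ (for $\alpha=\infty$ the multiplicity of a root is the order of the pole). An omitted value of $g$ (a value not taken on $\Sigma$) is regarded as a totally ramified value of order $\infty$; thus for $\mu=\infty$ the condition means that $\alpha$ is omitted. "Of order at least $\mu_j$" means of order $\mu$ for some $\mu\ge\mu_j$, i.e. $g=\alpha_j$ has no root of multiplicity less than $\mu_j$. The space $\mathcal{M}(\Sigma)$: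 For a Riemann surface $\Sigma$, $\mathcal{M}(\Sigma)$ is the set of all holomorphic maps $g:\Sigma\to\widehat{\mathbb{C}}$ (including $g\equiv\infty$), with the topology of uniform convergence on compact subsets with respect to the chordal distance $\chi$ on $\widehat{\mathbb{C}}$, where $\chi(z_1,z_2)=\frac{|z_1-z_2|}{\sqrt{1+|z_1|^2}\sqrt{1+|z_2|^2}}$ and $\chi(z_1,\infty)=\frac{1}{\sqrt{1+|z_1|^2}}$ for $z_1,z_2\in\mathbb{C}$. A family in $\mathcal{M}(\Sigma)$ is normal if every sequence in it has a subsequence converging in $\mathcal{M}(\Sigma)$ (locally uniformly with respect to $\chi$). Closed and compact properties: For a property $P$ of $\widehat{\mathbb{C}}$-valued holomorphic maps, put $\mathcal{P}(\Sigma):=\{g\in\mathcal{M}(\Sigma): g\text{ satisfies }P\}$. Consider: (P1) for any Riemann surfaces $\Sigma,\Sigma'$ and any holomorphic map $\phi:\Sigma\to\Sigma'$ without ramification points, $g\in\mathcal{P}(\Sigma')$ implies $g\circ\phi\in\mathcal{P}(\Sigma)$; (P2) for any Riemann surface $\Sigma$ and $g\in\mathcal{M}(\Sigma)$, if $g|_\Omega\in\mathcal{P}(\Omega)$ for every relatively compact domain $\Omega$ of $\Sigma$, then $g\in\mathcal{P}(\Sigma)$; (P3) for any Riemann surface $\Sigma$, $\mathcal{P}(\Sigma)$ is a closed subset of $\mathcal{M}(\Sigma)$; (P4) for any Riemann surface $\Sigma$, the family $\mathcal{P}(\Sigma)$ is normal on $\Sigma$. $P$ is a closed property if it satisfies (P1)–(P3),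 and a compact property if it satisfies (P1)–(P4). *)

theory Defs
  imports "HOL-Complex_Analysis.Complex_Analysis" "HOL-Library.Extended_Nat"
begin

section \<open>Riemann surfaces\<close>

text \<open>
  A chart is a pair of its domain and a coordinate function; the values of the coordinate function
  outside the domain are irrelevant.
\<close>

record 'a surface =
  surf_top :: "'a topology"
  charts :: "('a set \<times> ('a \<Rightarrow> complex)) set"

abbreviation pts :: "'a surface \<Rightarrow> 'a set" where
  "pts S \<equiv> topspace (surf_top S)"

definition second_countable_space :: "'a topology \<Rightarrow> bool" where
  "second_countable_space X \<longleftrightarrow>
    (\<exists>\<B>. countable \<B> \<and> (\<forall>V\<in>\<B>. openin X V) \<and>
         (\<forall>U x. openin X U \<and> x \<in> U \<longrightarrow> (\<exists>V\<in>\<B>. x \<in> V \<and> V \<subseteq> U)))"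

text \<open>
  Surfaces are taken to be second countable, as is usual for manifolds. By Rado's theorem this
  excludes no connected Hausdorff space with a complex one-dimensional atlas.
\<close>

definition riemann_surface :: "'a surface \<Rightarrow> bool" where
  "riemann_surface S \<longleftrightarrow>
    pts S \<noteq> {} \<and> connected_space (surf_top S) \<and> Hausdorff_space (surf_top S) \<and>
    second_countable_space (surf_top S) \<and>
    (\<Union>(U, z) \<in> charts S. U) = pts S \<and>
    (\<forall>(U, z) \<in> charts S. openin (surf_top S) U \<and> open (z ` U) \<and>
       homeomorphic_map (subtopology (surf_top S) U) (top_of_set (z ` U)) z) \<and>
    (\<forall>(U, z) \<in> charts S. \<forall>(V, w) \<in> charts S.
       (w \<circ> inv_into U z) holomorphic_on z ` (U \<inter> V))"

definition holomorphic_map :: "'a surface \<Rightarrow> 'b surface \<Rightarrow> ('a \<Rightarrow> 'b) \<Rightarrow> bool" where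
  "holomorphic_map S T f \<longleftrightarrow>
    continuous_map (surf_top S) (surf_top T) f \<and>
    (\<forall>(U, z) \<in> charts S. \<forall>(V, w) \<in> charts T.
       (w \<circ> f \<circ> inv_into U z) holomorphic_on z ` (U \<inter> f -` V))"

text \<open>
  The derivative in local coordinates vanishes; whether it does is independent of the charts. Every
  point is a ramification point of a constant map.
\<close>

definition ramification_point :: "'a surface \<Rightarrow> 'b surface \<Rightarrow> ('a \<Rightarrow> 'b) \<Rightarrow> 'a \<Rightarrow> bool" where
  "ramification_point S T f p \<longleftrightarrow>
    (\<exists>(U, z) \<in> charts S. \<exists>(V, w) \<in> charts T.
       p \<in> U \<and> f p \<in> V \<and> deriv (w \<circ> f \<circ> inv_into U z) (z p) = 0)"

definition restrict_surface :: "'a surface \<Rightarrow> 'a set \<Rightarrow> 'a surface" where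
  "restrict_surface S \<Omega> =
    \<lparr>surf_top = subtopology (surf_top S) \<Omega>, charts = (\<lambda>(U, z). (U \<inter> \<Omega>, z)) ` charts S\<rparr>"

definition rel_compact_domain :: "'a surface \<Rightarrow> 'a set \<Rightarrow> bool" where
  "rel_compact_domain S \<Omega> \<longleftrightarrow>
    \<Omega> \<noteq> {} \<and> openin (surf_top S) \<Omega> \<and> connectedin (surf_top S) \<Omega> \<and>
    compactin (surf_top S) (surf_top S closure_of \<Omega>)"


section \<open>The Riemann sphere and meromorphic functions\<close>

text \<open>The extended plane is the type \<open>complex option\<close>, with \<open>None\<close> as the point at infinity.\<close>

type_synonym ecomplex = "complex option"

definition riemann_sphere :: "ecomplex surface" where
  "riemann_sphere =
    \<lparr>surf_top = Alexandroff_compactification euclidean,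
     charts = {(range Some, the),
               (- {Some 0}, \<lambda>x. case x of None \<Rightarrow> 0 | Some z \<Rightarrow> inverse z)}\<rparr>"

fun chordal :: "ecomplex \<Rightarrow> ecomplex \<Rightarrow> real" where
  "chordal (Some z) (Some w) = cmod (z - w) / (sqrt (1 + (cmod z)\<^sup>2) * sqrt (1 + (cmod w)\<^sup>2))"
| "chordal (Some z) None = 1 / sqrt (1 + (cmod z)\<^sup>2)"
| "chordal None (Some w) = 1 / sqrt (1 + (cmod w)\<^sup>2)"
| "chordal None None = 0"

text \<open>Maps are normalised to be \<open>undefined\<close> off the surface, so that equality is equality of maps on it.\<close>

definition mero :: "'a surface \<Rightarrow> ('a \<Rightarrow> ecomplex) set" where
  "mero S = {g \<in> extensional (pts S). holomorphic_map S riemann_sphere g}"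

text \<open>
  The topology of uniform convergence on compact sets: the neighbourhoods of \<open>g\<close> are the sets
  containing all \<open>h\<close> that are uniformly close to \<open>g\<close> on some compact set.
\<close>

definition cc_open :: "'a surface \<Rightarrow> ('a \<Rightarrow> ecomplex) set \<Rightarrow> bool" where
  "cc_open S \<U> \<longleftrightarrow> \<U> \<subseteq> mero S \<and>
    (\<forall>g\<in>\<U>. \<exists>K e. compactin (surf_top S) K \<and> 0 < e \<and>
       {h \<in> mero S. \<forall>p\<in>K. chordal (h p) (g p) < e} \<subseteq> \<U>)"

definition mero_top :: "'a surface \<Rightarrow> ('a \<Rightarrow> ecomplex) topology" where
  "mero_top S = topology (cc_open S)"

lemma istopology_cc_open: "istopology (cc_open S)"
  unfolding istopology_def
proof (intro conjI allI impI)
  fix A B assume A: "cc_open S A" and B: "cc_open S B"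
  show "cc_open S (A \<inter> B)"
    unfolding cc_open_def
  proof (intro conjI ballI)
    show "A \<inter> B \<subseteq> mero S" using A by (auto simp: cc_open_def)
    fix g assume g: "g \<in> A \<inter> B"
    obtain K e where K: "compactin (surf_top S) K" "0 < e"
      "{h \<in> mero S. \<forall>p\<in>K. chordal (h p) (g p) < e} \<subseteq> A"
      using A g by (auto simp: cc_open_def)
    obtain L d where L: "compactin (surf_top S) L" "0 < d"
      "{h \<in> mero S. \<forall>p\<in>L. chordal (h p) (g p) < d} \<subseteq> B"
      using B g by (auto simp: cc_open_def)
    have "{h \<in> mero S. \<forall>p\<in>K \<union> L. chordal (h p) (g p) < min e d} \<subseteq> A \<inter> B"
      using K(3) L(3) by auto
    moreover have "compactin (surf_top S) (K \<union> L)" "0 < min e d"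
      using K L by (auto intro: compactin_Un)
    ultimately show "\<exists>K e. compactin (surf_top S) K \<and> 0 < e \<and>
       {h \<in> mero S. \<forall>p\<in>K. chordal (h p) (g p) < e} \<subseteq> A \<inter> B" by blast
  qed
next
  fix \<K> assume *: "\<forall>K\<in>\<K>. cc_open S K"
  show "cc_open S (\<Union>\<K>)"
    unfolding cc_open_def
  proof (intro conjI ballI)
    show "\<Union>\<K> \<subseteq> mero S" using * by (auto simp: cc_open_def)
    fix g assume "g \<in> \<Union>\<K>"
    then obtain A where A: "A \<in> \<K>" "g \<in> A" by blast
    with * have "\<exists>K e. compactin (surf_top S) K \<and> 0 < e \<and>
       {h \<in> mero S. \<forall>p\<in>K. chordal (h p) (g p) < e} \<subseteq> A"
      unfolding cc_open_def by blast
    with A show "\<exists>K e. compactin (surf_top S) K \<and> 0 < e \<and>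
       {h \<in> mero S. \<forall>p\<in>K. chordal (h p) (g p) < e} \<subseteq> \<Union>\<K>"
      by (meson Union_upper subset_trans)
  qed
qed

lemma openin_mero_top: "openin (mero_top S) = cc_open S"
  by (simp add: mero_top_def istopology_cc_open topology_inverse')

lemma topspace_mero_top: "topspace (mero_top S) = mero S"
proof -
  have "cc_open S (mero S)"
    unfolding cc_open_def by (auto intro!: exI[of _ "{}"] exI[of _ "1::real"])
  then show ?thesis
    unfolding topspace_def openin_mero_top unfolding cc_open_def by blast
qed

text \<open>Stereographic projection to a sphere of diameter one, on which \<open>\<chi>\<close> is the Euclidean distance\<close>

fun stereo :: "ecomplex \<Rightarrow> complex \<times> real" where
  "stereo (Some z) = (z /\<^sub>R (1 + (cmod z)\<^sup>2), 1 / (1 + (cmod z)\<^sup>2))"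
| "stereo None = (0, 0)"

lemma chordal_eq_dist: "chordal x y = dist (stereo x) (stereo y)"
proof (cases x; cases y)
  fix z w assume xy: "x = Some z" "y = Some w"
  obtain a b where z: "z = Complex a b" by (cases z)
  obtain c d where w: "w = Complex c d" by (cases w)
  define r where "r = 1 + a\<^sup>2 + b\<^sup>2"
  define s where "s = 1 + c\<^sup>2 + d\<^sup>2"
  have r: "r > 0" and s: "s > 0" unfolding r_def s_def
    by (smt (verit) zero_le_power2)+
  have rz: "1 + (cmod z)\<^sup>2 = r" and sw: "1 + (cmod w)\<^sup>2 = s"
    by (simp_all add: z w r_def s_def cmod_power2)
  have poly: "(a * s - c * r)\<^sup>2 + (b * s - d * r)\<^sup>2 + (s - r)\<^sup>2 = ((a - c)\<^sup>2 + (b - d)\<^sup>2) * (r * s)"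
    unfolding r_def s_def by algebra
  have "stereo x = (Complex (a / r) (b / r), 1 / r)" "stereo y = (Complex (c / s) (d / s), 1 / s)"
    by (simp_all only: xy stereo.simps rz sw)
       (simp_all add: z w complex_eq_iff divide_inverse mult.commute)
  then have "(dist (stereo x) (stereo y))\<^sup>2 = (a / r - c / s)\<^sup>2 + (b / r - d / s)\<^sup>2 + (1 / r - 1 / s)\<^sup>2"
    by (simp add: dist_prod_def dist_norm cmod_power2)
  also have "\<dots> = ((a * s - c * r)\<^sup>2 + (b * s - d * r)\<^sup>2 + (s - r)\<^sup>2) / (r * s)\<^sup>2"
    using r s by (simp add: diff_frac_eq power_divide add_divide_distrib)
  also have "\<dots> = ((a - c)\<^sup>2 + (b - d)\<^sup>2) / (r * s)"
    unfolding poly using r s by (simp add: power2_eq_square)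
  also have "\<dots> = (chordal x y)\<^sup>2"
    using r s by (simp only: xy chordal.simps rz sw power_divide power_mult_distrib)
      (simp add: cmod_power2 z w)
  finally have "(chordal x y)\<^sup>2 = (dist (stereo x) (stereo y))\<^sup>2" by simp
  moreover have "chordal x y \<ge> 0" by (simp add: xy)
  ultimately show ?thesis by (simp add: power2_eq_iff_nonneg)
next
  have *: "1 / sqrt (1 + (cmod z)\<^sup>2) = dist (z /\<^sub>R (1 + (cmod z)\<^sup>2), 1 / (1 + (cmod z)\<^sup>2)) (0, 0)" for z
  proof -
    define r where "r = 1 + (cmod z)\<^sup>2"
    have r: "r > 0" unfolding r_def by (smt (verit) zero_le_power2)
    have cz: "(cmod z)\<^sup>2 = r - 1" by (simp add: r_def)
    have "(dist (z /\<^sub>R r, 1 / r) (0, 0))\<^sup>2 = (cmod z)\<^sup>2 / r\<^sup>2 + 1 / r\<^sup>2"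
      using r by (simp add: dist_prod_def divide_inverse power_mult_distrib power_inverse mult.commute)
    also have "\<dots> = r / r\<^sup>2" by (simp add: cz diff_divide_distrib)
    also have "\<dots> = (1 / sqrt r)\<^sup>2" using r by (simp add: power_divide power2_eq_square)
    finally have "1 / sqrt r = dist (z /\<^sub>R r, 1 / r) (0, 0)"
      using r by (simp add: power2_eq_iff_nonneg)
    then show ?thesis by (simp only: r_def)
  qed
  { fix z assume "x = Some z" "y = None" then show ?thesis using * by simp }
  { fix w assume "x = None" "y = Some w" then show ?thesis using *[of w] by (simp add: dist_commute) }
  { assume "x = None" "y = None" then show ?thesis by simp }
qed

lemma chordal_triangle: "chordal x w \<le> chordal x y + chordal y w"
  by (simp add: chordal_eq_dist dist_triangle)

lemma limitin_mero_top:
  "limitin (mero_top S) f g F \<longleftrightarrow>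
    g \<in> mero S \<and> eventually (\<lambda>n. f n \<in> mero S) F \<and>
    (\<forall>K e. compactin (surf_top S) K \<and> 0 < e \<longrightarrow>
       eventually (\<lambda>n. \<forall>p\<in>K. chordal (f n p) (g p) < e) F)"
proof (intro iffI conjI allI impI)
  assume lim: "limitin (mero_top S) f g F"
  then show g: "g \<in> mero S"
    by (simp add: limitin_def topspace_mero_top)
  show "eventually (\<lambda>n. f n \<in> mero S) F"
    using lim g openin_topspace[of "mero_top S"] unfolding limitin_def topspace_mero_top by blast
  fix K and e :: real assume Ke: "compactin (surf_top S) K \<and> 0 < e"
  define V where "V = {h \<in> mero S. \<exists>d<e. \<forall>p\<in>K. chordal (h p) (g p) \<le> d}"
  have "openin (mero_top S) V"
    unfolding openin_mero_top cc_open_def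
  proof (intro conjI ballI)
    show "V \<subseteq> mero S" by (auto simp: V_def)
    fix h assume "h \<in> V"
    then obtain d where d: "d < e" "\<forall>p\<in>K. chordal (h p) (g p) \<le> d" by (auto simp: V_def)
    have "k \<in> V" if k: "k \<in> mero S" "\<forall>p\<in>K. chordal (k p) (h p) < (e - d) / 2" for k
    proof -
      have "\<forall>p\<in>K. chordal (k p) (g p) \<le> (e + d) / 2"
      proof
        fix p assume p: "p \<in> K"
        show "chordal (k p) (g p) \<le> (e + d) / 2"
          using chordal_triangle[of "k p" "g p" "h p"] bspec[OF k(2) p] bspec[OF d(2) p]
          by (simp add: field_simps)
      qed
      moreover have "(e + d) / 2 < e" using d by simp
      ultimately show ?thesis using k(1) unfolding V_def by blast
    qed
    then have "{k \<in> mero S. \<forall>p\<in>K. chordal (k p) (h p) < (e - d) / 2} \<subseteq> V" by blast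
    moreover have "0 < (e - d) / 2" using d by simp
    ultimately show "\<exists>K e. compactin (surf_top S) K \<and> 0 < e \<and>
        {k \<in> mero S. \<forall>p\<in>K. chordal (k p) (h p) < e} \<subseteq> V"
      using Ke by blast
  qed
  moreover have "g \<in> V"
    using g Ke by (auto simp: V_def chordal_eq_dist intro!: exI[of _ 0])
  ultimately have "eventually (\<lambda>n. f n \<in> V) F" using lim by (auto simp: limitin_def)
  then show "eventually (\<lambda>n. \<forall>p\<in>K. chordal (f n p) (g p) < e) F"
    by (rule eventually_mono) (force simp: V_def)
next
  assume *: "g \<in> mero S \<and> eventually (\<lambda>n. f n \<in> mero S) F \<and>
    (\<forall>K e. compactin (surf_top S) K \<and> 0 < e \<longrightarrow>
       eventually (\<lambda>n. \<forall>p\<in>K. chordal (f n p) (g p) < e) F)"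
  show "limitin (mero_top S) f g F"
    unfolding limitin_def topspace_mero_top openin_mero_top
  proof (intro conjI allI impI)
    show "g \<in> mero S" using * by blast
    fix U assume "cc_open S U \<and> g \<in> U"
    then obtain K e where K: "compactin (surf_top S) K" "0 < e"
      "{h \<in> mero S. \<forall>p\<in>K. chordal (h p) (g p) < e} \<subseteq> U"
      unfolding cc_open_def by blast
    have "eventually (\<lambda>n. f n \<in> mero S \<and> (\<forall>p\<in>K. chordal (f n p) (g p) < e)) F"
      using * K by (simp add: eventually_conj_iff)
    then show "eventually (\<lambda>n. f n \<in> U) F"
      by (rule eventually_mono) (use K(3) in blast)
  qed
qed

definition normal_family :: "'a surface \<Rightarrow> ('a \<Rightarrow> ecomplex) set \<Rightarrow> bool" where
  "normal_family S \<F> \<longleftrightarrow>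
    (\<forall>f :: nat \<Rightarrow> 'a \<Rightarrow> ecomplex. range f \<subseteq> \<F> \<longrightarrow>
      (\<exists>r g. strict_mono r \<and> limitin (mero_top S) (f \<circ> r) g sequentially))"


section \<open>Closed and compact properties\<close>

text \<open>
  Since a property has to be meaningful on all Riemann surfaces, it is a polymorphic predicate
  \<open>P\<close>. The definitions below therefore take two instances \<open>P\<close> and \<open>P'\<close> of it, at possibly different
  types of points, so that \<open>\<Sigma>\<close> and \<open>\<Sigma>'\<close> in the first condition need not live in the same type.
\<close>

type_synonym 'a map_property = "'a surface \<Rightarrow> ('a \<Rightarrow> ecomplex) \<Rightarrow> bool"

definition sat :: "'a map_property \<Rightarrow> 'a surface \<Rightarrow> ('a \<Rightarrow> ecomplex) set" where
  "sat P S = {g \<in> mero S. P S g}"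

definition prop_P1 :: "'a map_property \<Rightarrow> 'b map_property \<Rightarrow> bool" where
  "prop_P1 P P' \<longleftrightarrow>
    (\<forall>S T \<phi>. riemann_surface S \<and> riemann_surface T \<and> holomorphic_map S T \<phi> \<and>
       (\<forall>p\<in>pts S. \<not> ramification_point S T \<phi> p) \<longrightarrow>
       (\<forall>g\<in>sat P' T. compose (pts S) g \<phi> \<in> sat P S))"

definition prop_P2 :: "'a map_property \<Rightarrow> bool" where
  "prop_P2 P \<longleftrightarrow>
    (\<forall>S g. riemann_surface S \<and> g \<in> mero S \<and>
       (\<forall>\<Omega>. rel_compact_domain S \<Omega> \<longrightarrow> restrict g \<Omega> \<in> sat P (restrict_surface S \<Omega>)) \<longrightarrow>
       g \<in> sat P S)"

definition prop_P3 :: "'a map_property \<Rightarrow> bool" where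
  "prop_P3 P \<longleftrightarrow> (\<forall>S. riemann_surface S \<longrightarrow> closedin (mero_top S) (sat P S))"

definition prop_P4 :: "'a map_property \<Rightarrow> bool" where
  "prop_P4 P \<longleftrightarrow> (\<forall>S. riemann_surface S \<longrightarrow> normal_family S (sat P S))"

definition closed_property :: "'a map_property \<Rightarrow> 'b map_property \<Rightarrow> bool" where
  "closed_property P P' \<longleftrightarrow> prop_P1 P P' \<and> prop_P2 P \<and> prop_P3 P"

definition compact_property :: "'a map_property \<Rightarrow> 'b map_property \<Rightarrow> bool" where
  "compact_property P P' \<longleftrightarrow> prop_P1 P P' \<and> prop_P2 P \<and> prop_P3 P \<and> prop_P4 P"


section \<open>Totally ramified values\<close>

definition chart_at :: "'a surface \<Rightarrow> 'a \<Rightarrow> 'a set \<times> ('a \<Rightarrow> complex)" where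
  "chart_at S p = (SOME c. c \<in> charts S \<and> p \<in> fst c)"

text \<open>
  The multiplicity of \<open>p\<close> as a root of \<open>g = \<alpha>\<close>, where \<open>\<alpha> = g p\<close>: the order of the zero of \<open>g - \<alpha>\<close>,
  or the order of the pole of \<open>g\<close> if \<open>\<alpha> = \<infinity>\<close>. It does not depend on the choice of the chart. The
  first case separates locally constant \<open>g\<close>, on which \<^const>\<open>zorder\<close> is not meaningful. The value
  \<^term>\<open>the None\<close> at a pole does not matter as \<^const>\<open>zorder\<close> only looks at a punctured
  neighbourhood.
\<close>

definition root_mult :: "'a surface \<Rightarrow> ('a \<Rightarrow> ecomplex) \<Rightarrow> 'a \<Rightarrow> enat" where
  "root_mult S g p =
    (case chart_at S p of (U, z) \<Rightarrow>
      let h = g \<circ> inv_into U z in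
      if eventually (\<lambda>u. h u = g p) (at (z p)) then \<infinity>
      else (case g p of
              Some a \<Rightarrow> enat (nat (zorder (\<lambda>u. the (h u) - a) (z p)))
            | None \<Rightarrow> enat (nat (- zorder (\<lambda>u. the (h u)) (z p)))))"

definition totally_ramified_value ::
    "'a surface \<Rightarrow> ('a \<Rightarrow> ecomplex) \<Rightarrow> ecomplex \<Rightarrow> enat \<Rightarrow> bool" where
  "totally_ramified_value S g \<alpha> \<mu> \<longleftrightarrow>
    (if \<mu> = \<infinity> then \<forall>p\<in>pts S. g p \<noteq> \<alpha>
     else \<not> (\<exists>p\<in>pts S. g p = \<alpha> \<and> root_mult S g p < \<mu>))"

definition P_ramified :: "nat \<Rightarrow> (nat \<Rightarrow> ecomplex) \<Rightarrow> (nat \<Rightarrow> enat) \<Rightarrow> 'a map_property" where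
  "P_ramified q \<alpha> \<mu> S g \<longleftrightarrow>
    (\<forall>j\<in>{1..q}. \<exists>m\<ge>\<mu> j. totally_ramified_value S g (\<alpha> j) m) \<or> g constant_on pts S"

fun recip :: "enat \<Rightarrow> real" where
  "recip (enat n) = 1 / real n"
| "recip \<infinity> = 0"

end

theory Submission
  imports Defs "HOL-Library.Diagonal_Subsequence"
begin

text \<open>
  The multiplicity of \<open>g = g(p)\<close> at \<open>p\<close> is at least \<open>m\<close> iff, in a chart, the chordal distance of
  \<open>g\<close> to \<open>g(p)\<close> is \<open>O(\<bar>w - p\<bar>\<^sup>m)\<close>. This makes (P1) immediate; (P2) follows from the identity theorem
  and (P3) from the persistence of roots under small perturbations, with multiplicities that do not
  increase.

  For (P4), replace \<open>1 - 1/\<mu>\<^sub>j\<close> by slightly smaller \<open>s\<^sub>j < 1\<close> whose sum still exceeds \<open>2\<close>. The sphere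
  then carries a metric of curvature bounded above by a negative constant whose density grows like
  \<open>\<chi>(x, \<alpha>\<^sub>j)\<close> to the power \<open>- s\<^sub>j\<close> at \<open>\<alpha>\<^sub>j\<close>. Its pullback under a map with the prescribed ramification
  is continuous and vanishes over the points \<open>\<alpha>\<^sub>j\<close>, so the Ahlfors-Schwarz lemma applies. It bounds
  the spherical derivative in chart discs independently of the map, and the Arzela-Ascoli theorem
  yields normality.
\<close>

section \<open>Rotations of the sphere in homogeneous coordinates\<close>

text \<open>The number 2 is the Euler characteristic of the sphere: with cone angles 2 pi (1 - s_j)
  it drops to 2 - sum s_j, and Gauss-Bonnet requires this to be negative for a conical metric of
  negative curvature. Lowering the exponents serves two purposes. At a root of order n the pullback
  behaves like |w - z| to the power n (1 - s_j) - 1. For s_j = 1 - 1/\<mu>_j this exponent can be 0,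
  and the pullback need not vanish; now it is positive, so that a positive maximum of the Ahlfors
  quotient lies where all functions involved are smooth. For \<mu>_j = \<infinity> a cone replaces a
  cusp, and omitted values need no separate metric. Constants are the obstacle to closedness, since
  a limit of nonconstant maps may be constant with value \<alpha>_j. Hence every local argument
  about roots is preceded by the identity theorem, and neighbourhoods in the proof of (P3) also
  control two points at which the map differs. Infinity is treated like any other point: coordinates
  are centred at the value in question, or have their pole there.\<close>

fun hom1 :: "ecomplex \<Rightarrow> complex" where
  "hom1 (Some w) = w"
| "hom1 None = 1"

fun hom2 :: "ecomplex \<Rightarrow> complex" where
  "hom2 (Some w) = 1"
| "hom2 None = 0"

definition hnorm :: "ecomplex \<Rightarrow> real" where
  "hnorm x = sqrt ((cmod (hom1 x))\<^sup>2 + (cmod (hom2 x))\<^sup>2)"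

definition hdet :: "ecomplex \<Rightarrow> ecomplex \<Rightarrow> complex" where
  "hdet x y = hom1 x * hom2 y - hom2 x * hom1 y"

definition hprod :: "ecomplex \<Rightarrow> ecomplex \<Rightarrow> complex" where
  "hprod b x = hom1 x * cnj (hom1 b) + hom2 x * cnj (hom2 b)"

text \<open>
  Up to a unimodular factor, \<open>rot b\<close> is the rotation of the sphere taking \<open>b\<close> to \<open>0\<close>. Its pole is
  the antipode of \<open>b\<close>, the only point at which \<open>hprod b\<close> vanishes.
\<close>

definition rot :: "ecomplex \<Rightarrow> ecomplex \<Rightarrow> complex" where
  "rot b x = hdet x b / hprod b x"

fun antipode :: "ecomplex \<Rightarrow> ecomplex" where
  "antipode None = Some 0"
| "antipode (Some a) = (if a = 0 then None else Some (- 1 / cnj a))"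

lemma hnorm_pos [simp]: "hnorm x > 0"
  by (cases x) (simp_all add: hnorm_def add_nonneg_pos)

lemma hnorm_ge_0 [simp]: "hnorm x \<ge> 0" and hnorm_neq_0 [simp]: "hnorm x \<noteq> 0"
  using hnorm_pos[of x] by linarith+

lemma hnorm_squared: "(hnorm x)\<^sup>2 = (cmod (hom1 x))\<^sup>2 + (cmod (hom2 x))\<^sup>2"
  by (simp add: hnorm_def)

lemma of_real_hnorm_squared:
  "complex_of_real ((hnorm x)\<^sup>2) = hom1 x * cnj (hom1 x) + hom2 x * cnj (hom2 x)"
  by (simp only: hnorm_squared of_real_add complex_norm_square)

text \<open>Homogeneous coordinates merge the four cases of the chordal distance into one formula
  that is invariant under scaling of either vector.\<close>

lemma chordal_eq_hdet: "chordal x y = cmod (hdet x y) / (hnorm x * hnorm y)"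
  by (cases x; cases y) (simp_all add: hnorm_def hdet_def add.commute)

lemma chordal_commute: "chordal x y = chordal y x"
  by (simp add: chordal_eq_dist dist_commute)

lemma chordal_nonneg [simp]: "chordal x y \<ge> 0"
  by (simp add: chordal_eq_dist)

lemma chordal_eq_0_iff [simp]: "chordal x y = 0 \<longleftrightarrow> x = y"
  by (cases x; cases y) (auto simp: chordal_eq_hdet hdet_def)

lemma chordal_self [simp]: "chordal x x = 0"
  by simp

lemma chordal_pos_iff: "chordal x y > 0 \<longleftrightarrow> x \<noteq> y"
  using chordal_eq_0_iff[of x y] chordal_nonneg[of x y] by linarith

text \<open>Lagrange's identity in C^2: \<open>hprod b x\<close> measures the component of x along b
  and \<open>hdet x b\<close> the component orthogonal to it.\<close>

lemma hdet_hprod: "(cmod (hdet x b))\<^sup>2 + (cmod (hprod b x))\<^sup>2 = (hnorm x)\<^sup>2 * (hnorm b)\<^sup>2"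
proof -
  have "complex_of_real ((cmod (hdet x b))\<^sup>2 + (cmod (hprod b x))\<^sup>2)
      = complex_of_real ((hnorm x)\<^sup>2 * (hnorm b)\<^sup>2)"
    unfolding of_real_add of_real_mult of_real_hnorm_squared complex_norm_square
    by (simp add: hdet_def hprod_def algebra_simps)
  then show ?thesis
    using of_real_eq_iff by blast
qed

lemma chordal_le_1: "chordal x y \<le> 1"
proof -
  have "(cmod (hdet x y))\<^sup>2 \<le> (hnorm x * hnorm y)\<^sup>2"
    using hdet_hprod[of x y] by (simp add: power_mult_distrib) (smt (verit) zero_le_power2)
  then have "cmod (hdet x y) \<le> hnorm x * hnorm y"
    by (rule power2_le_imp_le) simp
  then show ?thesis by (simp add: chordal_eq_hdet)
qed

lemma hprod_self: "hprod b b \<noteq> 0"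
  by (metis hprod_def of_real_hnorm_squared hnorm_neq_0 of_real_eq_0_iff zero_eq_power2)

lemma rot_self [simp]: "rot b b = 0"
  by (simp add: rot_def hdet_def)

lemma rot_norm:
  assumes "hprod b x \<noteq> 0"
  shows "sqrt (1 + (cmod (rot b x))\<^sup>2) = hnorm x * hnorm b / cmod (hprod b x)"
proof -
  have "1 + (cmod (rot b x))\<^sup>2 = (hnorm x * hnorm b / cmod (hprod b x))\<^sup>2"
    using assms hdet_hprod[of x b]
    by (simp add: rot_def norm_divide power_divide power_mult_distrib field_simps)
  then show ?thesis by simp
qed

lemma rot_diff:
  assumes "hprod b x \<noteq> 0" "hprod b y \<noteq> 0"
  shows "rot b x - rot b y = complex_of_real ((hnorm b)\<^sup>2) * hdet x y / (hprod b x * hprod b y)"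
proof -
  \<comment> \<open>The pairs (\<open>hdet _ b\<close>, \<open>hprod b _\<close>) are coordinates in
    the orthogonal frame given by b, and the change of frame has determinant |b|^2 up to
    sign.\<close>
  have "hdet x b * hprod b y - hdet y b * hprod b x = complex_of_real ((hnorm b)\<^sup>2) * hdet x y"
    unfolding of_real_hnorm_squared by (simp add: hdet_def hprod_def algebra_simps)
  then show ?thesis
    using assms by (simp add: rot_def diff_frac_eq)
qed

text \<open>The factors \<open>hnorm b\<close> cancel, so the chordal distance has the same form in
  the coordinate \<open>rot b\<close> as in the standard one: rotations are isometries.\<close>

lemma chordal_rot:
  assumes "hprod b x \<noteq> 0" "hprod b y \<noteq> 0"
  shows "chordal x y = cmod (rot b x - rot b y)
           / (sqrt (1 + (cmod (rot b x))\<^sup>2) * sqrt (1 + (cmod (rot b y))\<^sup>2))"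
  unfolding chordal_eq_hdet rot_diff[OF assms] rot_norm[OF assms(1)] rot_norm[OF assms(2)]
  using assms by (simp add: norm_mult norm_divide power2_eq_square)

lemma rot_inject:
  assumes "hprod b x \<noteq> 0" "hprod b y \<noteq> 0"
  shows "rot b x = rot b y \<longleftrightarrow> x = y"
  using chordal_rot[OF assms] chordal_eq_0_iff[of x y] by auto

lemma hprod_eq_0_iff: "hprod b x = 0 \<longleftrightarrow> x = antipode b"
proof (cases b)
  case None
  then show ?thesis by (cases x) (auto simp: hprod_def)
next
  case (Some a)
  have "w * cnj a + 1 = 0 \<longleftrightarrow> w = - 1 / cnj a" if "a \<noteq> 0" for w
    using that by (metis complex_cnj_zero_iff eq_neg_iff_add_eq_0 nonzero_eq_divide_eq)
  then show ?thesis using Some by (cases x) (auto simp: hprod_def)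
qed

lemma antipode_antipode [simp]: "antipode (antipode b) = b"
  by (cases b) auto

lemma chordal_eq_1_iff: "chordal x b = 1 \<longleftrightarrow> x = antipode b"
proof -
  have "chordal x b = 1 \<longleftrightarrow> cmod (hdet x b) = hnorm x * hnorm b"
    by (auto simp: chordal_eq_hdet field_simps)
  also have "\<dots> \<longleftrightarrow> (cmod (hdet x b))\<^sup>2 = (hnorm x * hnorm b)\<^sup>2"
    by (simp add: power2_eq_iff_nonneg)
  also have "\<dots> \<longleftrightarrow> hprod b x = 0"
    using hdet_hprod[of x b] by (simp add: power_mult_distrib) (smt (verit) norm_eq_zero zero_eq_power2)
  finally show ?thesis by (simp add: hprod_eq_0_iff)
qed

lemma chordal_lt_1_imp: "chordal x b < 1 \<Longrightarrow> hprod b x \<noteq> 0"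
  using chordal_eq_1_iff hprod_eq_0_iff by force

text \<open>On the sphere of diameter one, b and its antipode are the ends of a diameter, so the
  angle at x is right (Thales) and this is Pythagoras.\<close>

lemma chordal_squared_add_antipode: "(chordal x b)\<^sup>2 + (chordal x (antipode b))\<^sup>2 = 1"
proof -
  have a: "cmod (hdet x (antipode b)) * hnorm b = cmod (hprod b x) * hnorm (antipode b)"
  proof -
    have "(cmod (hdet x (antipode b)) * hnorm b)\<^sup>2 = (cmod (hprod b x) * hnorm (antipode b))\<^sup>2"
    proof (cases b)
      case None
      then show ?thesis by (cases x) (simp_all add: hdet_def hprod_def hnorm_def)
    next
      case (Some a)
      have 1: "1 + (cmod a)\<^sup>2 > 0" by (smt (verit) zero_le_power2)
      show ?thesis
      proof (cases "a = 0")
        case True then show ?thesis using Some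
          by (cases x) (simp_all add: hdet_def hprod_def hnorm_def)
      next
        case False
        have "cmod (w + 1 / cnj a) = cmod (1 + w * cnj a) / cmod a" for w
        proof -
          have "w + 1 / cnj a = (1 + w * cnj a) / cnj a" using False by (simp add: field_simps)
          then show ?thesis by (simp add: norm_divide)
        qed
        then show ?thesis using Some False 1
          by (cases x) (simp_all add: hdet_def hprod_def hnorm_def power_mult_distrib norm_divide
               power_divide field_simps)
      qed
    qed
    then show ?thesis by (simp add: power2_eq_iff_nonneg)
  qed
  then have "chordal x (antipode b) = cmod (hprod b x) / (hnorm x * hnorm b)"
    by (simp add: chordal_eq_hdet field_simps)
  then show ?thesis
    using hdet_hprod[of x b]
    by (simp add: chordal_eq_hdet power_divide power_mult_distrib flip: add_divide_distrib)
qed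

lemma chordal_rot_self:
  assumes "hprod b x \<noteq> 0"
  shows "chordal x b = cmod (rot b x) / sqrt (1 + (cmod (rot b x))\<^sup>2)"
  using chordal_rot[OF assms hprod_self] by simp

text \<open>Centring the coordinate at the antipode puts its pole at a. Away from a, the distance to
  a is then a smooth function of the squared modulus of one analytic function, which is what the
  Laplacian computations use.\<close>

lemma chordal_antipode_squared:
  assumes "x \<noteq> a"
  shows "(chordal x a)\<^sup>2 = 1 / (1 + (cmod (rot (antipode a) x))\<^sup>2)"
proof -
  have "hprod (antipode a) x \<noteq> 0" using assms by (simp add: hprod_eq_0_iff)
  then have "(chordal x (antipode a))\<^sup>2 = (cmod (rot (antipode a) x))\<^sup>2 / (1 + (cmod (rot (antipode a) x))\<^sup>2)"
    by (simp add: chordal_rot_self power_divide)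
  moreover have "1 + m > 0 \<Longrightarrow> 1 - m / (1 + m) = 1 / (1 + m)" for m :: real
    by (simp add: field_simps)
  moreover have "1 + (cmod (rot (antipode a) x))\<^sup>2 > 0" by (smt (verit) zero_le_power2)
  ultimately show ?thesis
    using chordal_squared_add_antipode[of x a] by (metis add_diff_cancel_right')
qed

text \<open>The transition from one rotated coordinate to another is the Moebius map with these entries.\<close>

definition mob_num :: "ecomplex \<Rightarrow> ecomplex \<Rightarrow> complex \<Rightarrow> complex" where
  "mob_num b c u = (cnj (hom2 b) * u + hom1 b) * hom2 c - (hom2 b - cnj (hom1 b) * u) * hom1 c"

definition mob_den :: "ecomplex \<Rightarrow> ecomplex \<Rightarrow> complex \<Rightarrow> complex" where
  "mob_den b c u = (cnj (hom2 b) * u + hom1 b) * cnj (hom1 c) + (hom2 b - cnj (hom1 b) * u) * cnj (hom2 c)"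

lemma rot_transition:
  assumes "hprod b x \<noteq> 0"
  shows "mob_den b c (rot b x) = 0 \<longleftrightarrow> hprod c x = 0"
    and "rot c x = mob_num b c (rot b x) / mob_den b c (rot b x)"
proof -
  define N where "N = complex_of_real ((hnorm b)\<^sup>2)"
  have N: "N \<noteq> 0" by (simp add: N_def)
  \<comment> \<open>The coordinate \<open>rot b x\<close> determines the homogeneous coordinates of
    x up to the factor \<open>N / hprod b x\<close>, which cancels in the quotient.\<close>
  have 1: "(cnj (hom2 b) * rot b x + hom1 b) = N * hom1 x / hprod b x"
          "(hom2 b - cnj (hom1 b) * rot b x) = N * hom2 x / hprod b x"
    unfolding N_def of_real_hnorm_squared using assms
    by (simp_all add: rot_def field_simps) (simp_all add: hdet_def hprod_def algebra_simps)
  have den: "mob_den b c (rot b x) = N * hprod c x / hprod b x"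
    unfolding mob_den_def 1 by (simp add: hprod_def[of c] ring_distribs add_divide_distrib mult.assoc)
  have num: "mob_num b c (rot b x) = N * hdet x c / hprod b x"
    unfolding mob_num_def 1 by (simp add: hdet_def[of x c] right_diff_distrib diff_divide_distrib mult_ac)
  show "mob_den b c (rot b x) = 0 \<longleftrightarrow> hprod c x = 0"
    using den N assms by simp
  show "rot c x = mob_num b c (rot b x) / mob_den b c (rot b x)"
    using N assms unfolding den num by (simp add: rot_def[of c])
qed

lemma analytic_mob_num: "mob_num b c analytic_on A"
  unfolding mob_num_def by (intro analytic_intros)

lemma analytic_mob_den: "mob_den b c analytic_on A"
  unfolding mob_den_def by (intro analytic_intros)

text \<open>Chordal distance at most 1/2 from b means
  \<open>1 + (cmod (rot b x))\<^sup>2 \<le> 4/3\<close>, so the two square roots in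
  \<open>chordal_rot\<close> contribute at most 4/3. Together with
  \<open>chordal_le_rot_diff\<close> this transfers estimates between \<chi> and the coordinate
  centred at b.\<close>

lemma rot_diff_le:
  assumes "chordal x b \<le> 1/2" "chordal y b \<le> 1/2"
  shows "cmod (rot b x - rot b y) \<le> 4/3 * chordal x y"
proof -
  have bd: "sqrt (1 + (cmod (rot b x))\<^sup>2) \<le> sqrt (4/3) \<and> hprod b x \<noteq> 0" if "chordal x b \<le> 1/2" for x
  proof -
    have h: "hprod b x \<noteq> 0" using that chordal_lt_1_imp[of x b] by linarith
    have "(chordal x b)\<^sup>2 \<le> (1/2)\<^sup>2" using that by (intro power_mono) auto
    then have "(cmod (rot b x))\<^sup>2 / (1 + (cmod (rot b x))\<^sup>2) \<le> 1/4"
      by (simp add: chordal_rot_self[OF h] power_divide)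
    moreover have "1 + (cmod (rot b x))\<^sup>2 > 0" by (smt (verit) zero_le_power2)
    ultimately have "1 + (cmod (rot b x))\<^sup>2 \<le> 4/3" by (simp add: field_simps)
    then show ?thesis using h by simp
  qed
  let ?p = "sqrt (1 + (cmod (rot b x))\<^sup>2)" and ?q = "sqrt (1 + (cmod (rot b y))\<^sup>2)"
  have pos: "?p > 0" "?q > 0" by (smt (verit) zero_le_power2 real_sqrt_gt_zero)+
  have "cmod (rot b x - rot b y) = chordal x y * (?p * ?q)"
    using chordal_rot[of b x y] bd assms pos by simp
  also have "\<dots> \<le> chordal x y * (sqrt (4/3) * sqrt (4/3))"
    using bd assms pos by (intro mult_left_mono mult_mono) auto
  finally show ?thesis by simp
qed

lemma chordal_le_rot_diff:
  assumes "hprod b x \<noteq> 0" "hprod b y \<noteq> 0"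
  shows "chordal x y \<le> cmod (rot b x - rot b y)"
proof -
  have "1 * 1 \<le> sqrt (1 + (cmod (rot b x))\<^sup>2) * sqrt (1 + (cmod (rot b y))\<^sup>2)"
    by (intro mult_mono) auto
  then show ?thesis
    unfolding chordal_rot[OF assms] by (simp add: divide_le_eq mult_le_cancel_left1)
qed

section \<open>Sphere-valued analytic maps on plane domains\<close>

text \<open>Analyticity of \<open>rot b (h w)\<close> alone would be too weak: division by zero
  gives \<open>rot b\<close> the value 0 at its pole, so any function with values in b and its
  antipode would pass.\<close>

definition sph_analytic :: "(complex \<Rightarrow> ecomplex) \<Rightarrow> complex \<Rightarrow> bool" where
  "sph_analytic h z \<longleftrightarrow>
    (\<exists>b. (\<forall>\<^sub>F w in nhds z. hprod b (h w) \<noteq> 0) \<and> (\<lambda>w. rot b (h w)) analytic_on {z})"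

lemma isCont_eventually_nonzero:
  fixes f :: "'a::t2_space \<Rightarrow> 'b::t1_space"
  assumes "isCont f z" "f z \<noteq> c"
  shows "\<forall>\<^sub>F w in nhds z. f w \<noteq> c"
proof -
  have "\<forall>\<^sub>F w in at z. f w \<noteq> c"
    using assms by (intro tendsto_imp_eventually_ne[where c = "f z"]) (auto simp: isCont_def)
  then show ?thesis using assms(2) by (auto simp: eventually_nhds_conv_at)
qed

text \<open>The coordinate supplied by \<open>sph_analytic\<close> may be exchanged for any whose
  pole is not h z: the transition is a Moebius map whose denominator is nonzero at h z, hence
  nearby.\<close>

lemma sph_analytic_rot:
  assumes "sph_analytic h z" "hprod c (h z) \<noteq> 0"
  shows "\<forall>\<^sub>F w in nhds z. hprod c (h w) \<noteq> 0" and "(\<lambda>w. rot c (h w)) analytic_on {z}"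
proof -
  obtain b where b: "\<forall>\<^sub>F w in nhds z. hprod b (h w) \<noteq> 0" "(\<lambda>w. rot b (h w)) analytic_on {z}"
    using assms(1) by (auto simp: sph_analytic_def)
  have bz: "hprod b (h z) \<noteq> 0" using b(1) by (rule eventually_nhds_x_imp_x)
  have den: "(\<lambda>w. mob_den b c (rot b (h w))) analytic_on {z}"
    using analytic_on_compose[OF b(2) analytic_mob_den] by (simp add: o_def)
  have num: "(\<lambda>w. mob_num b c (rot b (h w))) analytic_on {z}"
    using analytic_on_compose[OF b(2) analytic_mob_num] by (simp add: o_def)
  have nz: "mob_den b c (rot b (h z)) \<noteq> 0" using rot_transition(1)[OF bz] assms(2) by simp
  have "\<forall>\<^sub>F w in nhds z. mob_den b c (rot b (h w)) \<noteq> 0"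
    using analytic_at_imp_isCont[OF den] nz by (rule isCont_eventually_nonzero)
  with b(1) show "\<forall>\<^sub>F w in nhds z. hprod c (h w) \<noteq> 0"
    by eventually_elim (simp add: rot_transition(1))
  have an: "(\<lambda>w. mob_num b c (rot b (h w)) / mob_den b c (rot b (h w))) analytic_on {z}"
    using num den nz by (intro analytic_on_divide) auto
  have ev: "\<forall>\<^sub>F w in nhds z. mob_num b c (rot b (h w)) / mob_den b c (rot b (h w)) = rot c (h w)"
    using b(1) by eventually_elim (rule rot_transition(2)[symmetric])
  show "(\<lambda>w. rot c (h w)) analytic_on {z}"
    by (rule iffD1[OF analytic_at_cong[OF ev refl] an])
qed

lemma sph_analyticI:
  assumes "\<forall>\<^sub>F w in nhds z. hprod b (h w) \<noteq> 0" "(\<lambda>w. rot b (h w)) analytic_on {z}"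
  shows "sph_analytic h z"
  using assms by (auto simp: sph_analytic_def)

lemma sph_analytic_cong:
  assumes "\<forall>\<^sub>F w in nhds z. h w = k w"
  shows "sph_analytic h z \<longleftrightarrow> sph_analytic k z"
proof -
  have "sph_analytic k z" if eq: "\<forall>\<^sub>F w in nhds z. h w = k w" and an: "sph_analytic h z" for h k
  proof -
    obtain b where b: "\<forall>\<^sub>F w in nhds z. hprod b (h w) \<noteq> 0" "(\<lambda>w. rot b (h w)) analytic_on {z}"
      using an by (auto simp: sph_analytic_def)
    show ?thesis
    proof (rule sph_analyticI)
      show "\<forall>\<^sub>F w in nhds z. hprod b (k w) \<noteq> 0"
        using b(1) eq by eventually_elim simp
      have "\<forall>\<^sub>F w in nhds z. rot b (h w) = rot b (k w)"
        using eq by eventually_elim simp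
      then show "(\<lambda>w. rot b (k w)) analytic_on {z}"
        using analytic_at_cong[of "\<lambda>w. rot b (h w)" "\<lambda>w. rot b (k w)" z z] b(2) by simp
    qed
  qed
  from this[of h k] this[of k h] show ?thesis
    using assms by (auto simp: eq_commute)
qed

lemma sph_analytic_compose:
  assumes "sph_analytic h (\<phi> z)" "\<phi> analytic_on {z}"
  shows "sph_analytic (h \<circ> \<phi>) z"
proof -
  obtain b where b: "\<forall>\<^sub>F w in nhds (\<phi> z). hprod b (h w) \<noteq> 0" "(\<lambda>w. rot b (h w)) analytic_on {\<phi> z}"
    using assms(1) by (auto simp: sph_analytic_def)
  have "filterlim \<phi> (nhds (\<phi> z)) (nhds z)"
    using analytic_at_imp_isCont[OF assms(2)] by (simp add: isCont_def tendsto_at_iff_tendsto_nhds)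
  then have "\<forall>\<^sub>F w in nhds z. hprod b (h (\<phi> w)) \<noteq> 0"
    by (rule eventually_compose_filterlim[OF b(1)])
  moreover have "(\<lambda>w. rot b (h (\<phi> w))) analytic_on {z}"
    using analytic_on_compose[OF assms(2), of "\<lambda>w. rot b (h w)"] b(2) by (simp add: o_def)
  ultimately show ?thesis by (intro sph_analyticI) auto
qed

lemma sph_analytic_eventually:
  assumes "sph_analytic h z"
  shows "\<forall>\<^sub>F w in nhds z. sph_analytic h w"
proof -
  obtain b where b: "\<forall>\<^sub>F w in nhds z. hprod b (h w) \<noteq> 0" "(\<lambda>w. rot b (h w)) analytic_on {z}"
    using assms by (auto simp: sph_analytic_def)
  have "\<forall>\<^sub>F w in nhds z. \<forall>\<^sub>F w in nhds w. hprod b (h w) \<noteq> 0"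
    using b(1) by (simp add: eventually_eventually)
  moreover have "\<forall>\<^sub>F w in nhds z. (\<lambda>w. rot b (h w)) analytic_on {w}"
  proof -
    obtain r where r: "r > 0" "(\<lambda>w. rot b (h w)) holomorphic_on ball z r"
      using analytic_at_ball[THEN iffD1, OF b(2)] by blast
    then have "(\<lambda>w. rot b (h w)) analytic_on ball z r" by (simp add: analytic_on_open)
    moreover have "\<forall>\<^sub>F w in nhds z. w \<in> ball z r"
      using r(1) by (intro eventually_nhds_in_open) auto
    ultimately show ?thesis by (auto elim!: eventually_mono intro: analytic_on_subset)
  qed
  ultimately show ?thesis by eventually_elim (auto intro: sph_analyticI)
qed

lemma sph_analytic_stereo:
  assumes "sph_analytic h z"
  shows "isCont (\<lambda>w. stereo (h w)) z"
proof -
  note h = sph_analytic_rot[OF assms hprod_self]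
  have "((\<lambda>w. cmod (rot (h z) (h w) - rot (h z) (h z))) \<longlongrightarrow> cmod (rot (h z) (h z) - rot (h z) (h z))) (at z)"
    using analytic_at_imp_isCont[OF h(2)] unfolding isCont_def by (intro tendsto_intros)
  then have "((\<lambda>w. cmod (rot (h z) (h w) - rot (h z) (h z))) \<longlongrightarrow> 0) (at z)" by simp
  moreover have "\<forall>\<^sub>F w in at z. norm (chordal (h w) (h z)) \<le> cmod (rot (h z) (h w) - rot (h z) (h z))"
    using h(1) unfolding eventually_nhds_conv_at
    by (auto elim!: eventually_mono simp del: rot_self intro!: chordal_le_rot_diff hprod_self)
  ultimately have "((\<lambda>w. chordal (h w) (h z)) \<longlongrightarrow> 0) (at z)"
    by (rule Lim_null_comparison[rotated])
  then show ?thesis unfolding isCont_def chordal_eq_dist by (rule tendsto_dist_iff[THEN iffD2])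
qed

lemma isCont_chordal:
  assumes "sph_analytic h z"
  shows "isCont (\<lambda>w. chordal (h w) a) z"
  unfolding chordal_eq_dist by (intro continuous_dist continuous_const sph_analytic_stereo[OF assms])

section \<open>The spherical derivative\<close>

text \<open>The coordinate \<open>rot (h z)\<close> vanishes at \<open>h z\<close>, so the usual denominator equals \<open>1\<close> here.\<close>

definition sph_deriv :: "(complex \<Rightarrow> ecomplex) \<Rightarrow> complex \<Rightarrow> real" where
  "sph_deriv h z = cmod (deriv (\<lambda>w. rot (h z) (h w)) z)"

text \<open>The left-hand side does not mention b, so uniqueness of limits makes the right-hand side
  the same for all admissible coordinates; \<open>sph_deriv_rot\<close> is obtained in this
  way.\<close>

lemma chordal_quotient_tendsto_rot:
  assumes "sph_analytic h z" "hprod b (h z) \<noteq> 0"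
  shows "((\<lambda>w. chordal (h w) (h z) / cmod (w - z)) \<longlongrightarrow>
           cmod (deriv (\<lambda>w. rot b (h w)) z) / (1 + (cmod (rot b (h z)))\<^sup>2)) (at z)"
proof -
  note h = sph_analytic_rot[OF assms]
  define k where "k = (\<lambda>w. rot b (h w))"
  have D: "(k has_field_derivative deriv k z) (at z)"
    using h(2) unfolding k_def by (meson analytic_at_imp_isCont analytic_on_imp_differentiable_at
        field_differentiable_derivI singletonI)
  then have 1: "((\<lambda>w. (k w - k z) / (w - z)) \<longlongrightarrow> deriv k z) (at z)"
    by (simp add: has_field_derivative_iff)
  have c: "(k \<longlongrightarrow> k z) (at z)"
    using analytic_at_imp_isCont[OF h(2)] by (simp add: k_def isCont_def)
  have pos: "sqrt (1 + (cmod (k z))\<^sup>2) * sqrt (1 + (cmod (k z))\<^sup>2) = 1 + (cmod (k z))\<^sup>2"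
    by simp
  have nz: "1 + (cmod (k z))\<^sup>2 \<noteq> 0" by (smt (verit) zero_le_power2)
  have "((\<lambda>w. cmod ((k w - k z) / (w - z)) / (sqrt (1 + (cmod (k w))\<^sup>2) * sqrt (1 + (cmod (k z))\<^sup>2)))
     \<longlongrightarrow> cmod (deriv k z) / (sqrt (1 + (cmod (k z))\<^sup>2) * sqrt (1 + (cmod (k z))\<^sup>2))) (at z)"
    by (intro tendsto_intros 1 c) (use pos nz in simp)
  then have lim: "((\<lambda>w. cmod ((k w - k z) / (w - z)) / (sqrt (1 + (cmod (k w))\<^sup>2) * sqrt (1 + (cmod (k z))\<^sup>2)))
     \<longlongrightarrow> cmod (deriv k z) / (1 + (cmod (k z))\<^sup>2)) (at z)"
    by (simp only: pos)
  have ev: "\<forall>\<^sub>F w in at z. cmod ((k w - k z) / (w - z)) / (sqrt (1 + (cmod (k w))\<^sup>2) * sqrt (1 + (cmod (k z))\<^sup>2))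
       = chordal (h w) (h z) / cmod (w - z)"
    using h(1) unfolding eventually_nhds_conv_at
    by (auto elim!: eventually_mono simp: chordal_rot assms(2) k_def norm_divide)
  show ?thesis
    using Lim_transform_eventually[OF lim ev] by (simp add: k_def)
qed

lemma sph_deriv_rot:
  assumes "sph_analytic h z" "hprod b (h z) \<noteq> 0"
  shows "sph_deriv h z = cmod (deriv (\<lambda>w. rot b (h w)) z) / (1 + (cmod (rot b (h z)))\<^sup>2)"
proof -
  have "sph_deriv h z = cmod (deriv (\<lambda>w. rot (h z) (h w)) z) / (1 + (cmod (rot (h z) (h z)))\<^sup>2)"
    by (simp add: sph_deriv_def)
  then show ?thesis
    using tendsto_unique[OF at_neq_bot chordal_quotient_tendsto_rot[OF assms]
      chordal_quotient_tendsto_rot[OF assms(1) hprod_self]] by (rule trans[OF _ sym])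
qed

lemma chordal_quotient_tendsto:
  assumes "sph_analytic h z"
  shows "((\<lambda>w. chordal (h w) (h z) / cmod (w - z)) \<longlongrightarrow> sph_deriv h z) (at z)"
  using chordal_quotient_tendsto_rot[OF assms hprod_self] by (simp add: sph_deriv_def)

lemma sph_deriv_nonneg [simp]: "sph_deriv h z \<ge> 0"
  by (simp add: sph_deriv_def)

text \<open>In the definition of \<open>sph_deriv\<close> the coordinate moves with the point.
  Freezing it at b = h z gives an expression that is visibly continuous near z.\<close>

lemma isCont_sph_deriv:
  assumes "sph_analytic h z"
  shows "isCont (sph_deriv h) z"
proof -
  define b where "b = h z"
  have hb: "hprod b (h z) \<noteq> 0" by (simp add: b_def hprod_self)
  note h = sph_analytic_rot[OF assms hb]
  have "\<forall>\<^sub>F w in nhds z. sph_deriv h w = cmod (deriv (\<lambda>w. rot b (h w)) w) / (1 + (cmod (rot b (h w)))\<^sup>2)"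
    using sph_analytic_eventually[OF assms] h(1) by eventually_elim (rule sph_deriv_rot)
  moreover have "isCont (\<lambda>w. cmod (deriv (\<lambda>w. rot b (h w)) w) / (1 + (cmod (rot b (h w)))\<^sup>2)) z"
    using analytic_at_imp_isCont[OF h(2)] analytic_at_imp_isCont[OF analytic_deriv[OF h(2)]]
    by (intro continuous_intros) (auto simp: b_def)
  ultimately show ?thesis by (subst isCont_cong)
qed

text \<open>A mean value inequality with values in a metric space. The local bound of slope M + e'
  adds up along the segment by the triangle inequality, and the bisection principle
  \<open>Bolzano\<close> makes it global.\<close>

lemma chordal_le_of_sph_deriv_le:
  assumes "convex D" "\<And>z. z \<in> D \<Longrightarrow> sph_analytic h z" "\<And>z. z \<in> D \<Longrightarrow> sph_deriv h z \<le> M"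
    and xy: "x \<in> D" "y \<in> D"
  shows "chordal (h x) (h y) \<le> M * cmod (x - y)"
proof (rule field_le_epsilon)
  fix e :: real assume "e > 0"
  define p where "p t = x + of_real t * (y - x)" for t :: real
  \<comment> \<open>The total excess e' |x - y| stays below e, and the summand 1 covers x =
    y.\<close>
  define e' where "e' = e / (1 + cmod (x - y))"
  have e': "e' > 0" using \<open>e > 0\<close> by (simp add: e'_def add_pos_nonneg)
  have pD: "p t \<in> D" if "0 \<le> t" "t \<le> 1" for t
    using convexD_alt[OF assms(1) xy that] by (simp add: p_def scaleR_conv_of_real algebra_simps)
  define L where "L = (M + e') * cmod (x - y)"
  have pd: "cmod (p s - p t) = \<bar>s - t\<bar> * cmod (x - y)" for s t
  proof -
    have "p s - p t = of_real (s - t) * (y - x)" by (simp add: p_def algebra_simps)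
    then show ?thesis by (simp add: norm_mult norm_minus_commute del: of_real_diff)
  qed
  define P where "P a b \<longleftrightarrow> (0 \<le> a \<and> b \<le> 1 \<longrightarrow> chordal (h (p a)) (h (p b)) \<le> L * (b - a))" for a b
  have "P 0 1"
  proof (rule Bolzano)
    fix a b c assume "P a b" "P b c" "a \<le> b" "b \<le> c"
    then show "P a c"
      using chordal_triangle[of "h (p a)" "h (p c)" "h (p b)"]
      by (auto simp: P_def algebra_simps)
  next
    fix t :: real assume t: "0 \<le> t" "t \<le> 1"
    have an: "sph_analytic h (p t)" using pD[OF t] assms(2) by blast
    have "\<forall>\<^sub>F w in at (p t). chordal (h w) (h (p t)) / cmod (w - p t) < M + e'"
      by (rule order_tendstoD(2)[OF chordal_quotient_tendsto[OF an]])
         (use assms(3)[OF pD[OF t]] e' in linarith)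
    then obtain d where d: "d > 0" "\<And>w. w \<noteq> p t \<Longrightarrow> dist w (p t) < d \<Longrightarrow> chordal (h w) (h (p t)) / cmod (w - p t) < M + e'"
      unfolding eventually_at by auto
    have le: "chordal (h w) (h (p t)) \<le> (M + e') * cmod (w - p t)" if "dist w (p t) < d" for w
    proof (cases "w = p t")
      case False
      then show ?thesis using d(2)[OF False that] by (simp add: field_simps)
    qed auto
    define d' where "d' = d / (1 + cmod (x - y))"
    have d': "d' > 0" using d(1) by (simp add: d'_def add_pos_nonneg)
    have le': "chordal (h (p s)) (h (p t)) \<le> L * \<bar>s - t\<bar>" if "\<bar>s - t\<bar> < d'" for s
    proof -
      have "\<bar>s - t\<bar> * cmod (x - y) \<le> \<bar>s - t\<bar> * (1 + cmod (x - y))" by (intro mult_left_mono) auto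
      also have "\<dots> < d" using that by (simp add: d'_def field_simps add_pos_nonneg)
      finally have "dist (p s) (p t) < d" by (simp add: dist_norm pd)
      from le[OF this] show ?thesis by (simp add: pd L_def mult_ac)
    qed
    show "\<exists>d>0. \<forall>a b. a \<le> t \<and> t \<le> b \<and> b - a < d \<longrightarrow> P a b"
    proof (intro exI[of _ d'] conjI allI impI d')
      fix a b assume ab: "a \<le> t \<and> t \<le> b \<and> b - a < d'"
      have "chordal (h (p a)) (h (p b)) \<le> L * \<bar>a - t\<bar> + L * \<bar>b - t\<bar>"
        using chordal_triangle[of "h (p a)" "h (p b)" "h (p t)"] le'[of a] le'[of b] ab
          chordal_commute[of "h (p t)" "h (p b)"] by linarith
      then show "P a b" using ab by (auto simp: P_def algebra_simps)
    qed
  qed auto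
  then have "chordal (h x) (h y) \<le> L" by (simp add: P_def p_def)
  also have "L = M * cmod (x - y) + e * (cmod (x - y) / (1 + cmod (x - y)))"
    by (simp add: L_def e'_def algebra_simps)
  also have "\<dots> \<le> M * cmod (x - y) + e * 1"
    using \<open>e > 0\<close> by (intro add_left_mono mult_left_mono) (auto simp: add_pos_nonneg)
  finally show "chordal (h x) (h y) \<le> M * cmod (x - y) + e" by simp
qed

section \<open>Ramification\<close>

text \<open>
  Stated with the chordal distance, ramification is invariant under changes of coordinates and is
  inherited by compositions.
\<close>

definition ramified :: "(complex \<Rightarrow> ecomplex) \<Rightarrow> complex \<Rightarrow> nat \<Rightarrow> bool" where
  "ramified h z m \<longleftrightarrow> (\<exists>C. \<forall>\<^sub>F w in nhds z. chordal (h w) (h z) \<le> C * cmod (w - z) ^ m)"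

lemma ramified_const:
  assumes "\<forall>\<^sub>F w in nhds x. h w = h x"
  shows "ramified h x m"
proof -
  have "\<forall>\<^sub>F w in nhds x. chordal (h w) (h x) \<le> 0 * cmod (w - x) ^ m"
    using assms by eventually_elim simp
  then show ?thesis unfolding ramified_def by blast
qed

text \<open>Dividing by |w - z|^n, a bound with m > n would force G to tend to 0 at z.\<close>

lemma power_bound_iff:
  fixes F G :: "complex \<Rightarrow> complex"
  assumes "\<forall>\<^sub>F w in nhds z. F w = (w - z) ^ n * G w" "isCont G z" "G z \<noteq> 0"
  shows "(\<exists>C. \<forall>\<^sub>F w in nhds z. cmod (F w) \<le> C * cmod (w - z) ^ m) \<longleftrightarrow> m \<le> n"
proof
  assume "m \<le> n"
  have "\<forall>\<^sub>F w in at z. cmod (G w) < cmod (G z) + 1"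
    using assms(2) by (intro order_tendstoD(2)[of _ "cmod (G z)"]) (auto simp: isCont_def intro: tendsto_norm)
  then have G: "\<forall>\<^sub>F w in nhds z. cmod (G w) < cmod (G z) + 1"
    by (simp add: eventually_nhds_conv_at)
  have "\<forall>\<^sub>F w in nhds z. dist w z < 1"
    unfolding eventually_nhds_metric by (auto intro!: exI[of _ 1])
  with G assms(1) have "\<forall>\<^sub>F w in nhds z. cmod (F w) \<le> (cmod (G z) + 1) * cmod (w - z) ^ m"
  proof eventually_elim
    case (elim w)
    have "cmod (w - z) ^ n \<le> cmod (w - z) ^ m"
      using elim \<open>m \<le> n\<close> by (intro power_decreasing) (auto simp: dist_norm)
    then have "cmod (w - z) ^ n * cmod (G w) \<le> cmod (w - z) ^ m * (cmod (G z) + 1)"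
      using elim by (intro mult_mono) auto
    then show ?case using elim by (simp add: norm_mult norm_power mult.commute)
  qed
  then show "\<exists>C. \<forall>\<^sub>F w in nhds z. cmod (F w) \<le> C * cmod (w - z) ^ m" by blast
next
  assume "\<exists>C. \<forall>\<^sub>F w in nhds z. cmod (F w) \<le> C * cmod (w - z) ^ m"
  then obtain C where C: "\<forall>\<^sub>F w in nhds z. cmod (F w) \<le> C * cmod (w - z) ^ m" by blast
  show "m \<le> n"
  proof (rule ccontr)
    assume "\<not> m \<le> n"
    then have mn: "m = n + (m - n)" "m - n > 0" by auto
    have "\<forall>\<^sub>F w in at z. w \<noteq> z" by (simp add: eventually_at_filter)
    moreover have "\<forall>\<^sub>F w in at z. F w = (w - z) ^ n * G w" "\<forall>\<^sub>F w in at z. cmod (F w) \<le> C * cmod (w - z) ^ m"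
      using assms(1) C by (auto simp: eventually_nhds_conv_at)
    ultimately have "\<forall>\<^sub>F w in at z. norm (G w) \<le> C * cmod (w - z) ^ (m - n)"
    proof eventually_elim
      case (elim w)
      have "cmod (w - z) ^ n * cmod (G w) \<le> cmod (w - z) ^ n * (C * cmod (w - z) ^ (m - n))"
      proof -
        have "cmod (w - z) ^ m = cmod (w - z) ^ n * cmod (w - z) ^ (m - n)"
          using mn(1) by (metis power_add)
        then show ?thesis using elim by (simp add: norm_mult norm_power mult_ac)
      qed
      then show ?case using elim by simp
    qed
    moreover have "((\<lambda>w. C * cmod (w - z) ^ (m - n)) \<longlongrightarrow> C * cmod (z - z) ^ (m - n)) (at z)"
      by (intro tendsto_intros)
    then have "((\<lambda>w. C * cmod (w - z) ^ (m - n)) \<longlongrightarrow> 0) (at z)" using mn(2) by (simp add: power_0_left)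
    ultimately have "(G \<longlongrightarrow> 0) (at z)" by (rule Lim_null_comparison)
    then show False using assms(2,3) LIM_unique unfolding isCont_def by blast
  qed
qed

lemma analytic_order_cases:
  assumes "F analytic_on {z}" "F z = (0 :: complex)"
  obtains (zero) "\<forall>\<^sub>F w in nhds z. F w = 0" "\<And>i. (deriv ^^ i) F z = 0"
  | (order) n G where "n > 0" "G analytic_on {z}" "G z \<noteq> 0"
      "\<forall>\<^sub>F w in nhds z. F w = (w - z) ^ n * G w"
      "\<And>i. i < n \<Longrightarrow> (deriv ^^ i) F z = 0" "(deriv ^^ n) F z \<noteq> 0"
proof -
  obtain r where r: "r > 0" "F holomorphic_on ball z r"
    using analytic_at_ball[THEN iffD1, OF assms(1)] by blast
  show ?thesis
  proof (cases "\<forall>i. (deriv ^^ i) F z = 0")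
    case True
    have "F w = 0" if "w \<in> ball z r" for w
      by (rule holomorphic_fun_eq_0_on_ball[OF r(2) that]) (use True in auto)
    moreover have "\<forall>\<^sub>F w in nhds z. w \<in> ball z r"
      using r(1) by (intro eventually_nhds_in_open) auto
    ultimately show ?thesis using True by (intro zero) (auto elim: eventually_mono)
  next
    case False
    define n where "n = (LEAST i. (deriv ^^ i) F z \<noteq> 0)"
    have n: "(deriv ^^ n) F z \<noteq> 0" unfolding n_def using LeastI_ex[of "\<lambda>i. (deriv ^^ i) F z \<noteq> 0"] False by blast
    have less: "(deriv ^^ i) F z = 0" if "i < n" for i
      using that not_less_Least unfolding n_def by blast
    have "n > 0" using n assms(2) by (cases n) auto
    obtain G s where G: "0 < s" "G holomorphic_on ball z s"
      "\<And>w. w \<in> ball z s \<Longrightarrow> F w - F z = (w - z) ^ n * G w" "\<And>w. w \<in> ball z s \<Longrightarrow> G w \<noteq> 0"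
      using holomorphic_factor_order_of_zero[OF r(2) _ _ \<open>n > 0\<close> n] r(1) less by (metis centre_in_ball open_ball)
    have "\<forall>\<^sub>F w in nhds z. w \<in> ball z s"
      using G(1) by (intro eventually_nhds_in_open) auto
    then have "\<forall>\<^sub>F w in nhds z. F w = (w - z) ^ n * G w"
      using G(3) assms(2) by (auto elim: eventually_mono)
    moreover have "G analytic_on {z}"
      using G(1,2) analytic_at_ball[THEN iffD2] by blast
    ultimately show ?thesis
      using G(1) G(4)[of z] n less \<open>n > 0\<close> by (intro order[of n G]) auto
  qed
qed

lemma analytic_power_bound:
  assumes "F analytic_on {z}" "\<And>i. i < m \<Longrightarrow> (deriv ^^ i) F z = 0" "m > 0"
  obtains C where "\<forall>\<^sub>F w in nhds z. cmod (F w) \<le> C * cmod (w - z) ^ m"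
proof -
  have "F z = 0" using assms(2)[of 0] assms(3) by simp
  with assms(1) show ?thesis
  proof (cases rule: analytic_order_cases)
    case zero
    then show ?thesis by (intro that[of 0]) (auto elim: eventually_mono)
  next
    case (order n G)
    have "m \<le> n" using assms(2) order(6) by (meson not_le)
    then have "\<exists>C. \<forall>\<^sub>F w in nhds z. cmod (F w) \<le> C * cmod (w - z) ^ m"
      using power_bound_iff[OF order(4)] analytic_at_imp_isCont[OF order(2)] order(3) by blast
    then show ?thesis using that by blast
  qed
qed

lemma ramified_iff_bound:
  assumes "sph_analytic h z"
  shows "ramified h z m \<longleftrightarrow> (\<exists>C. \<forall>\<^sub>F w in nhds z. cmod (rot (h z) (h w)) \<le> C * cmod (w - z) ^ m)"
proof
  assume "ramified h z m"
  then obtain C where C: "\<forall>\<^sub>F w in nhds z. chordal (h w) (h z) \<le> C * cmod (w - z) ^ m"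
    by (auto simp: ramified_def)
  have "\<forall>\<^sub>F w in nhds z. chordal (h w) (h z) < 1/2"
    using order_tendstoD(2)[of "\<lambda>w. chordal (h w) (h z)" 0 "at z" "1/2"]
      isCont_chordal[OF assms, of "h z"]
    by (auto simp: isCont_def eventually_nhds_conv_at)
  with C have "\<forall>\<^sub>F w in nhds z. cmod (rot (h z) (h w)) \<le> (4/3 * C) * cmod (w - z) ^ m"
  proof eventually_elim
    case (elim w)
    then show ?case using rot_diff_le[of "h w" "h z" "h z"] chordal_eq_0_iff[of "h z" "h z"] by auto
  qed
  then show "\<exists>C. \<forall>\<^sub>F w in nhds z. cmod (rot (h z) (h w)) \<le> C * cmod (w - z) ^ m" by blast
next
  assume "\<exists>C. \<forall>\<^sub>F w in nhds z. cmod (rot (h z) (h w)) \<le> C * cmod (w - z) ^ m"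
  then obtain C where C: "\<forall>\<^sub>F w in nhds z. cmod (rot (h z) (h w)) \<le> C * cmod (w - z) ^ m" by blast
  have "\<forall>\<^sub>F w in nhds z. chordal (h w) (h z) \<le> C * cmod (w - z) ^ m"
    using C sph_analytic_rot(1)[OF assms hprod_self]
    by eventually_elim (use chordal_le_rot_diff[OF _ hprod_self] in force)
  then show "ramified h z m" by (auto simp: ramified_def)
qed

text \<open>The growth condition suits compositions; vanishing of derivatives is the form that
  survives small uniform perturbations, by Cauchy's inequality.\<close>

lemma ramified_iff_derivs:
  assumes "sph_analytic h z"
  shows "ramified h z m \<longleftrightarrow> (\<forall>i<m. (deriv ^^ i) (\<lambda>w. rot (h z) (h w)) z = 0)"
  using sph_analytic_rot(2)[OF assms hprod_self] rot_self
proof (cases rule: analytic_order_cases)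
  case zero
  then show ?thesis by (auto simp: ramified_iff_bound[OF assms] intro!: exI[of _ 0] elim: eventually_mono)
next
  case (order n G)
  have "ramified h z m \<longleftrightarrow> m \<le> n"
    unfolding ramified_iff_bound[OF assms]
    by (rule power_bound_iff[OF order(4)]) (use order analytic_at_imp_isCont in auto)
  also have "\<dots> \<longleftrightarrow> (\<forall>i<m. (deriv ^^ i) (\<lambda>w. rot (h z) (h w)) z = 0)"
    using order(5,6) by (meson le_less_linear less_le_trans)
  finally show ?thesis .
qed

lemma ramified_compose:
  assumes "ramified h (\<phi> z) m" "\<phi> analytic_on {z}"
  shows "ramified (h \<circ> \<phi>) z m"
proof -
  obtain C where C: "\<forall>\<^sub>F w in nhds (\<phi> z). chordal (h w) (h (\<phi> z)) \<le> C * cmod (w - \<phi> z) ^ m"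
    using assms(1) by (auto simp: ramified_def)
  have cont: "filterlim \<phi> (nhds (\<phi> z)) (nhds z)"
    using analytic_at_imp_isCont[OF assms(2)] by (simp add: isCont_def tendsto_at_iff_tendsto_nhds)
  have C': "\<forall>\<^sub>F w in nhds z. chordal (h (\<phi> w)) (h (\<phi> z)) \<le> C * cmod (\<phi> w - \<phi> z) ^ m"
    by (rule eventually_compose_filterlim[OF C cont])
  have "(\<phi> has_field_derivative deriv \<phi> z) (at z)"
    using assms(2) by (meson analytic_on_imp_differentiable_at field_differentiable_derivI singletonI)
  then have "((\<lambda>w. cmod ((\<phi> w - \<phi> z) / (w - z))) \<longlongrightarrow> cmod (deriv \<phi> z)) (at z)"
    by (intro tendsto_norm) (simp add: has_field_derivative_iff)
  then have "\<forall>\<^sub>F w in at z. cmod ((\<phi> w - \<phi> z) / (w - z)) < cmod (deriv \<phi> z) + 1"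
    by (rule order_tendstoD(2)) simp
  moreover have "\<forall>\<^sub>F w in at z. w \<noteq> z" by (simp add: eventually_at_filter)
  ultimately have "\<forall>\<^sub>F w in at z. cmod (\<phi> w - \<phi> z) \<le> (cmod (deriv \<phi> z) + 1) * cmod (w - z)"
    by eventually_elim (simp add: norm_divide field_simps)
  then have "\<forall>\<^sub>F w in nhds z. cmod (\<phi> w - \<phi> z) \<le> (cmod (deriv \<phi> z) + 1) * cmod (w - z)"
    by (simp add: eventually_nhds_conv_at)
  with C' have "\<forall>\<^sub>F w in nhds z. chordal (h (\<phi> w)) (h (\<phi> z)) \<le> (\<bar>C\<bar> * (cmod (deriv \<phi> z) + 1) ^ m) * cmod (w - z) ^ m"
  proof eventually_elim
    case (elim w)
    have "C * cmod (\<phi> w - \<phi> z) ^ m \<le> \<bar>C\<bar> * ((cmod (deriv \<phi> z) + 1) * cmod (w - z)) ^ m"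
      using elim(2) by (intro mult_mono power_mono) auto
    then show ?case using elim(1) by (simp add: power_mult_distrib mult.assoc)
  qed
  then show ?thesis by (auto simp: ramified_def)
qed

lemma ramified_cong:
  assumes "\<forall>\<^sub>F w in nhds z. h w = k w"
  shows "ramified h z m \<longleftrightarrow> ramified k z m"
proof -
  have "h z = k z" using assms by (rule eventually_nhds_x_imp_x)
  then have "(\<forall>\<^sub>F w in nhds z. chordal (h w) (h z) \<le> C * cmod (w - z) ^ m) \<longleftrightarrow>
      (\<forall>\<^sub>F w in nhds z. chordal (k w) (k z) \<le> C * cmod (w - z) ^ m)" for C
    using assms \<open>h z = k z\<close> by (intro eventually_cong) (auto elim: eventually_mono)
  then show ?thesis by (simp add: ramified_def)
qed

section \<open>Laplacians at a point\<close>

definition second_deriv :: "(real \<Rightarrow> real) \<Rightarrow> real \<Rightarrow> real \<Rightarrow> bool" where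
  "second_deriv f a b \<longleftrightarrow>
    (\<exists>f'. (\<forall>\<^sub>F s in nhds 0. (f has_real_derivative f' s) (at s)) \<and> f' 0 = a \<and>
          (f' has_real_derivative b) (at 0))"

lemma second_deriv_add:
  assumes "second_deriv f a b" "second_deriv g c d"
  shows "second_deriv (\<lambda>s. f s + g s) (a + c) (b + d)"
proof -
  obtain f' g' where f: "\<forall>\<^sub>F s in nhds 0. (f has_real_derivative f' s) (at s)" "f' 0 = a" "(f' has_real_derivative b) (at 0)"
    and g: "\<forall>\<^sub>F s in nhds 0. (g has_real_derivative g' s) (at s)" "g' 0 = c" "(g' has_real_derivative d) (at 0)"
    using assms unfolding second_deriv_def by blast
  have "\<forall>\<^sub>F s in nhds 0. ((\<lambda>s. f s + g s) has_real_derivative f' s + g' s) (at s)"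
    using f(1) g(1) by eventually_elim (rule DERIV_add)
  then show ?thesis
    unfolding second_deriv_def using f g by (intro exI[of _ "\<lambda>s. f' s + g' s"]) (auto intro: DERIV_add)
qed

lemma second_deriv_compose:
  assumes "second_deriv f a b"
    and "\<forall>\<^sub>F v in nhds (f 0). (F has_real_derivative F' v) (at v)"
    and "(F' has_real_derivative F2) (at (f 0))"
  shows "second_deriv (\<lambda>s. F (f s)) (F' (f 0) * a) (F2 * a\<^sup>2 + F' (f 0) * b)"
proof -
  obtain f' where f: "\<forall>\<^sub>F s in nhds 0. (f has_real_derivative f' s) (at s)" "f' 0 = a" "(f' has_real_derivative b) (at 0)"
    using assms(1) unfolding second_deriv_def by blast
  have D0: "(f has_real_derivative a) (at 0)"
    using eventually_nhds_x_imp_x[OF f(1)] f(2) by simp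
  have "filterlim f (nhds (f 0)) (nhds 0)"
    using DERIV_isCont[OF D0] by (simp add: isCont_def tendsto_at_iff_tendsto_nhds)
  from eventually_compose_filterlim[OF assms(2) this] f(1)
  have "\<forall>\<^sub>F s in nhds 0. ((\<lambda>s. F (f s)) has_real_derivative F' (f s) * f' s) (at s)"
    by eventually_elim (rule DERIV_chain2)
  moreover have "((\<lambda>s. F' (f s) * f' s) has_real_derivative (F2 * a) * f' 0 + b * F' (f 0)) (at 0)"
    by (rule DERIV_mult[OF DERIV_chain2[OF assms(3) D0] f(3)])
  then have "((\<lambda>s. F' (f s) * f' s) has_real_derivative F2 * a\<^sup>2 + F' (f 0) * b) (at 0)"
    by (simp add: f(2) power2_eq_square mult_ac)
  ultimately show ?thesis
    unfolding second_deriv_def using f(2) by (intro exI[of _ "\<lambda>s. F' (f s) * f' s"]) auto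
qed

lemma second_deriv_cong:
  assumes "\<forall>\<^sub>F s in nhds 0. f s = g s" "second_deriv f a b"
  shows "second_deriv g a b"
proof -
  obtain f' where f: "\<forall>\<^sub>F s in nhds 0. (f has_real_derivative f' s) (at s)" "f' 0 = a" "(f' has_real_derivative b) (at 0)"
    using assms(2) unfolding second_deriv_def by blast
  have "\<forall>\<^sub>F s in nhds 0. \<forall>\<^sub>F s' in nhds s. f s' = g s'"
    using assms(1) by (simp add: eventually_eventually)
  with f(1) have "\<forall>\<^sub>F s in nhds 0. (g has_real_derivative f' s) (at s)"
    by eventually_elim (use DERIV_cong_ev in blast)
  with f show ?thesis unfolding second_deriv_def by blast
qed

text \<open>At the maximum the first derivative vanishes. If b were positive, the derivative would
  be positive just to the right of 0, and f would increase there by the mean value theorem.\<close>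

lemma second_deriv_max:
  assumes "second_deriv f a b" and max: "\<forall>\<^sub>F s in nhds 0. f s \<le> f 0"
  shows "b \<le> 0"
proof (rule ccontr)
  assume "\<not> b \<le> 0"
  obtain f' where f: "\<forall>\<^sub>F s in nhds 0. (f has_real_derivative f' s) (at s)" "f' 0 = a" "(f' has_real_derivative b) (at 0)"
    using assms(1) unfolding second_deriv_def by blast
  have D0: "(f has_real_derivative a) (at 0)"
    using eventually_nhds_x_imp_x[OF f(1)] f(2) by simp
  obtain d where d: "d > 0" "\<And>s. \<bar>s\<bar> < d \<Longrightarrow> f s \<le> f 0 \<and> (f has_real_derivative f' s) (at s)"
    using eventually_conj[OF max f(1)] unfolding eventually_nhds_metric by (auto simp: dist_real_def)
  have "a = 0"
    by (rule DERIV_local_max[OF D0 d(1)]) (use d(2) in auto)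
  obtain e where e: "e > 0" "\<And>h. 0 < h \<Longrightarrow> h < e \<Longrightarrow> f' 0 < f' (0 + h)"
    using DERIV_pos_inc_right[OF f(3)] \<open>\<not> b \<le> 0\<close> by auto
  define s where "s = min d e / 2"
  have s: "0 < s" "s < d" "s < e" using d(1) e(1) by (auto simp: s_def min_def)
  obtain x where x: "0 < x" "x < s" "f s - f 0 = (s - 0) * f' x"
    using MVT2[of 0 s f f'] s d(2) by auto
  have "f' x > 0" using e(2)[of x] x s \<open>a = 0\<close> f(2) by auto
  then have "f s > f 0" using x s by (smt (verit) mult_pos_pos)
  then show False using d(2)[of s] s by auto
qed

lemma deriv_along_line:
  assumes "(H has_field_derivative D) (at (z + of_real s * d))"
  shows "((\<lambda>s. Re (H (z + of_real s * d))) has_real_derivative Re (D * d)) (at s)"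
    and "((\<lambda>s. Im (H (z + of_real s * d))) has_real_derivative Im (D * d)) (at s)"
proof -
  have "((\<lambda>u. H (z + u * d)) has_field_derivative D * d) (at (of_real s))"
    by (rule DERIV_chain2[where f = H and g = "\<lambda>u. z + u * d" and x = "of_real s", OF assms])
      (auto intro!: derivative_eq_intros)
  then have *: "((\<lambda>s. H (z + of_real s * d)) has_vector_derivative D * d) (at s)"
    by (rule has_vector_derivative_real_field)
  show "((\<lambda>s. Re (H (z + of_real s * d))) has_real_derivative Re (D * d)) (at s)"
    using bounded_linear.has_vector_derivative[OF bounded_linear_Re *]
    by (simp add: has_real_derivative_iff_has_vector_derivative)
  show "((\<lambda>s. Im (H (z + of_real s * d))) has_real_derivative Im (D * d)) (at s)"
    using bounded_linear.has_vector_derivative[OF bounded_linear_Im *]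
    by (simp add: has_real_derivative_iff_has_vector_derivative)
qed

lemma filterlim_line: "filterlim (\<lambda>s. z + of_real s * d) (nhds (z :: complex)) (nhds (0 :: real))"
proof -
  have "((\<lambda>s. z + of_real s * d) \<longlongrightarrow> z + of_real 0 * d) (at 0)" by (intro tendsto_intros)
  then show ?thesis
    using tendsto_at_iff_tendsto_nhds[of "\<lambda>s. z + of_real s * d" 0] by simp
qed

lemma second_deriv_analytic_along_line:
  assumes "H analytic_on {z}"
  shows "second_deriv (\<lambda>s. Re (H (z + of_real s * d))) (Re (deriv H z * d)) (Re (deriv (deriv H) z * d * d))"
    and "second_deriv (\<lambda>s. Im (H (z + of_real s * d))) (Im (deriv H z * d)) (Im (deriv (deriv H) z * d * d))"
proof -
  obtain r where r: "r > 0" "H holomorphic_on ball z r"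
    using analytic_at_ball[THEN iffD1, OF assms] by blast
  have "\<forall>\<^sub>F w in nhds z. w \<in> ball z r"
    using r(1) by (intro eventually_nhds_in_open) auto
  from eventually_compose_filterlim[OF this filterlim_line]
  have ev: "\<forall>\<^sub>F s in nhds 0. z + of_real s * d \<in> ball z r" .
  have 1: "\<forall>\<^sub>F s in nhds 0. (H has_field_derivative deriv H (z + of_real s * d)) (at (z + of_real s * d))"
    using ev by eventually_elim (use r holomorphic_derivI open_ball in blast)
  have "(deriv H has_field_derivative deriv (deriv H) z) (at (z + of_real 0 * d))"
    using r holomorphic_derivI[OF holomorphic_deriv[OF r(2) open_ball] open_ball] by simp
  note 2 = deriv_along_line[OF DERIV_cmult_right[OF this, of d]]
  show "second_deriv (\<lambda>s. Re (H (z + of_real s * d))) (Re (deriv H z * d)) (Re (deriv (deriv H) z * d * d))"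
    unfolding second_deriv_def
    using 2(1) eventually_mono[OF 1 deriv_along_line(1)]
    by (intro exI[of _ "\<lambda>s. Re (deriv H (z + of_real s * d) * d)"]) auto
  show "second_deriv (\<lambda>s. Im (H (z + of_real s * d))) (Im (deriv H z * d)) (Im (deriv (deriv H) z * d * d))"
    unfolding second_deriv_def
    using 2(2) eventually_mono[OF 1 deriv_along_line(2)]
    by (intro exI[of _ "\<lambda>s. Im (deriv H (z + of_real s * d) * d)"]) auto
qed

text \<open>A relation rather than a function, so that existence and value pass together through the
  calculus rules. The factor 1 matches the lemmas stated for a general direction d.\<close>

definition has_laplacian :: "(complex \<Rightarrow> real) \<Rightarrow> complex \<Rightarrow> real \<Rightarrow> bool" where
  "has_laplacian u z L \<longleftrightarrow>
    (\<exists>a b c d. second_deriv (\<lambda>s. u (z + of_real s * 1)) a b \<and>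
               second_deriv (\<lambda>s. u (z + of_real s * \<i>)) c d \<and> L = b + d)"

lemma has_laplacian_add:
  assumes "has_laplacian u z L" "has_laplacian v z M"
  shows "has_laplacian (\<lambda>w. u w + v w) z (L + M)"
proof -
  obtain a b c d where u: "second_deriv (\<lambda>s. u (z + of_real s * 1)) a b"
      "second_deriv (\<lambda>s. u (z + of_real s * \<i>)) c d" "L = b + d"
    using assms(1) unfolding has_laplacian_def by blast
  obtain a' b' c' d' where v: "second_deriv (\<lambda>s. v (z + of_real s * 1)) a' b'"
      "second_deriv (\<lambda>s. v (z + of_real s * \<i>)) c' d'" "M = b' + d'"
    using assms(2) unfolding has_laplacian_def by blast
  have "L + M = (b + b') + (d + d')" using u v by simp
  with second_deriv_add[OF u(1) v(1)] second_deriv_add[OF u(2) v(2)]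
  show ?thesis unfolding has_laplacian_def by blast
qed

lemma has_laplacian_cmult:
  assumes "has_laplacian u z L"
  shows "has_laplacian (\<lambda>w. c * u w) z (c * L)"
proof -
  have *: "second_deriv (\<lambda>s. c * f s) (c * a) (c * b)" if "second_deriv f a b" for f a b
    using second_deriv_compose[OF that, of "\<lambda>v. c * v" "\<lambda>_. c" 0]
    by (auto intro!: derivative_eq_intros simp: eventually_True)
  show ?thesis
    using assms unfolding has_laplacian_def by (metis * distrib_left)
qed

lemma has_laplacian_cong:
  assumes "\<forall>\<^sub>F w in nhds z. u w = v w" "has_laplacian u z L"
  shows "has_laplacian v z L"
proof -
  have *: "\<forall>\<^sub>F s in nhds 0. u (z + of_real s * d) = v (z + of_real s * d)" for d
    by (rule eventually_compose_filterlim[OF assms(1) filterlim_line])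
  show ?thesis
    using assms(2) second_deriv_cong[OF *[of 1]] second_deriv_cong[OF *[of \<i>]]
    unfolding has_laplacian_def by blast
qed

lemma has_laplacian_const: "has_laplacian (\<lambda>_. c) z 0"
  unfolding has_laplacian_def second_deriv_def
  by (intro exI[of _ 0] conjI exI[of _ "\<lambda>_. 0"]) (auto simp: eventually_True)

lemma has_laplacian_sum:
  assumes "finite A" "\<And>i. i \<in> A \<Longrightarrow> has_laplacian (u i) z (L i)"
  shows "has_laplacian (\<lambda>w. \<Sum>i\<in>A. u i w) z (\<Sum>i\<in>A. L i)"
  using assms
  by (induction A rule: finite_induct) (auto intro: has_laplacian_const has_laplacian_add)

lemma has_laplacian_max:
  assumes "has_laplacian u z L" "\<forall>\<^sub>F w in nhds z. u w \<le> u z"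
  shows "L \<le> 0"
proof -
  obtain a b c d where u: "second_deriv (\<lambda>s. u (z + of_real s * 1)) a b"
      "second_deriv (\<lambda>s. u (z + of_real s * \<i>)) c d" "L = b + d"
    using assms(1) unfolding has_laplacian_def by blast
  have *: "\<forall>\<^sub>F s in nhds 0. u (z + of_real s * d) \<le> u (z + of_real 0 * d)" for d
    using eventually_compose_filterlim[OF assms(2) filterlim_line] by simp
  from second_deriv_max[OF u(1) *] second_deriv_max[OF u(2) *] u(3) show ?thesis by simp
qed

text \<open>The second derivative of k enters with the factor d * d, which is 1 and -1 in the two
  directions, so it cancels. What remains is |k'|^2 times 4 (F' + v F'') at v = |k|^2. The
  logarithms and powers occurring below are all of this form.\<close>

lemma has_laplacian_norm_squared:
  assumes "k analytic_on {z}"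
    and "\<forall>\<^sub>F v in nhds ((cmod (k z))\<^sup>2). (F has_real_derivative F' v) (at v)"
    and "(F' has_real_derivative F2) (at ((cmod (k z))\<^sup>2))"
  shows "has_laplacian (\<lambda>w. F ((cmod (k w))\<^sup>2)) z
           (4 * (cmod (deriv k z))\<^sup>2 * (F' ((cmod (k z))\<^sup>2) + (cmod (k z))\<^sup>2 * F2))"
proof -
  have sq: "second_deriv (\<lambda>s. (f s)\<^sup>2) (2 * f 0 * a) (2 * a\<^sup>2 + 2 * f 0 * b)"
    if "second_deriv f a b" for f a b
  proof (rule second_deriv_compose[OF that, of "\<lambda>v. v\<^sup>2" "\<lambda>v. 2 * v" 2])
    show "\<forall>\<^sub>F v in nhds (f 0). ((\<lambda>v. v\<^sup>2) has_real_derivative 2 * v) (at v)"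
      by (intro always_eventually allI) (auto intro!: derivative_eq_intros)
  qed (auto intro!: derivative_eq_intros)
  define A where "A d = 2 * Re (k z) * Re (deriv k z * d) + 2 * Im (k z) * Im (deriv k z * d)" for d
  define B where "B d = (2 * (Re (deriv k z * d))\<^sup>2 + 2 * Re (k z) * Re (deriv (deriv k) z * d * d)) +
      (2 * (Im (deriv k z * d))\<^sup>2 + 2 * Im (k z) * Im (deriv (deriv k) z * d * d))" for d
  have n: "second_deriv (\<lambda>s. (cmod (k (z + of_real s * d)))\<^sup>2) (A d) (B d)" for d
    using second_deriv_add[OF sq[OF second_deriv_analytic_along_line(1)[OF assms(1), of d]]
        sq[OF second_deriv_analytic_along_line(2)[OF assms(1), of d]]]
    by (simp add: A_def B_def cmod_power2)
  have "second_deriv (\<lambda>s. F ((cmod (k (z + of_real s * d)))\<^sup>2)) (F' ((cmod (k z))\<^sup>2) * A d)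
     (F2 * (A d)\<^sup>2 + F' ((cmod (k z))\<^sup>2) * B d)" for d
    using second_deriv_compose[OF n[of d], of F F' F2] assms(2,3) by simp
  note this[of 1] this[of \<i>]
  moreover have "4 * (cmod (deriv k z))\<^sup>2 * (F' ((cmod (k z))\<^sup>2) + (cmod (k z))\<^sup>2 * F2)
     = (F2 * (A 1)\<^sup>2 + F' ((cmod (k z))\<^sup>2) * B 1) + (F2 * (A \<i>)\<^sup>2 + F' ((cmod (k z))\<^sup>2) * B \<i>)"
  proof -
    have sA: "(A 1)\<^sup>2 + (A \<i>)\<^sup>2 = 4 * (cmod (deriv k z))\<^sup>2 * (cmod (k z))\<^sup>2"
      unfolding A_def cmod_power2 by (simp add: power2_eq_square algebra_simps)
    have sB: "B 1 + B \<i> = 4 * (cmod (deriv k z))\<^sup>2"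
      unfolding B_def cmod_power2 by (simp add: power2_eq_square algebra_simps)
    have "(F2 * (A 1)\<^sup>2 + f * B 1) + (F2 * (A \<i>)\<^sup>2 + f * B \<i>)
        = 4 * (cmod (deriv k z))\<^sup>2 * (f + (cmod (k z))\<^sup>2 * F2)" for f
    proof -
      have "(F2 * (A 1)\<^sup>2 + f * B 1) + (F2 * (A \<i>)\<^sup>2 + f * B \<i>)
          = F2 * ((A 1)\<^sup>2 + (A \<i>)\<^sup>2) + f * (B 1 + B \<i>)" by (simp add: algebra_simps)
      then show ?thesis unfolding sA sB by (simp add: algebra_simps)
    qed
    then show ?thesis by simp
  qed
  ultimately show ?thesis unfolding has_laplacian_def by blast
qed

section \<open>A conical metric of negative curvature\<close>

text \<open>
  The density \<open>\<Prod> \<chi>\<^sub>j\<^sup>-\<^sup>s\<^sup>j\<close> relative to the spherical metric has negative curvature because the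
  exponents add up to more than \<open>2\<close>, but that curvature tends to \<open>0\<close> at the points \<open>\<alpha> j\<close>. The
  exponential factor, whose Laplacian is of order \<open>\<chi>\<^sub>j\<^sup>2\<^sup>t\<^sup>-\<^sup>2\<close>, bounds it away from \<open>0\<close>.
\<close>

locale cone_metric =
  fixes J :: "'i set" and \<alpha> :: "'i \<Rightarrow> ecomplex" and s :: "'i \<Rightarrow> real"
  assumes finite_J: "finite J" and inj: "inj_on \<alpha> J"
    and s: "\<And>j. j \<in> J \<Longrightarrow> 0 < s j \<and> s j < 1"
    and sum_gt: "(\<Sum>j\<in>J. s j) > 2"
begin

text \<open>The choice gives 2t - 2 \<le> -2 s_j for every j, so the Laplacian of the exponential
  term blows up at least as fast as the squared density at each cone point.\<close>

definition t :: real where "t = Min ((\<lambda>j. 1 - s j) ` J)"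

text \<open>The negative part of the exponential term is at most 2 \<epsilon> card J, because t (t +
  1) \<le> 2 and chordal distances are at most 1. This value makes that bound equal to the surplus
  (sum s_j) / 2 - 1.\<close>

definition \<epsilon> :: real where "\<epsilon> = ((\<Sum>j\<in>J. s j) - 2) / (4 * real (card J))"

definition dens :: "ecomplex \<Rightarrow> real" where
  "dens x = (\<Prod>j\<in>J. chordal x (\<alpha> j) powr (- s j)) * exp (\<epsilon> * (\<Sum>j\<in>J. chordal x (\<alpha> j) powr (2 * t)))"

text \<open>The curvature of the metric with density \<open>dens\<close> is \<open>- 4 neg_curv / dens\<^sup>2\<close>.\<close>

definition neg_curv :: "ecomplex \<Rightarrow> real" where
  "neg_curv x = (\<Sum>j\<in>J. s j) / 2 - 1 + \<epsilon> * (\<Sum>j\<in>J. t\<^sup>2 * chordal x (\<alpha> j) powr (2 * t - 2)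
      - t * (t + 1) * chordal x (\<alpha> j) powr (2 * t))"

section \<open>Bounds for the parameters and the density\<close>

lemma J_nonempty: "J \<noteq> {}" using sum_gt by auto

lemma card_J: "card J > 0" using finite_J J_nonempty by (simp add: card_gt_0_iff)

lemma t_le: "j \<in> J \<Longrightarrow> t \<le> 1 - s j"
  unfolding t_def using finite_J by (intro Min_le) auto

lemma t_pos: "t > 0"
  unfolding t_def using finite_J J_nonempty s by (subst Min_gr_iff) auto

lemma t_less_1: "t < 1"
  using t_le s J_nonempty by fastforce

lemma \<epsilon>_pos: "\<epsilon> > 0"
  unfolding \<epsilon>_def using sum_gt card_J by (intro divide_pos_pos) auto

text \<open>The true density is infinite at a cone point; here \<open>0 powr a = 0\<close> decides.
  This default is the right value for pullbacks: at a sufficiently ramified root the spherical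
  derivative outweighs the singularity and the product tends to 0.\<close>

lemma dens_eq_0: "x \<in> \<alpha> ` J \<Longrightarrow> dens x = 0"
  unfolding dens_def using finite_J by auto

lemma dens_nonneg: "dens x \<ge> 0"
  unfolding dens_def by (intro mult_nonneg_nonneg prod_nonneg) auto

text \<open>Chordal distances never exceed 1, so negative powers are at least 1. A bound for the
  conical metric is therefore a bound for the spherical one, without a further constant.\<close>

lemma dens_ge_1:
  assumes "x \<notin> \<alpha> ` J"
  shows "dens x \<ge> 1"
proof -
  have "1 \<le> chordal x (\<alpha> j) powr (- s j)" if "j \<in> J" for j
  proof -
    have "chordal x (\<alpha> j) > 0" using assms that by (auto simp: chordal_pos_iff)
    moreover have "chordal x (\<alpha> j) powr s j \<le> 1"
      using s[OF that] chordal_le_1 by (intro powr_le1) auto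
    ultimately show ?thesis
      unfolding powr_minus by (intro one_le_inverse) (metis powr_gt_zero less_irrefl)
  qed
  then have "1 \<le> (\<Prod>j\<in>J. chordal x (\<alpha> j) powr (- s j))" by (intro prod_ge_1) auto
  moreover have "1 \<le> exp (\<epsilon> * (\<Sum>j\<in>J. chordal x (\<alpha> j) powr (2 * t)))"
    using \<epsilon>_pos by (simp add: sum_nonneg)
  ultimately have "1 * 1 \<le> dens x" unfolding dens_def by (intro mult_mono) auto
  then show ?thesis by simp
qed

text \<open>Let i be the index nearest to x. For j \<noteq> i the distance between \<alpha>_i and
  \<alpha>_j is at most twice that between x and \<alpha>_j, so half the minimal distance
  works.\<close>

lemma separation:
  obtains \<delta> where "0 < \<delta>" "\<delta> \<le> 1" "\<And>x. \<exists>i\<in>J. \<forall>j\<in>J - {i}. \<delta> \<le> chordal x (\<alpha> j)"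
proof -
  define D where "D = insert 1 ((\<lambda>(i, j). chordal (\<alpha> i) (\<alpha> j)) ` {p \<in> J \<times> J. fst p \<noteq> snd p})"
  have fin: "finite D" unfolding D_def using finite_J by auto
  have pos: "0 < Min D"
    using fin inj by (subst Min_gr_iff) (auto simp: D_def chordal_pos_iff inj_on_def)
  have le1: "Min D \<le> 1" using fin by (intro Min_le) (auto simp: D_def)
  have "\<exists>i\<in>J. \<forall>j\<in>J - {i}. Min D / 2 \<le> chordal x (\<alpha> j)" for x
  proof -
    obtain i where i: "i \<in> J" "\<And>j. j \<in> J \<Longrightarrow> chordal x (\<alpha> i) \<le> chordal x (\<alpha> j)"
      using arg_min_if_finite[OF finite_J J_nonempty, of "\<lambda>j. chordal x (\<alpha> j)"]
      by (meson not_le)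
    have "Min D / 2 \<le> chordal x (\<alpha> j)" if j: "j \<in> J - {i}" for j
    proof -
      have "Min D \<le> chordal (\<alpha> i) (\<alpha> j)" using fin i j by (intro Min_le) (auto simp: D_def)
      also have "\<dots> \<le> chordal x (\<alpha> i) + chordal x (\<alpha> j)"
        using chordal_triangle[of "\<alpha> i" "\<alpha> j" x] by (simp add: chordal_commute)
      finally show ?thesis using i(2)[of j] j by simp
    qed
    then show ?thesis using i by blast
  qed
  then show ?thesis using pos le1 by (intro that[of "Min D / 2"]) auto
qed

text \<open>Both sides are compared with S, the sum of the powers 2t - 2 of the distances. Only the
  nearest cone point can make the density large, whence dens^2 \<le> M S; and the choice of
  \<epsilon> leaves \<epsilon> t^2 S in \<open>neg_curv\<close>.\<close>

lemma neg_curv_ge: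
  obtains c where "c > 0" "\<And>x. x \<notin> \<alpha> ` J \<Longrightarrow> c * (dens x)\<^sup>2 \<le> neg_curv x"
proof -
  obtain \<delta> where \<delta>: "0 < \<delta>" "\<delta> \<le> 1" "\<And>x. \<exists>i\<in>J. \<forall>j\<in>J - {i}. \<delta> \<le> chordal x (\<alpha> j)"
    using separation by blast
  define K where "K = \<delta> powr (- 2)"
  define M where "M = K ^ card J * exp (2 * \<epsilon> * real (card J))"
  have K1: "K \<ge> 1"
    using \<delta> by (simp add: K_def powr_minus powr_le1 power_le_one field_simps)
  have "M > 0" using K1 by (simp add: M_def)
  have main: "\<epsilon> * t\<^sup>2 / M * (dens x)\<^sup>2 \<le> neg_curv x" if x: "x \<notin> \<alpha> ` J" for x
  proof -
    define \<rho> where "\<rho> j = chordal x (\<alpha> j)" for j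
    define S where "S = (\<Sum>j\<in>J. \<rho> j powr (2 * t - 2))"
    have \<rho>: "0 < \<rho> j" "\<rho> j \<le> 1" if "j \<in> J" for j
      using x that by (auto simp: \<rho>_def chordal_pos_iff chordal_le_1)
    obtain i where i: "i \<in> J" "\<And>j. j \<in> J - {i} \<Longrightarrow> \<delta> \<le> \<rho> j" using \<delta>(3)[of x] by (auto simp: \<rho>_def)
    have "(\<Prod>j\<in>J. \<rho> j powr (- s j))\<^sup>2 = (\<Prod>j\<in>J. \<rho> j powr (- 2 * s j))"
      unfolding prod_power_distrib
      by (intro prod.cong refl) (simp add: power2_eq_square flip: powr_add)
    also have "\<dots> = \<rho> i powr (- 2 * s i) * (\<Prod>j\<in>J - {i}. \<rho> j powr (- 2 * s j))"
      using i finite_J by (simp add: prod.remove)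
    also have "\<dots> \<le> S * K ^ card J"
    proof (rule mult_mono)
      have "\<rho> i powr (- 2 * s i) \<le> \<rho> i powr (2 * t - 2)"
        using \<rho>[OF i(1)] t_le[OF i(1)] by (intro powr_mono') auto
      also have "\<dots> \<le> S"
        unfolding S_def using finite_J i by (intro member_le_sum) auto
      finally show "\<rho> i powr (- 2 * s i) \<le> S" .
      have "(\<Prod>j\<in>J - {i}. \<rho> j powr (- 2 * s j)) \<le> (\<Prod>j\<in>J - {i}. K)"
      proof (rule prod_mono)
        fix j assume j: "j \<in> J - {i}"
        have "\<rho> j powr (- 2 * s j) \<le> \<rho> j powr (- 2)"
          using \<rho>[of j] s[of j] j by (intro powr_mono') auto
        also have "\<dots> \<le> K"
          unfolding K_def using i(2)[OF j] \<delta> by (intro powr_mono2') auto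
        finally show "0 \<le> \<rho> j powr (- 2 * s j) \<and> \<rho> j powr (- 2 * s j) \<le> K" by simp
      qed
      also have "\<dots> = K ^ card (J - {i})" by simp
      also have "\<dots> \<le> K ^ card J"
        using K1 finite_J by (intro power_increasing card_mono) auto
      finally show "(\<Prod>j\<in>J - {i}. \<rho> j powr (- 2 * s j)) \<le> K ^ card J" .
    qed (auto simp: S_def sum_nonneg prod_nonneg)
    finally have P: "(\<Prod>j\<in>J. \<rho> j powr (- s j))\<^sup>2 \<le> S * K ^ card J" .
    have le1: "(\<Sum>j\<in>J. \<rho> j powr (2 * t)) \<le> real (card J)"
    proof -
      have "(\<Sum>j\<in>J. \<rho> j powr (2 * t)) \<le> (\<Sum>j\<in>J. 1)"
        using \<rho> t_pos by (intro sum_mono powr_le1) (auto simp: less_imp_le)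
      then show ?thesis by simp
    qed
    have E: "(exp (\<epsilon> * (\<Sum>j\<in>J. \<rho> j powr (2 * t))))\<^sup>2 \<le> exp (2 * \<epsilon> * real (card J))"
      using le1 \<epsilon>_pos by (simp add: power2_eq_square flip: exp_add)
    have "(dens x)\<^sup>2 \<le> S * K ^ card J * exp (2 * \<epsilon> * real (card J))"
      unfolding dens_def power_mult_distrib \<rho>_def[symmetric]
      using P E K1 by (intro mult_mono) (auto simp: S_def sum_nonneg)
    then have "(dens x)\<^sup>2 \<le> M * S" by (simp add: M_def mult_ac)
    then have "\<epsilon> * t\<^sup>2 / M * (dens x)\<^sup>2 \<le> \<epsilon> * t\<^sup>2 / M * (M * S)"
      using \<epsilon>_pos \<open>M > 0\<close> by (intro mult_left_mono) auto
    also have "\<dots> = \<epsilon> * t\<^sup>2 * S" using \<open>M > 0\<close> by simp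
    also have "\<dots> \<le> neg_curv x"
    proof -
      have "t * (t + 1) * (\<Sum>j\<in>J. \<rho> j powr (2 * t)) \<le> (1 * 2) * real (card J)"
        using t_pos t_less_1 le1 by (intro mult_mono) (auto simp: sum_nonneg)
      then have "\<epsilon> * (t * (t + 1) * (\<Sum>j\<in>J. \<rho> j powr (2 * t))) \<le> \<epsilon> * (2 * real (card J))"
        using \<epsilon>_pos by (intro mult_left_mono) auto
      also have "\<epsilon> * (2 * real (card J)) = (\<Sum>j\<in>J. s j) / 2 - 1"
        using card_J by (simp add: \<epsilon>_def field_simps)
      finally show ?thesis
        unfolding neg_curv_def \<rho>_def[symmetric] S_def sum_subtractf
        by (simp add: right_diff_distrib flip: sum_distrib_left)
    qed
    finally show ?thesis .
  qed
  show ?thesis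
    using \<epsilon>_pos t_pos \<open>M > 0\<close> main by (intro that[of "\<epsilon> * t\<^sup>2 / M"]) auto
qed

text \<open>Each \<alpha>_j gets a coordinate k j with its pole there, so that its distance function
  depends on |k j| only. By invariance of the spherical derivative, |k j'|^2 equals \<sigma>^2 (1 +
  |k j|^2)^2, and every term acquires the common factor \<sigma>^2.\<close>

lemma laplacian_log_density:
  assumes an: "sph_analytic h z" and hz: "h z \<notin> \<alpha> ` J" and nz: "sph_deriv h z \<noteq> 0"
  shows "has_laplacian (\<lambda>w. ln (sph_deriv h w * dens (h w))) z (4 * (sph_deriv h z)\<^sup>2 * neg_curv (h z))"
proof -
  define k where "k j = (\<lambda>w. rot (antipode (\<alpha> j)) (h w))" for j
  define \<sigma> where "\<sigma> = sph_deriv h z"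
  have hp: "hprod (antipode (\<alpha> j)) x \<noteq> 0 \<longleftrightarrow> x \<noteq> \<alpha> j" for j x by (simp add: hprod_eq_0_iff)
  have kan: "k j analytic_on {z}" and ev1: "\<forall>\<^sub>F w in nhds z. h w \<noteq> \<alpha> j" if "j \<in> J" for j
    using sph_analytic_rot[OF an, of "antipode (\<alpha> j)"] hz that by (auto simp: hp k_def)
  have ev: "\<forall>\<^sub>F w in nhds z. \<forall>j\<in>J. h w \<noteq> \<alpha> j"
    using finite_J ev1 by (simp add: eventually_ball_finite_distrib)
  have y_pos: "1 + (cmod (k j w))\<^sup>2 > 0" for j w by (smt (verit) zero_le_power2)
  have sd: "sph_deriv h w = cmod (deriv (k j) w) / (1 + (cmod (k j w))\<^sup>2)"
    if "sph_analytic h w" "h w \<noteq> \<alpha> j" for j w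
    using sph_deriv_rot[OF that(1), of "antipode (\<alpha> j)"] that by (simp add: hp k_def)
  have ksq: "(cmod (deriv (k j) z))\<^sup>2 = \<sigma>\<^sup>2 * (1 + (cmod (k j z))\<^sup>2)\<^sup>2" if "j \<in> J" for j
  proof -
    have "cmod (deriv (k j) z) = \<sigma> * (1 + (cmod (k j z))\<^sup>2)"
      using sd[OF an, of j] hz that y_pos[of j z] unfolding \<sigma>_def by force
    then show ?thesis by (simp add: power_mult_distrib)
  qed
  have chi: "chordal (h w) (\<alpha> j) = (1 + (cmod (k j w))\<^sup>2) powr (- 1/2)" if "h w \<noteq> \<alpha> j" for j w
  proof -
    have "(chordal (h w) (\<alpha> j))\<^sup>2 = ((1 + (cmod (k j w))\<^sup>2) powr (- 1/2))\<^sup>2"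
      using chordal_antipode_squared[OF that] y_pos[of j w]
      by (simp add: k_def power2_eq_square powr_minus_divide flip: powr_add)
    then show ?thesis by (simp add: power2_eq_iff_nonneg)
  qed
  \<comment> \<open>Any one of the coordinates serves to express \<open>sph_deriv\<close>. Its
    numerator enters A as half the logarithm of |k i'|^2, a harmonic function because k i' is
    analytic and nonzero at z.\<close>
  obtain i where i: "i \<in> J" using J_nonempty by blast
  define A where "A w = 1/2 * ln ((cmod (deriv (k i) w))\<^sup>2) + (- 1) * ln (1 + (cmod (k i w))\<^sup>2)
    + (\<Sum>j\<in>J. s j / 2 * ln (1 + (cmod (k j w))\<^sup>2)) + \<epsilon> * (\<Sum>j\<in>J. (1 + (cmod (k j w))\<^sup>2) powr (- t))" for w

  have lap_ln: "has_laplacian (\<lambda>w. ln (1 + (cmod (k j w))\<^sup>2)) z (4 * \<sigma>\<^sup>2)" if "j \<in> J" for j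
  proof -
    let ?v = "(cmod (k j z))\<^sup>2"
    have "has_laplacian (\<lambda>w. ln (1 + (cmod (k j w))\<^sup>2)) z
        (4 * (cmod (deriv (k j) z))\<^sup>2 * (1 / (1 + ?v) + ?v * (- 1 / (1 + ?v)\<^sup>2)))"
      (is "has_laplacian _ _ ?L")
    proof (rule has_laplacian_norm_squared[OF kan[OF that], of "\<lambda>v. ln (1 + v)" "\<lambda>v. 1 / (1 + v)"])
      have "\<forall>\<^sub>F v in nhds ?v. v > -1"
        by (intro eventually_nhds_in_open[of "{-1<..}" ?v, simplified]) (smt (verit) zero_le_power2)
      then show "\<forall>\<^sub>F v in nhds ?v. ((\<lambda>v. ln (1 + v)) has_real_derivative 1 / (1 + v)) (at v)"
        by eventually_elim (auto intro!: derivative_eq_intros)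
      show "((\<lambda>v. 1 / (1 + v)) has_real_derivative - 1 / (1 + ?v)\<^sup>2) (at ?v)"
        using y_pos[of j z] by (auto intro!: derivative_eq_intros simp: power2_eq_square)
    qed
    moreover have "?L = 4 * \<sigma>\<^sup>2"
    proof -
      have *: "y \<noteq> 0 \<Longrightarrow> 4 * (S * y\<^sup>2) * (1 / y + (y - 1) * (- 1 / y\<^sup>2)) = 4 * S" for y S :: real
        by (simp add: field_simps power2_eq_square)
      show ?thesis unfolding ksq[OF that] using *[of "1 + ?v" "\<sigma>\<^sup>2"] y_pos[of j z] by simp
    qed
    ultimately show ?thesis by (simp only:)
  qed
  have dpowr: "((\<lambda>v. (1 + v) powr a) has_real_derivative a * (1 + v) powr (a - 1)) (at v)"
    if "1 + v > 0" for a v :: real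
  proof -
    have "((\<lambda>v. (1 + v) powr a) has_real_derivative (a * (1 + v) powr (a - 1)) * 1) (at v)"
      by (rule DERIV_chain2[where g = "\<lambda>v. 1 + v" and x = v, OF has_real_derivative_powr[OF that]])
        (auto intro!: derivative_eq_intros)
    then show ?thesis by simp
  qed
  have lap_powr: "has_laplacian (\<lambda>w. (1 + (cmod (k j w))\<^sup>2) powr (- t)) z
      (4 * \<sigma>\<^sup>2 * (t\<^sup>2 * chordal (h z) (\<alpha> j) powr (2 * t - 2) - t * (t + 1) * chordal (h z) (\<alpha> j) powr (2 * t)))"
    if j: "j \<in> J" for j
  proof -
    let ?v = "(cmod (k j z))\<^sup>2"
    have "has_laplacian (\<lambda>w. (1 + (cmod (k j w))\<^sup>2) powr (- t)) z
        (4 * (cmod (deriv (k j) z))\<^sup>2 * (- t * (1 + ?v) powr (- t - 1) + ?v * (- t * ((- t - 1) * (1 + ?v) powr (- t - 1 - 1)))))"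
      (is "has_laplacian _ _ ?L")
    proof (rule has_laplacian_norm_squared[OF kan[OF that], of "\<lambda>v. (1 + v) powr (- t)" "\<lambda>v. - t * (1 + v) powr (- t - 1)"])
      have "\<forall>\<^sub>F v in nhds ?v. v > -1"
        by (intro eventually_nhds_in_open[of "{-1<..}" ?v, simplified]) (smt (verit) zero_le_power2)
      then show "\<forall>\<^sub>F v in nhds ?v. ((\<lambda>v. (1 + v) powr (- t)) has_real_derivative - t * (1 + v) powr (- t - 1)) (at v)"
        by eventually_elim (rule dpowr, simp)
      show "((\<lambda>v. - t * (1 + v) powr (- t - 1)) has_real_derivative - t * ((- t - 1) * (1 + ?v) powr (- t - 1 - 1))) (at ?v)"
        by (intro DERIV_cmult dpowr y_pos)
    qed
    moreover have "?L
      = 4 * \<sigma>\<^sup>2 * (t\<^sup>2 * chordal (h z) (\<alpha> j) powr (2 * t - 2) - t * (t + 1) * chordal (h z) (\<alpha> j) powr (2 * t))"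
    proof -
      define y where "y = 1 + ?v"
      have y: "y > 0" unfolding y_def by (rule y_pos)
      have v: "?v = y - 1" by (simp add: y_def)
      have c: "chordal (h z) (\<alpha> j) = y powr (- 1/2)" using chi[of z j] hz j by (auto simp: y_def)
      have p0: "y powr (- t - 1) = y powr (- t) / y"
        using y by (simp add: powr_diff)
      have e: "- t - 1 - 1 = - t - 2" by simp
      have p1: "y powr (- t - 1 - 1) = y powr (- t) / y\<^sup>2"
        unfolding e using y by (simp only: powr_diff) simp
      have "- 1/2 * (2 * t - 2) = - t + 1" by (simp add: field_simps)
      then have p2: "chordal (h z) (\<alpha> j) powr (2 * t - 2) = y powr (- t) * y"
        unfolding c powr_powr using y by (simp only: powr_add) simp
      have p3: "chordal (h z) (\<alpha> j) powr (2 * t) = y powr (- t)"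
        unfolding c powr_powr by simp
      have "4 * (S * y\<^sup>2) * (- t * (P / y) + (y - 1) * (- t * ((- t - 1) * (P / y\<^sup>2))))
          = 4 * S * (t\<^sup>2 * (P * y) - t * (t + 1) * P)" for S P
      proof -
        have 1: "- t * (P / y) + (y - 1) * (- t * ((- t - 1) * (P / y\<^sup>2)))
            = (- t * P * y + (y - 1) * (- t * ((- t - 1) * P))) / y\<^sup>2"
          using y by (simp add: add_divide_distrib diff_divide_distrib power2_eq_square)
        have 2: "4 * (S * y\<^sup>2) * (X / y\<^sup>2) = 4 * S * X" for X
          using y by simp
        show ?thesis unfolding 1 2 by (simp add: algebra_simps power2_eq_square)
      qed
      moreover have "1 + (y - 1) = y" by simp
      ultimately show ?thesis
        unfolding ksq[OF j] v p2 p3 by (simp only: p0 p1)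
    qed
    ultimately show ?thesis by (simp only:)
  qed
  have ki0: "deriv (k i) z \<noteq> 0" using ksq[OF i] nz y_pos[of i z] by (auto simp: \<sigma>_def)
  have kian: "deriv (k i) analytic_on {z}" using kan[OF i] by (rule analytic_deriv)
  have lap_deriv: "has_laplacian (\<lambda>w. ln ((cmod (deriv (k i) w))\<^sup>2)) z 0"
  proof -
    let ?v = "(cmod (deriv (k i) z))\<^sup>2"
    have v: "?v > 0" using ki0 by simp
    have "has_laplacian (\<lambda>w. ln ((cmod (deriv (k i) w))\<^sup>2)) z
       (4 * (cmod (deriv (deriv (k i)) z))\<^sup>2 * (1 / ?v + ?v * (- 1 / ?v\<^sup>2)))"
    proof (rule has_laplacian_norm_squared[OF kian, of ln "\<lambda>v. 1 / v"])
      have "\<forall>\<^sub>F v in nhds ?v. v > 0"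
        using v by (intro eventually_nhds_in_open[of "{0<..}" ?v, simplified mem_Collect_eq greaterThan_iff]) auto
      then show "\<forall>\<^sub>F v in nhds ?v. (ln has_real_derivative 1 / v) (at v)"
        by eventually_elim (auto intro!: derivative_eq_intros)
      show "((\<lambda>v. 1 / v) has_real_derivative - 1 / ?v\<^sup>2) (at ?v)"
        using v ki0 by (auto intro!: derivative_eq_intros simp: power2_eq_square)
    qed
    moreover have "1 / ?v + ?v * (- 1 / ?v\<^sup>2) = 0" using v by (simp add: power2_eq_square)
    ultimately show ?thesis by simp
  qed
  have "has_laplacian A z (1/2 * 0 + (- 1) * (4 * \<sigma>\<^sup>2) + (\<Sum>j\<in>J. s j / 2 * (4 * \<sigma>\<^sup>2)) + \<epsilon> * (\<Sum>j\<in>J.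
       4 * \<sigma>\<^sup>2 * (t\<^sup>2 * chordal (h z) (\<alpha> j) powr (2 * t - 2) - t * (t + 1) * chordal (h z) (\<alpha> j) powr (2 * t))))"
    (is "has_laplacian A z ?L")
    unfolding A_def
    by (intro has_laplacian_add has_laplacian_cmult has_laplacian_sum finite_J lap_ln lap_powr lap_deriv i)
  also have "?L = 4 * \<sigma>\<^sup>2 * neg_curv (h z)"
  proof -
    have "1/2 * 0 + (- 1) * (4 * S) + a / 2 * (4 * S) + \<epsilon> * (4 * S * Y) = 4 * S * (a / 2 - 1 + \<epsilon> * Y)"
      for a S Y by (simp add: algebra_simps)
    then show ?thesis
      unfolding neg_curv_def sum_distrib_left[symmetric] sum_distrib_right[symmetric] sum_divide_distrib[symmetric] .
  qed
  finally have lapA: "has_laplacian A z (4 * \<sigma>\<^sup>2 * neg_curv (h z))" .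
  have "\<forall>\<^sub>F w in nhds z. deriv (k i) w \<noteq> 0"
    using analytic_at_imp_isCont[OF kian] ki0 by (rule isCont_eventually_nonzero)
  then have "\<forall>\<^sub>F w in nhds z. A w = ln (sph_deriv h w * dens (h w))"
    using ev sph_analytic_eventually[OF an]
  proof eventually_elim
    case (elim w)
    have chi_pos: "chordal (h w) (\<alpha> j) > 0" if "j \<in> J" for j using elim(2) that by (auto simp: chordal_pos_iff)
    have ln_chi: "ln (chordal (h w) (\<alpha> j)) = - 1/2 * ln (1 + (cmod (k j w))\<^sup>2)" if "j \<in> J" for j
      using chi[of w j] elim(2) that y_pos[of j w] by (simp add: ln_powr)
    have "h w \<notin> \<alpha> ` J" using elim(2) by auto
    from dens_ge_1[OF this] have "dens (h w) > 0" by simp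
    then have "ln (sph_deriv h w * dens (h w)) = ln (sph_deriv h w) + ln (dens (h w))"
      using elim i y_pos[of i w] by (intro ln_mult_pos) (auto simp: sd[of w i])
    also have "ln (sph_deriv h w) = 1/2 * ln ((cmod (deriv (k i) w))\<^sup>2) + (- 1) * ln (1 + (cmod (k i w))\<^sup>2)"
      using elim i y_pos[of i w] by (simp add: sd[of w i] ln_div ln_realpow)
    also have "ln (dens (h w)) = (\<Sum>j\<in>J. ln (chordal (h w) (\<alpha> j) powr (- s j))) + \<epsilon> * (\<Sum>j\<in>J. chordal (h w) (\<alpha> j) powr (2 * t))"
    proof -
      have pos: "chordal (h w) (\<alpha> j) powr (- s j) > 0" if "j \<in> J" for j
        using chi_pos[OF that] by (metis powr_gt_zero less_irrefl)
      have "ln (\<Prod>j\<in>J. chordal (h w) (\<alpha> j) powr (- s j)) = (\<Sum>j\<in>J. ln (chordal (h w) (\<alpha> j) powr (- s j)))"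
        using finite_J by (rule ln_prod) (metis pos less_irrefl)
      then show ?thesis
        unfolding dens_def using pos by (subst ln_mult_pos) (auto intro!: prod_pos simp del: powr_gt_zero)
    qed
    also have "(\<Sum>j\<in>J. ln (chordal (h w) (\<alpha> j) powr (- s j))) = (\<Sum>j\<in>J. s j / 2 * ln (1 + (cmod (k j w))\<^sup>2))"
      using chi_pos by (intro sum.cong refl) (simp add: ln_powr ln_chi)
    also have "(\<Sum>j\<in>J. chordal (h w) (\<alpha> j) powr (2 * t)) = (\<Sum>j\<in>J. (1 + (cmod (k j w))\<^sup>2) powr (- t))"
      using chi elim(2) by (intro sum.cong refl) (simp add: powr_powr)
    finally show ?case by (simp add: A_def)
  qed
  from has_laplacian_cong[OF this lapA] show ?thesis by (simp add: \<sigma>_def)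
qed

text \<open>Near a root of \<open>h = \<alpha> j\<close> of order \<open>n\<close> the density is \<open>O(\<bar>w - z\<bar>\<^sup>n\<^sup>-\<^sup>1\<^sup>-\<^sup>n\<^sup>s)\<close>.\<close>

lemma isCont_density:
  assumes an: "sph_analytic h z"
    and ram: "\<And>j. j \<in> J \<Longrightarrow> h z = \<alpha> j \<Longrightarrow> \<exists>m. real m * (1 - s j) > 1 \<and> ramified h z m"
  shows "isCont (\<lambda>w. sph_deriv h w * dens (h w)) z"
proof -
  define rest where "rest I w = (\<Prod>j\<in>I. chordal (h w) (\<alpha> j) powr (- s j)) *
      exp (\<epsilon> * (\<Sum>j\<in>J. chordal (h w) (\<alpha> j) powr (2 * t)))" for I w
  have rest_cont: "isCont (rest I) z" if "I \<subseteq> J" "h z \<notin> \<alpha> ` I" for I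
  proof -
    have c: "((\<lambda>w. chordal (h w) a) \<longlongrightarrow> chordal (h z) a) (at z)" for a
      using isCont_chordal[OF an] by (simp add: isCont_def)
    have 1: "((\<lambda>w. chordal (h w) (\<alpha> j) powr (- s j)) \<longlongrightarrow> chordal (h z) (\<alpha> j) powr (- s j)) (at z)" if "j \<in> I" for j
      using \<open>h z \<notin> \<alpha> ` I\<close> that by (intro tendsto_powr c tendsto_const) auto
    have 2: "((\<lambda>w. chordal (h w) (\<alpha> j) powr (2 * t)) \<longlongrightarrow> chordal (h z) (\<alpha> j) powr (2 * t)) (at z)" for j
      using t_pos by (intro tendsto_powr' c tendsto_const) auto
    show ?thesis unfolding isCont_def rest_def
      by (intro tendsto_mult tendsto_prod tendsto_exp tendsto_sum tendsto_const 1 2)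
  qed
  have dens_rest: "dens (h w) = rest J w" for w by (simp add: dens_def rest_def)
  show ?thesis
  proof (cases "h z \<in> \<alpha> ` J")
    case False
    have "isCont (\<lambda>w. sph_deriv h w * rest J w) z"
      using isCont_sph_deriv[OF an] rest_cont[OF order_refl False] by (rule isCont_mult)
    then show ?thesis by (simp add: dens_rest)
  next
    case True
    then obtain i where i: "i \<in> J" "h z = \<alpha> i" by blast
    obtain m where m: "real m * (1 - s i) > 1" "ramified h z m" using ram[OF i] by blast
    define k where "k = (\<lambda>w. rot (\<alpha> i) (h w))"
    have kan: "k analytic_on {z}" and evk: "\<forall>\<^sub>F w in nhds z. hprod (\<alpha> i) (h w) \<noteq> 0"
      using sph_analytic_rot[OF an, of "\<alpha> i"] i(2) hprod_self by (simp_all add: k_def)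
    have kz: "k z = 0" using i by (simp add: k_def)
    have "((\<lambda>w. sph_deriv h w * dens (h w)) \<longlongrightarrow> 0) (at z)"
      using kan kz
    proof (cases rule: analytic_order_cases)
      case zero
      \<comment> \<open>Here h is constant near z with the value of a cone point, and
        \<open>dens\<close> is 0 there by the default value of \<open>powr\<close>.\<close>
      have "\<forall>\<^sub>F w in nhds z. 0 = sph_deriv h w * dens (h w)"
        using zero(1) evk
      proof eventually_elim
        case (elim w)
        have "h w = \<alpha> i"
          using rot_inject[OF elim(2) hprod_self] elim(1) by (simp add: k_def)
        then show ?case using dens_eq_0[of "h w"] i(1) by simp
      qed
      then have "\<forall>\<^sub>F w in at z. 0 = sph_deriv h w * dens (h w)" by (simp add: eventually_nhds_conv_at)
      then show ?thesis by (rule Lim_transform_eventually[OF tendsto_const])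
    next
      case (order n G)
      have "m \<le> n"
        using m(2) order(6) unfolding ramified_iff_derivs[OF an] i(2) k_def[symmetric] by (meson not_le)
      have e_pos: "real n * (1 - s i) - 1 > 0"
      proof -
        have "real m * (1 - s i) \<le> real n * (1 - s i)"
          using \<open>m \<le> n\<close> s[OF i(1)] by (intro mult_right_mono) auto
        then show ?thesis using m(1) by simp
      qed
      \<comment> \<open>The order must be at least 2, since \<open>analytic_power_bound\<close> is
        applied to k' with the exponent n - 1, which has to be positive.\<close>
      have "n \<noteq> 1" using e_pos s[OF i(1)] by auto
      then have n2: "n \<ge> 2" using order(1) by simp
      obtain C where C: "\<forall>\<^sub>F w in nhds z. cmod (deriv k w) \<le> C * cmod (w - z) ^ (n - 1)"
      proof (rule analytic_power_bound[of "deriv k" z "n - 1"])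
        show "(deriv ^^ l) (deriv k) z = 0" if "l < n - 1" for l
          using order(5)[of "Suc l"] that by (simp add: funpow_swap1)
      qed (use kan analytic_deriv n2 in auto)
      define g where "g = cmod (G z) / 2"
      have g: "g > 0" using order(3) by (simp add: g_def)
      have evG: "\<forall>\<^sub>F w in at z. cmod (G w) > g"
        using analytic_at_imp_isCont[OF order(2)] order(3)
        by (intro order_tendstoD(1)[of _ "cmod (G z)"]) (auto simp: isCont_def g_def intro: tendsto_norm)
      have evk1: "\<forall>\<^sub>F w in at z. cmod (k w) < 1"
      proof (rule order_tendstoD(2))
        show "((\<lambda>w. cmod (k w)) \<longlongrightarrow> cmod (k z)) (at z)"
          using analytic_at_imp_isCont[OF kan] by (intro tendsto_norm) (simp add: isCont_def)
      qed (simp add: kz)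
      \<comment> \<open>The points \<alpha>_j are distinct, so the factors belonging to the other
        indices stay bounded near z.\<close>
      define B where "B = \<bar>rest (J - {i}) z\<bar> + 1"
      have "isCont (rest (J - {i})) z"
        using inj i by (intro rest_cont) (auto simp: inj_on_def)
      then have evB: "\<forall>\<^sub>F w in at z. \<bar>rest (J - {i}) w\<bar> < B"
        by (intro order_tendstoD(2)[of _ "\<bar>rest (J - {i}) z\<bar>"]) (auto simp: isCont_def B_def intro: tendsto_rabs)
      define E where "E = real n * (1 - s i) - 1"
      define K where "K = \<bar>C\<bar> * (g / 2) powr (- s i) * B"
      have "\<forall>\<^sub>F w in at z. w \<noteq> z" by (simp add: eventually_at_filter)
      moreover have "\<forall>\<^sub>F w in at z. k w = (w - z) ^ n * G w" "\<forall>\<^sub>F w in at z. hprod (\<alpha> i) (h w) \<noteq> 0"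
          "\<forall>\<^sub>F w in at z. cmod (deriv k w) \<le> C * cmod (w - z) ^ (n - 1)" "\<forall>\<^sub>F w in at z. sph_analytic h w"
        using order(4) evk C sph_analytic_eventually[OF an] by (simp_all add: eventually_nhds_conv_at)
      ultimately have "\<forall>\<^sub>F w in at z. norm (sph_deriv h w * dens (h w)) \<le> K * cmod (w - z) powr E"
        using evG evk1 evB
      proof eventually_elim
        case (elim w)
        define r where "r = cmod (w - z)"
        have r: "r > 0" using elim(1) by (simp add: r_def)
        have q: "1 + (cmod (k w))\<^sup>2 \<ge> 1" by simp
        have "sph_deriv h w = cmod (deriv k w) / (1 + (cmod (k w))\<^sup>2)"
          using sph_deriv_rot[OF elim(5,3)] by (simp add: k_def)
        also have "\<dots> \<le> cmod (deriv k w) / 1"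
          using q by (intro divide_left_mono) (auto intro: add_pos_nonneg)
        also have "\<dots> = cmod (deriv k w)" by simp
        also have "\<dots> \<le> \<bar>C\<bar> * r ^ (n - 1)"
          using elim(4) by (intro order_trans[OF elim(4)]) (auto simp: r_def intro!: mult_right_mono)
        also have "r ^ (n - 1) = r powr (real n - 1)"
          using r n2 by (simp add: powr_realpow[symmetric] of_nat_diff)
        finally have 1: "sph_deriv h w \<le> \<bar>C\<bar> * r powr (real n - 1)" .
        have "r ^ n * g \<le> cmod (k w)"
          using elim(2,6) r by (simp add: norm_mult norm_power r_def)
        moreover have "cmod (k w) / 2 \<le> chordal (h w) (\<alpha> i)"
        proof -
          have "sqrt (1 + (cmod (k w))\<^sup>2) \<le> sqrt 4"
            using power_mono[of "cmod (k w)" 1 2] elim(7) by (intro real_sqrt_le_mono) simp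
          then have "cmod (k w) / 2 \<le> cmod (k w) / sqrt (1 + (cmod (k w))\<^sup>2)"
            using q by (intro divide_left_mono) (auto intro: add_pos_nonneg)
          then show ?thesis using chordal_rot_self[OF elim(3)] by (simp add: k_def)
        qed
        ultimately have "g / 2 * r ^ n \<le> chordal (h w) (\<alpha> i)" by (simp add: mult.commute)
        then have "chordal (h w) (\<alpha> i) powr (- s i) \<le> (g / 2 * r ^ n) powr (- s i)"
          using g r s[OF i(1)] by (intro powr_mono2') auto
        also have "\<dots> = (g / 2) powr (- s i) * r powr (- (real n * s i))"
        proof -
          have rn: "r ^ n = r powr real n" using r by (simp add: powr_realpow)
          show ?thesis unfolding rn by (subst powr_mult) (use g r in \<open>auto simp: powr_powr\<close>)
        qed
        finally have 2: "chordal (h w) (\<alpha> i) powr (- s i) \<le> (g / 2) powr (- s i) * r powr (- (real n * s i))" .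
        have d: "dens (h w) = chordal (h w) (\<alpha> i) powr (- s i) * rest (J - {i}) w"
          unfolding dens_def rest_def using finite_J i(1) by (simp add: prod.remove mult.assoc)
        have "norm (sph_deriv h w * dens (h w))
            = sph_deriv h w * (chordal (h w) (\<alpha> i) powr (- s i) * \<bar>rest (J - {i}) w\<bar>)"
          unfolding d by (simp add: abs_mult)
        also have "\<dots> \<le> (\<bar>C\<bar> * r powr (real n - 1)) * (((g / 2) powr (- s i) * r powr (- (real n * s i))) * B)"
          using 1 2 elim(8) by (intro mult_mono mult_nonneg_nonneg) auto
        also have "\<dots> = K * (r powr (real n - 1) * r powr (- (real n * s i)))" by (simp add: K_def mult_ac)
        also have "r powr (real n - 1) * r powr (- (real n * s i)) = r powr E"
          by (simp add: E_def algebra_simps flip: powr_add)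
        finally show ?case by (simp add: r_def)
      qed
      moreover have "((\<lambda>w. K * cmod (w - z) powr E) \<longlongrightarrow> K * 0) (at z)"
      proof (intro tendsto_mult tendsto_const)
        have "((\<lambda>w. cmod (w - z)) \<longlongrightarrow> cmod (z - z)) (at z)" by (intro tendsto_intros)
        then have 0: "((\<lambda>w. cmod (w - z)) \<longlongrightarrow> 0) (at z)" by simp
        show "((\<lambda>w. cmod (w - z) powr E) \<longlongrightarrow> 0) (at z)"
          by (rule tendsto_zero_powrI[OF 0 tendsto_const]) (use e_pos in \<open>auto simp: E_def eventually_True\<close>)
      qed
      then have "((\<lambda>w. K * cmod (w - z) powr E) \<longlongrightarrow> 0) (at z)" by simp
      ultimately show ?thesis by (rule Lim_null_comparison)
    qed
    moreover have "dens (h z) = 0" using True by (rule dens_eq_0)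
    ultimately show ?thesis by (simp add: isCont_def)
  qed
qed

text \<open>
  The Ahlfors-Schwarz argument: at a maximum of the density relative to the hyperbolic metric of
  the disc, the Laplacian of the logarithm of the quotient is nonpositive.
\<close>

lemma sph_deriv_estimate:
  obtains C where "C > 0"
    "\<And>h c R z. 0 < R \<Longrightarrow> (\<And>z. z \<in> cball c R \<Longrightarrow> sph_analytic h z) \<Longrightarrow>
      (\<And>z j. z \<in> cball c R \<Longrightarrow> j \<in> J \<Longrightarrow> h z = \<alpha> j \<Longrightarrow> \<exists>m. real m * (1 - s j) > 1 \<and> ramified h z m) \<Longrightarrow>
      z \<in> cball c R \<Longrightarrow> sph_deriv h z * (R\<^sup>2 - (cmod (z - c))\<^sup>2) \<le> C * R"
proof -
  obtain \<kappa> where \<kappa>: "\<kappa> > 0" "\<And>x. x \<notin> \<alpha> ` J \<Longrightarrow> \<kappa> * (dens x)\<^sup>2 \<le> neg_curv x"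
    using neg_curv_ge by blast
  have main: "sph_deriv h z * (R\<^sup>2 - (cmod (z - c))\<^sup>2) \<le> 1 / sqrt \<kappa> * R"
    if R: "0 < R" and an: "\<And>z. z \<in> cball c R \<Longrightarrow> sph_analytic h z"
      and ram: "\<And>z j. z \<in> cball c R \<Longrightarrow> j \<in> J \<Longrightarrow> h z = \<alpha> j \<Longrightarrow> \<exists>m. real m * (1 - s j) > 1 \<and> ramified h z m"
      and z: "z \<in> cball c R" for h c R z
  proof -
    define f where "f w = sph_deriv h w * dens (h w)" for w
    \<comment> \<open>Up to a constant this is the quotient of the pulled-back density by the
      hyperbolic density of the disc. It vanishes on the boundary circle, so a positive maximum is
      interior.\<close>
    define v where "v w = (R\<^sup>2 - (cmod (w - c))\<^sup>2) * f w" for w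
    have vcont: "isCont v w" if "w \<in> cball c R" for w
    proof -
      have "isCont f w" unfolding f_def by (rule isCont_density[OF an[OF that] ram[OF that]])
      then show ?thesis unfolding v_def by (intro continuous_intros)
    qed
    have f0: "f w \<ge> 0" for w by (simp add: f_def dens_nonneg)
    have d0: "R\<^sup>2 - (cmod (w - c))\<^sup>2 \<ge> 0" if "w \<in> cball c R" for w
      using that power_mono[of "cmod (w - c)" R 2] by (simp add: dist_norm norm_minus_commute)
    obtain z0 where z0: "z0 \<in> cball c R" "\<And>w. w \<in> cball c R \<Longrightarrow> v w \<le> v z0"
      using continuous_attains_sup[of "cball c R" v] R vcont
      by (auto simp: continuous_at_imp_continuous_on)
    have "v z0 \<le> 1 / sqrt \<kappa> * R"
    proof (cases "v z0 \<le> 0")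
      case True
      then show ?thesis using R \<kappa>(1) by (intro order_trans[OF True]) auto
    next
      case False
      define D where "D = R\<^sup>2 - (cmod (z0 - c))\<^sup>2"
      \<comment> \<open>Positivity of the maximum puts z0 in the open disc, away from the preimages
        of cone points and from zeros of the spherical derivative. There the logarithm has a
        Laplacian.\<close>
      have D: "D > 0" and fz: "f z0 > 0"
        using False d0[OF z0(1)] f0[of z0] by (auto simp: v_def D_def zero_less_mult_iff not_le order_le_less)
      have hz: "h z0 \<notin> \<alpha> ` J" and nz: "sph_deriv h z0 \<noteq> 0"
        using fz dens_eq_0[of "h z0"] by (auto simp: f_def)
      have lt: "cmod (z0 - c) < R"
        using D R by (intro power2_less_imp_less[of _ R]) (auto simp: D_def)
      have evb: "\<forall>\<^sub>F w in nhds z0. w \<in> ball c R"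
        using lt by (intro eventually_nhds_in_open) (auto simp: dist_norm norm_minus_commute)
      have "\<forall>\<^sub>F w in at z0. v w > 0"
        using vcont[OF z0(1)] False by (intro order_tendstoD(1)[of _ "v z0"]) (auto simp: isCont_def)
      then have evv: "\<forall>\<^sub>F w in nhds z0. v w > 0" using False by (simp add: eventually_nhds_conv_at)
      have "\<forall>\<^sub>F w in nhds z0. ln (R\<^sup>2 - (cmod (w - c))\<^sup>2) + ln (f w) \<le> ln (R\<^sup>2 - (cmod (z0 - c))\<^sup>2) + ln (f z0)"
        using evb evv
      proof eventually_elim
        case (elim w)
        have w: "w \<in> cball c R" using elim(1) by simp
        have p: "R\<^sup>2 - (cmod (w - c))\<^sup>2 > 0" "f w > 0"
          using elim(2) d0[OF w] f0[of w] by (auto simp: v_def zero_less_mult_iff)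
        have "ln (v w) \<le> ln (v z0)" using z0(2)[OF w] elim(2) by simp
        then show ?case using p D fz by (simp add: v_def D_def ln_mult_pos)
      qed
      moreover have "has_laplacian (\<lambda>w. ln (R\<^sup>2 - (cmod (w - c))\<^sup>2) + ln (f w)) z0
          (- 4 * R\<^sup>2 / D\<^sup>2 + 4 * (sph_deriv h z0)\<^sup>2 * neg_curv (h z0))"
      proof (rule has_laplacian_add)
        show "has_laplacian (\<lambda>w. ln (f w)) z0 (4 * (sph_deriv h z0)\<^sup>2 * neg_curv (h z0))"
          unfolding f_def by (rule laplacian_log_density[OF an[OF z0(1)] hz nz])
        let ?v = "(cmod (z0 - c))\<^sup>2"
        have dr: "deriv (\<lambda>w. w - c) z0 = 1"
          by (rule DERIV_imp_deriv) (auto intro!: derivative_eq_intros)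
        have "has_laplacian (\<lambda>w. ln (R\<^sup>2 - (cmod (w - c))\<^sup>2)) z0
           (4 * (cmod (deriv (\<lambda>w. w - c) z0))\<^sup>2 * (- 1 / (R\<^sup>2 - ?v) + ?v * (- 1 / (R\<^sup>2 - ?v)\<^sup>2)))"
        proof (rule has_laplacian_norm_squared[of _ _ "\<lambda>v. ln (R\<^sup>2 - v)" "\<lambda>v. - 1 / (R\<^sup>2 - v)"])
          have "\<forall>\<^sub>F v in nhds ?v. v < R\<^sup>2"
            using D by (intro eventually_nhds_in_open[of "{..<R\<^sup>2}" ?v, simplified]) (simp add: D_def)
          then show "\<forall>\<^sub>F v in nhds ?v. ((\<lambda>v. ln (R\<^sup>2 - v)) has_real_derivative - 1 / (R\<^sup>2 - v)) (at v)"
            by eventually_elim (auto intro!: derivative_eq_intros)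
          show "((\<lambda>v. - 1 / (R\<^sup>2 - v)) has_real_derivative - 1 / (R\<^sup>2 - ?v)\<^sup>2) (at ?v)"
            using D by (auto intro!: derivative_eq_intros simp: D_def power2_eq_square)
        qed (auto intro!: analytic_intros)
        moreover have "4 * (cmod (deriv (\<lambda>w. w - c) z0))\<^sup>2 * (- 1 / (R\<^sup>2 - ?v) + ?v * (- 1 / (R\<^sup>2 - ?v)\<^sup>2))
            = - 4 * R\<^sup>2 / D\<^sup>2"
        proof -
          have v: "?v = R\<^sup>2 - D" by (simp add: D_def)
          show ?thesis unfolding dr v using D by (simp add: field_simps power2_eq_square)
        qed
        ultimately show "has_laplacian (\<lambda>w. ln (R\<^sup>2 - (cmod (w - c))\<^sup>2)) z0 (- 4 * R\<^sup>2 / D\<^sup>2)" by simp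
      qed
      ultimately have "- 4 * R\<^sup>2 / D\<^sup>2 + 4 * (sph_deriv h z0)\<^sup>2 * neg_curv (h z0) \<le> 0"
        using has_laplacian_max by blast
      moreover have "(sph_deriv h z0)\<^sup>2 * (\<kappa> * (dens (h z0))\<^sup>2) \<le> (sph_deriv h z0)\<^sup>2 * neg_curv (h z0)"
        by (intro mult_left_mono \<kappa>(2) hz) auto
      ultimately have "(sph_deriv h z0)\<^sup>2 * (\<kappa> * (dens (h z0))\<^sup>2) \<le> R\<^sup>2 / D\<^sup>2" by simp
      then have "\<kappa> * (v z0)\<^sup>2 \<le> R\<^sup>2"
        using D by (simp add: v_def f_def D_def[symmetric] power_mult_distrib field_simps)
      then have "(v z0)\<^sup>2 \<le> (1 / sqrt \<kappa> * R)\<^sup>2"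
        using \<kappa>(1) by (simp add: power_mult_distrib power_divide field_simps)
      from power2_le_imp_le[OF this] R \<kappa>(1) show ?thesis by simp
    qed
    \<comment> \<open>Over a cone point \<open>dens\<close> is 0, but m (1 - s_j) > 1 forces m \<ge>
      2, so the spherical derivative vanishes as well.\<close>
    moreover have "sph_deriv h z \<le> f z"
    proof (cases "h z \<in> \<alpha> ` J")
      case False
      then show ?thesis using mult_left_mono[OF dens_ge_1[OF False], of "sph_deriv h z"] by (simp add: f_def)
    next
      case True
      then obtain j where j: "j \<in> J" "h z = \<alpha> j" by blast
      obtain m where m: "real m * (1 - s j) > 1" "ramified h z m" using ram[OF z j] by blast
      have "\<not> m \<le> 1"
      proof
        assume "m \<le> 1"
        then have "real m * (1 - s j) \<le> 1 * 1" using s[OF j(1)] by (intro mult_mono) auto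
        then show False using m(1) by simp
      qed
      then have "1 < m" by simp
      then have "(deriv ^^ 1) (\<lambda>w. rot (h z) (h w)) z = 0"
        using m(2) ramified_iff_derivs[OF an[OF z]] by blast
      then have "sph_deriv h z = 0" by (simp add: sph_deriv_def)
      then show ?thesis by (simp add: f0)
    qed
    then have "sph_deriv h z * (R\<^sup>2 - (cmod (z - c))\<^sup>2) \<le> v z"
      using mult_right_mono[OF _ d0[OF z]] by (simp add: v_def mult.commute)
    ultimately show ?thesis using z0(2)[OF z] by linarith
  qed
  show ?thesis using \<kappa>(1) main by (intro that[of "1 / sqrt \<kappa>"]) auto
qed

end

section \<open>Limits and persistence of roots\<close>

text \<open>Weierstrass' theorem, after finding one coordinate for all maps. Near z a single F N
  varies by less than 1/8 and is within 1/8 of h, so h stays within 3/8 of b = h z and the later F n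
  within 1/2, the range in which \<open>rot_diff_le\<close> applies.\<close>

lemma sph_analytic_uniform_limit:
  assumes r: "r > 0"
    and an: "\<forall>\<^sub>F n in sequentially. \<forall>w\<in>ball z r. sph_analytic (F n) w"
    and lim: "\<And>e. e > 0 \<Longrightarrow> \<forall>\<^sub>F n in sequentially. \<forall>w\<in>ball z r. chordal (F n w) (h w) < e"
  shows "sph_analytic h z"
proof -
  define b where "b = h z"
  have "\<forall>\<^sub>F n in sequentially. (\<forall>w\<in>ball z r. sph_analytic (F n) w) \<and> (\<forall>w\<in>ball z r. chordal (F n w) (h w) < 1/8)"
    using an lim[of "1/8"] by (simp add: eventually_conj)
  then obtain N where N: "\<And>w. w \<in> ball z r \<Longrightarrow> sph_analytic (F N) w"
      "\<And>w. w \<in> ball z r \<Longrightarrow> chordal (F N w) (h w) < 1/8"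
    using eventually_happens'[OF sequentially_bot] by blast
  have "sph_analytic (F N) z" using N(1) r by auto
  from isCont_chordal[OF this, of "F N z"]
  have "((\<lambda>w. chordal (F N w) (F N z)) \<longlongrightarrow> chordal (F N z) (F N z)) (at z)"
    unfolding isCont_def .
  then have "\<forall>\<^sub>F w in at z. chordal (F N w) (F N z) < 1/8"
    by (rule order_tendstoD(2)) simp
  then have "\<forall>\<^sub>F w in nhds z. chordal (F N w) (F N z) < 1/8"
    by (simp add: eventually_nhds_conv_at)
  then obtain d where d: "d > 0" "\<And>w. w \<in> ball z d \<Longrightarrow> chordal (F N w) (F N z) < 1/8"
    unfolding eventually_nhds_metric by (metis dist_commute mem_ball)
  define s where "s = min r d / 2"
  have s: "s > 0" "cball z s \<subseteq> ball z r" "cball z s \<subseteq> ball z d" using r d(1) by (auto simp: s_def)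
  have hb: "chordal (h w) b < 3/8" if w: "w \<in> cball z s" for w
  proof -
    have "w \<in> ball z r" "w \<in> ball z d" "z \<in> ball z r" using w s r by auto
    from N(2)[OF this(1)] d(2)[OF this(2)] N(2)[OF this(3)] show ?thesis
      using chordal_triangle[of "h w" b "F N w"] chordal_triangle[of "F N w" b "F N z"]
        chordal_commute[of "h w" "F N w"] by (simp add: b_def)
  qed
  have Fb: "\<forall>\<^sub>F n in sequentially. \<forall>w\<in>cball z s. chordal (F n w) b < 1/2"
    using lim[of "1/8", simplified]
  proof eventually_elim
    case (elim n)
    show ?case
    proof
      fix w assume w: "w \<in> cball z s"
      then show "chordal (F n w) b < 1/2"
        using elim s(2) hb[OF w] chordal_triangle[of "F n w" b "h w"] by fastforce
    qed
  qed
  have "uniform_limit (cball z s) (\<lambda>n w. rot b (F n w)) (\<lambda>w. rot b (h w)) sequentially"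
  proof (rule uniform_limitI)
    fix e :: real assume e: "e > 0"
    show "\<forall>\<^sub>F n in sequentially. \<forall>w\<in>cball z s. dist (rot b (F n w)) (rot b (h w)) < e"
      using lim[OF half_gt_zero[OF e]] Fb
    proof eventually_elim
      case (elim n)
      show ?case
      proof
        fix w assume w: "w \<in> cball z s"
        have "cmod (rot b (F n w) - rot b (h w)) \<le> 4/3 * chordal (F n w) (h w)"
          using bspec[OF elim(2) w] hb[OF w] by (intro rot_diff_le) linarith+
        also have "\<dots> < e"
        proof -
          have "w \<in> ball z r" using w s(2) by blast
          with elim(1) have "chordal (F n w) (h w) < e / 2" by blast
          then show ?thesis using e by linarith
        qed
        finally show "dist (rot b (F n w)) (rot b (h w)) < e" by (simp add: dist_norm)
      qed
    qed
  qed
  moreover have "\<forall>\<^sub>F n in sequentially. continuous_on (cball z s) (\<lambda>w. rot b (F n w)) \<and> (\<lambda>w. rot b (F n w)) holomorphic_on ball z s"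
    using an Fb
  proof eventually_elim
    case (elim n)
    have "(\<lambda>w. rot b (F n w)) analytic_on {w}" if w: "w \<in> cball z s" for w
    proof (rule sph_analytic_rot(2))
      have "chordal (F n w) b < 1" using elim(2) w by (smt (verit) field_sum_of_halves)
      then show "hprod b (F n w) \<noteq> 0" by (rule chordal_lt_1_imp)
    qed (use elim(1) w s(2) in blast)
    then have "(\<lambda>w. rot b (F n w)) analytic_on cball z s"
      using analytic_on_analytic_at by blast
    then show ?case
      by (meson analytic_imp_holomorphic ball_subset_cball holomorphic_on_imp_continuous_on holomorphic_on_subset)
  qed
  ultimately have "(\<lambda>w. rot b (h w)) holomorphic_on ball z s"
    using holomorphic_uniform_limit[of z s "\<lambda>n w. rot b (F n w)"] trivial_limit_sequentially by blast
  then have "(\<lambda>w. rot b (h w)) analytic_on {z}"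
    using analytic_at_ball s(1) by blast
  moreover have "\<forall>\<^sub>F w in nhds z. w \<in> ball z s"
    using s(1) by (intro eventually_nhds_in_open) auto
  then have "\<forall>\<^sub>F w in nhds z. hprod b (h w) \<noteq> 0"
  proof eventually_elim
    case (elim w)
    then have "chordal (h w) b < 3/8" by (intro hb) auto
    then show ?case by (intro chordal_lt_1_imp) linarith
  qed
  ultimately show ?thesis by (intro sph_analyticI)
qed

text \<open>Hurwitz' theorem with multiplicities. A root of h of order less than m has a derivative
  of order i < m that is bounded away from 0 on a disc. Nearby maps have a root in that disc, and by
  Cauchy's inequality their i-th derivative is nonzero at it.\<close>

lemma roots_persist:
  assumes r: "r > 0" and an: "\<And>w. w \<in> ball z r \<Longrightarrow> sph_analytic h w"
    and nconst: "\<not> (\<forall>\<^sub>F w in nhds z. h w = h z)"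
  obtains \<rho> e where "0 < \<rho>" "cball z \<rho> \<subseteq> ball z r" "0 < e"
    "\<And>g. (\<And>w. w \<in> cball z \<rho> \<Longrightarrow> sph_analytic g w) \<Longrightarrow>
       (\<And>w. w \<in> cball z \<rho> \<Longrightarrow> chordal (g w) (h w) < e) \<Longrightarrow>
       \<exists>y\<in>cball z \<rho>. g y = h z \<and> (ramified g y m \<longrightarrow> ramified h z m)"
proof -
  define a where "a = h z"
  have anz: "sph_analytic h z" using an r by auto
  have az: "hprod a (h z) \<noteq> 0" by (simp add: a_def hprod_self)
  define k where "k = (\<lambda>w. rot a (h w))"
  have kan: "k analytic_on {z}" using sph_analytic_rot(2)[OF anz az] by (simp add: k_def)
  have kz: "k z = 0" by (simp add: k_def a_def)
  have ev1: "\<forall>\<^sub>F w in nhds z. chordal (h w) a < 1/4"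
  proof -
    have "((\<lambda>w. chordal (h w) a) \<longlongrightarrow> chordal (h z) a) (at z)"
      using isCont_chordal[OF anz] by (simp add: isCont_def)
    then have "\<forall>\<^sub>F w in at z. chordal (h w) a < 1/4"
      by (rule order_tendstoD(2)) (simp add: a_def)
    then show ?thesis by (simp add: eventually_nhds_conv_at a_def)
  qed
  have ev2: "\<forall>\<^sub>F w in nhds z. w = z \<or> k w \<noteq> 0"
    using kan kz
  proof (cases rule: analytic_order_cases)
    case zero
    have "\<forall>\<^sub>F w in nhds z. h w = h z"
      using zero(1) sph_analytic_rot(1)[OF anz az]
    proof eventually_elim
      case (elim w)
      then show ?case using rot_inject[OF elim(2) az] kz by (simp add: k_def)
    qed
    then show ?thesis using nconst by blast
  next
    case (order n G)
    have "\<forall>\<^sub>F w in nhds z. G w \<noteq> 0"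
      using analytic_at_imp_isCont[OF order(2)] order(3) by (rule isCont_eventually_nonzero)
    with order(4) show ?thesis by eventually_elim auto
  qed
  \<comment> \<open>If h is ramified to order m, the conclusion about multiplicities is trivial and
    the value of i is immaterial.\<close>
  obtain i where i: "ramified h z m \<or> (i < m \<and> (deriv ^^ i) k z \<noteq> 0)"
    using ramified_iff_derivs[OF anz, of m] by (auto simp: k_def a_def)
  define j where "j = (if ramified h z m then 0 else i)"
  have ev3: "\<forall>\<^sub>F w in nhds z. ramified h z m \<or> (deriv ^^ i) k w \<noteq> 0"
  proof (cases "ramified h z m")
    case False
    have "(deriv ^^ i) k analytic_on {z}" using kan by (rule analytic_higher_deriv)
    then have "\<forall>\<^sub>F w in nhds z. (deriv ^^ i) k w \<noteq> 0"
      using analytic_at_imp_isCont i False by (intro isCont_eventually_nonzero) auto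
    then show ?thesis by eventually_elim simp
  qed simp
  obtain s0 where s0: "s0 > 0" "\<And>w. w \<in> ball z s0 \<Longrightarrow> chordal (h w) a < 1/4 \<and> (w = z \<or> k w \<noteq> 0) \<and>
       (ramified h z m \<or> (deriv ^^ i) k w \<noteq> 0)"
    using eventually_conj[OF ev1 eventually_conj[OF ev2 ev3]] unfolding eventually_nhds_metric
    by (auto simp: dist_commute)
  define \<rho> where "\<rho> = min r s0 / 2"
  have \<rho>: "\<rho> > 0" "cball z \<rho> \<subseteq> ball z r" "cball z \<rho> \<subseteq> ball z s0" using r s0(1) by (auto simp: \<rho>_def)
  have khol: "k analytic_on ball z s0 \<inter> ball z r"
  proof -
    have "k analytic_on {w}" if "w \<in> ball z s0 \<inter> ball z r" for w
    proof -
      have "hprod a (h w) \<noteq> 0" using s0(2)[of w] that by (intro chordal_lt_1_imp) auto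
      then show ?thesis using sph_analytic_rot(2)[OF an[of w]] that by (simp add: k_def)
    qed
    then show ?thesis using analytic_on_analytic_at by blast
  qed
  have kan\<rho>: "k analytic_on cball z \<rho>" by (rule analytic_on_subset[OF khol]) (use \<rho> in auto)
  \<comment> \<open>With half the radius, the disc of radius p about any point of
    \<open>cball z p\<close>, in particular about the root still to be found, stays in
    \<open>cball z \<rho>\<close>.\<close>
  define p where "p = \<rho> / 2"
  have p: "p > 0" "p < \<rho>" using \<rho>(1) by (auto simp: p_def)
  have "compact (sphere z p)" "sphere z p \<noteq> {}" using p by auto
  moreover have "continuous_on (sphere z p) (\<lambda>w. cmod (k w))"
    using p by (intro continuous_on_norm holomorphic_on_imp_continuous_on analytic_imp_holomorphic
        analytic_on_subset[OF kan\<rho>]) auto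
  ultimately obtain w0 where w0: "w0 \<in> sphere z p" "\<And>w. w \<in> sphere z p \<Longrightarrow> cmod (k w0) \<le> cmod (k w)"
    using continuous_attains_inf[of "sphere z p" "\<lambda>w. cmod (k w)"] by blast
  define \<delta> where "\<delta> = cmod (k w0)"
  have "w0 \<in> cball z \<rho>" "w0 \<noteq> z" using w0(1) p by auto
  then have "w0 \<in> ball z s0" "w0 \<noteq> z" using \<rho>(3) by auto
  then have \<delta>: "\<delta> > 0" using s0(2)[of w0] by (auto simp: \<delta>_def)
  obtain \<eta> where \<eta>: "\<eta> > 0" "\<And>w. w \<in> cball z p \<Longrightarrow> ramified h z m \<or> \<eta> \<le> cmod ((deriv ^^ i) k w)"
  proof (cases "ramified h z m")
    case True then show ?thesis using that[of 1] by auto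
  next
    case False
    have "compact (cball z p)" "cball z p \<noteq> {}" using p by auto
    moreover have "continuous_on (cball z p) (\<lambda>w. cmod ((deriv ^^ i) k w))"
      using p by (intro continuous_on_norm holomorphic_on_imp_continuous_on analytic_imp_holomorphic
          analytic_higher_deriv analytic_on_subset[OF kan\<rho>]) auto
    ultimately obtain w1 where w1: "w1 \<in> cball z p" "\<And>w. w \<in> cball z p \<Longrightarrow> cmod ((deriv ^^ i) k w1) \<le> cmod ((deriv ^^ i) k w)"
      using continuous_attains_inf[of "cball z p" "\<lambda>w. cmod ((deriv ^^ i) k w)"] by blast
    have "w1 \<in> cball z \<rho>" using w1(1) p by auto
    then have "(deriv ^^ i) k w1 \<noteq> 0" using s0(2)[of w1] \<rho>(3) False by auto
    then show ?thesis using that[of "cmod ((deriv ^^ i) k w1)"] w1 by auto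
  qed
  \<comment> \<open>The bound 1/4 keeps g within 1/2 of a, where \<open>rot_diff_le\<close> costs a
    factor 4/3. Then \<delta> / 4 gives |f - k| \<le> \<delta> / 3, and the last entry makes the
    i-th derivatives differ by at most \<eta> / 3.\<close>
  define e where "e = min (1/4) (min (\<delta> / 4) (\<eta> * p ^ i / (4 * fact i)))"
  have e: "e > 0" "e \<le> 1/4" "e \<le> \<delta> / 4" "e \<le> \<eta> * p ^ i / (4 * fact i)"
    using \<delta> \<eta>(1) p(1) by (auto simp: e_def)
  have main: "\<exists>y\<in>cball z \<rho>. g y = h z \<and> (ramified g y m \<longrightarrow> ramified h z m)"
    if gan: "\<And>w. w \<in> cball z \<rho> \<Longrightarrow> sph_analytic g w"
      and gh: "\<And>w. w \<in> cball z \<rho> \<Longrightarrow> chordal (g w) (h w) < e" for g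
  proof -
    define f where "f = (\<lambda>w. rot a (g w))"
    have ga: "chordal (g w) a \<le> 1/2" if w: "w \<in> cball z \<rho>" for w
    proof -
      have "chordal (h w) a < 1/4" using s0(2)[of w] w \<rho>(3) by auto
      then show ?thesis using chordal_triangle[of "g w" a "h w"] gh[OF w] e(2) by linarith
    qed
    have ghp: "hprod a (g w) \<noteq> 0" if w: "w \<in> cball z \<rho>" for w
      using ga[OF w] by (intro chordal_lt_1_imp) linarith
    have "f analytic_on {w}" if w: "w \<in> cball z \<rho>" for w
      unfolding f_def by (rule sph_analytic_rot(2)[OF gan[OF w] ghp[OF w]])
    then have fan: "f analytic_on cball z \<rho>" using analytic_on_analytic_at by blast
    have fk: "cmod (f w - k w) \<le> 4/3 * e" if w: "w \<in> cball z \<rho>" for w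
    proof -
      have "chordal (h w) a < 1/4" using s0(2)[of w] w \<rho>(3) by auto
      then have "cmod (f w - k w) \<le> 4/3 * chordal (g w) (h w)"
        unfolding f_def k_def using ga[OF w] by (intro rot_diff_le) auto
      then show ?thesis using gh[OF w] by linarith
    qed
    \<comment> \<open>Minimum modulus, from Cauchy's inequality of order 0 for 1/f: on the circle
      |f| \<ge> 2 \<delta> / 3, whereas at the centre |f| \<le> \<delta> / 3.\<close>
    have "\<exists>y\<in>cball z p. f y = 0"
    proof (rule ccontr)
      assume no: "\<not> (\<exists>y\<in>cball z p. f y = 0)"
      have "(\<lambda>w. inverse (f w)) analytic_on cball z p"
        using no p by (intro analytic_on_inverse analytic_on_subset[OF fan]) auto
      then have hol: "(\<lambda>w. inverse (f w)) holomorphic_on cball z p" by (rule analytic_imp_holomorphic)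
      have "cmod ((deriv ^^ 0) (\<lambda>w. inverse (f w)) z) \<le> fact 0 * (3 / (2 * \<delta>)) / p ^ 0"
      proof (rule Cauchy_inequality)
        show "(\<lambda>w. inverse (f w)) holomorphic_on ball z p" using hol by (rule holomorphic_on_subset) auto
        show "continuous_on (cball z p) (\<lambda>w. inverse (f w))" using hol by (rule holomorphic_on_imp_continuous_on)
        fix w assume "cmod (z - w) = p"
        then have w: "w \<in> sphere z p" "w \<in> cball z \<rho>" using p by (auto simp: dist_norm)
        have "\<delta> \<le> cmod (k w)" using w0(2)[OF w(1)] by (simp add: \<delta>_def)
        also have "\<dots> \<le> cmod (f w) + cmod (f w - k w)"
          using norm_triangle_ineq4[of "f w" "f w - k w"] by simp
        also have "\<dots> \<le> cmod (f w) + \<delta> / 3" using fk[OF w(2)] e(3) by simp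
        finally have "2 * \<delta> / 3 \<le> cmod (f w)" by simp
        then show "cmod (inverse (f w)) \<le> 3 / (2 * \<delta>)"
          using \<delta> le_imp_inverse_le[of "2 * \<delta> / 3" "cmod (f w)"] by (simp add: norm_inverse)
      qed (use p in auto)
      then have 1: "cmod (inverse (f z)) \<le> 3 / (2 * \<delta>)" by simp
      have "cmod (f z) \<le> \<delta> / 3" using fk[of z] kz e(3) \<rho>(1) by simp
      moreover have "f z \<noteq> 0" using no p by auto
      ultimately have "inverse (\<delta> / 3) \<le> cmod (inverse (f z))"
        unfolding norm_inverse by (intro le_imp_inverse_le) auto
      then have "3 / \<delta> \<le> 3 / (2 * \<delta>)" using 1 by simp
      then show False using \<delta> by (simp add: field_simps)
    qed
    then obtain y where y: "y \<in> cball z p" "f y = 0" by blast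
    have y\<rho>: "y \<in> cball z \<rho>" using y(1) p by auto
    have gy: "g y = a"
      using rot_inject[OF ghp[OF y\<rho>] hprod_self[of a]] y(2) by (simp add: f_def)
    have "ramified h z m" if "ramified g y m"
    proof (rule ccontr)
      assume nr: "\<not> ramified h z m"
      have f0: "(deriv ^^ i) f y = 0"
        using that ramified_iff_derivs[OF gan[OF y\<rho>]] i nr unfolding gy f_def by blast
      have bp: "cball y p \<subseteq> cball z \<rho>"
      proof
        fix w assume "w \<in> cball y p"
        then show "w \<in> cball z \<rho>" using y(1) dist_triangle[of z w y] by (auto simp: p_def)
      qed
      have fky: "f analytic_on cball y p" "k analytic_on cball y p"
        using analytic_on_subset[OF fan bp] analytic_on_subset[OF kan\<rho> bp] .
      have hd: "(\<lambda>w. f w - k w) analytic_on cball y p" using fky by (rule analytic_on_diff)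
      have "cmod ((deriv ^^ i) (\<lambda>w. f w - k w) y) \<le> fact i * (4/3 * e) / p ^ i"
      proof (rule Cauchy_inequality)
        show "(\<lambda>w. f w - k w) holomorphic_on ball y p"
          by (rule holomorphic_on_subset[OF analytic_imp_holomorphic[OF hd]]) auto
        show "continuous_on (cball y p) (\<lambda>w. f w - k w)"
          by (rule holomorphic_on_imp_continuous_on[OF analytic_imp_holomorphic[OF hd]])
        fix w assume "cmod (y - w) = p"
        then have "w \<in> cball z \<rho>" using bp by (auto simp: dist_norm)
        then show "cmod (f w - k w) \<le> 4/3 * e" by (rule fk)
      qed (use p in auto)
      also have "(deriv ^^ i) (\<lambda>w. f w - k w) y = (deriv ^^ i) f y - (deriv ^^ i) k y"
        using p by (intro higher_deriv_diff[of _ "ball y p"] holomorphic_on_subset[OF analytic_imp_holomorphic[OF fky(1)]]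
            holomorphic_on_subset[OF analytic_imp_holomorphic[OF fky(2)]]) auto
      finally have "cmod ((deriv ^^ i) k y) \<le> fact i * (4/3 * e) / p ^ i" by (simp add: f0)
      also have "\<dots> \<le> fact i * (4/3 * (\<eta> * p ^ i / (4 * fact i))) / p ^ i"
        using e(4) p(1) by (intro divide_right_mono mult_left_mono) auto
      also have "\<dots> = \<eta> / 3" using p(1) by simp
      finally show False using \<eta> y(1) nr by fastforce
    qed
    then show ?thesis using gy y\<rho> by (auto simp: a_def)
  qed
  show ?thesis using that[OF \<rho>(1,2) e(1) main] .
qed

section \<open>Charts\<close>

text \<open>
  Multiplicities depend on nothing else, so that the remaining axioms of a Riemann surface need not
  be verified for restrictions to open sets.
\<close>

definition atlas :: "'a surface \<Rightarrow> bool" where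
  "atlas S \<longleftrightarrow>
    (\<Union>(U, z) \<in> charts S. U) = pts S \<and>
    (\<forall>(U, z) \<in> charts S. openin (surf_top S) U \<and> open (z ` U) \<and>
       homeomorphic_map (subtopology (surf_top S) U) (top_of_set (z ` U)) z) \<and>
    (\<forall>(U, z) \<in> charts S. \<forall>(V, w) \<in> charts S.
       (w \<circ> inv_into U z) holomorphic_on z ` (U \<inter> V))"

lemma riemann_surface_atlas: "riemann_surface S \<Longrightarrow> atlas S"
  by (simp add: riemann_surface_def atlas_def)

lemma chart_props:
  assumes "atlas S" "(U, z) \<in> charts S"
  shows "openin (surf_top S) U" and "U \<subseteq> pts S" and "open (z ` U)" and "inj_on z U"
    and "continuous_map (subtopology (surf_top S) U) euclidean z"
    and "continuous_map (top_of_set (z ` U)) (surf_top S) (inv_into U z)"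
proof -
  have *: "openin (surf_top S) U" "open (z ` U)"
      "homeomorphic_map (subtopology (surf_top S) U) (top_of_set (z ` U)) z"
    using assms by (auto simp: atlas_def)
  show "openin (surf_top S) U" "open (z ` U)" by fact+
  then show U: "U \<subseteq> pts S" by (simp add: openin_subset)
  have top: "topspace (subtopology (surf_top S) U) = U" using U by auto
  show inj: "inj_on z U" using homeomorphic_imp_injective_map[OF *(3)] unfolding top .
  show "continuous_map (subtopology (surf_top S) U) euclidean z"
    using homeomorphic_imp_continuous_map[OF *(3)] continuous_map_into_fulltopology by blast
  obtain g where g: "homeomorphic_maps (subtopology (surf_top S) U) (top_of_set (z ` U)) z g"
    using *(3) homeomorphic_map_maps by blast
  have "continuous_map (top_of_set (z ` U)) (surf_top S) g"
    using g continuous_map_into_fulltopology unfolding homeomorphic_maps_def by blast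
  moreover have "g x = inv_into U z x" if x: "x \<in> z ` U" for x
  proof -
    obtain p where p: "p \<in> U" "x = z p" using x by blast
    then have "g (z p) = p" using g unfolding homeomorphic_maps_def top by blast
    then show ?thesis using p inj by simp
  qed
  ultimately show "continuous_map (top_of_set (z ` U)) (surf_top S) (inv_into U z)"
    by (rule continuous_map_eq) simp
qed

lemma chart_image_open:
  assumes "atlas S" "(U, z) \<in> charts S" "openin (surf_top S) V" "V \<subseteq> U"
  shows "open (z ` V)"
proof -
  note c = chart_props[OF assms(1,2)]
  have "openin (top_of_set (z ` U)) {x \<in> topspace (top_of_set (z ` U)). inv_into U z x \<in> V}"
    using c(6) assms(3) by (rule openin_continuous_map_preimage)
  moreover have "{x \<in> topspace (top_of_set (z ` U)). inv_into U z x \<in> V} = z ` V"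
    using assms(4) c(4) by (auto simp: inv_into_f_f subset_iff)
  ultimately have "openin (top_of_set (z ` U)) (z ` V)" by simp
  then show ?thesis using openin_open_eq[OF c(3)] by blast
qed

lemma chart_preimage_open:
  assumes "atlas S" "(U, z) \<in> charts S" "open W" "W \<subseteq> z ` U"
  shows "openin (surf_top S) (inv_into U z ` W)"
proof -
  note c = chart_props[OF assms(1,2)]
  have "openin (subtopology (surf_top S) U) {p \<in> topspace (subtopology (surf_top S) U). z p \<in> W}"
    using c(5) assms(3) by (intro openin_continuous_map_preimage) auto
  moreover have "{p \<in> topspace (subtopology (surf_top S) U). z p \<in> W} = inv_into U z ` W"
  proof (intro set_eqI iffI)
    fix p assume "p \<in> {p \<in> topspace (subtopology (surf_top S) U). z p \<in> W}"
    then show "p \<in> inv_into U z ` W" using c(4) by (intro image_eqI[of _ _ "z p"]) auto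
  next
    fix p assume "p \<in> inv_into U z ` W"
    then show "p \<in> {p \<in> topspace (subtopology (surf_top S) U). z p \<in> W}"
      using assms(4) c(2) by (auto simp: f_inv_into_f inv_into_into subset_iff)
  qed
  ultimately show ?thesis using c(1) openin_trans_full by force
qed

lemma chart_preimage_compact:
  assumes "atlas S" "(U, z) \<in> charts S" "compact K" "K \<subseteq> z ` U"
  shows "compactin (surf_top S) (inv_into U z ` K)"
proof (rule image_compactin[OF _ chart_props(6)[OF assms(1,2)]])
  show "compactin (top_of_set (z ` U)) K" using assms(3,4) by (simp add: compactin_subtopology)
qed

lemma chart_ball:
  assumes "atlas S" "(U, z) \<in> charts S" "p \<in> U"
  obtains r where "r > 0" "cball (z p) r \<subseteq> z ` U"
  using chart_props(3)[OF assms(1,2)] assms(3) open_contains_cball by (meson imageI)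

lemma atlas_chart:
  assumes "atlas S" "p \<in> pts S"
  obtains U z where "(U, z) \<in> charts S" "p \<in> U"
proof -
  have "p \<in> (\<Union>(U, z)\<in>charts S. U)" using assms by (simp add: atlas_def)
  then show ?thesis using that by auto
qed

lemma transition_analytic:
  assumes "atlas S" "(U, z) \<in> charts S" "(V, w) \<in> charts S" "p \<in> U" "p \<in> V"
  shows "(w \<circ> inv_into U z) analytic_on {z p}"
proof -
  have "openin (surf_top S) (U \<inter> V)"
    using chart_props(1)[OF assms(1)] assms by blast
  then have "open (z ` (U \<inter> V))" by (rule chart_image_open[OF assms(1,2)]) simp
  moreover have "(w \<circ> inv_into U z) holomorphic_on z ` (U \<inter> V)"
    using assms by (auto simp: atlas_def)
  ultimately show ?thesis
    using assms(4,5) analytic_on_open analytic_on_subset by (metis IntI empty_subsetI image_eqI insert_subset)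
qed

section \<open>Meromorphic functions in charts\<close>

lemma stereo_inject: "stereo x = stereo y \<longleftrightarrow> x = y"
  by (metis chordal_eq_0_iff chordal_eq_dist dist_eq_0_iff)

text \<open>Only neighbourhoods of infinity need an argument: a point w whose image keeps distance e
  from \<open>stereo None\<close> satisfies |w| \<le> 1/e, so the complement of the preimage is
  compact.\<close>

lemma continuous_map_stereo: "continuous_map (Alexandroff_compactification euclidean) euclidean stereo"
  unfolding continuous_map_def
proof (intro conjI allI impI)
  fix V :: "(complex \<times> real) set" assume "openin euclidean V"
  then have V: "open V" by simp
  have cont: "continuous_on UNIV (\<lambda>w. stereo (Some w))"
  proof -
    have "1 + (cmod w)\<^sup>2 \<noteq> 0" for w by (smt (verit) zero_le_power2)
    then show ?thesis by (simp, intro continuous_intros) auto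
  qed
  then have op: "open ((\<lambda>w. stereo (Some w)) -` V)" using V by (simp add: open_vimage)
  show "openin (Alexandroff_compactification euclidean) {x \<in> topspace (Alexandroff_compactification euclidean). stereo x \<in> V}"
  proof (cases "stereo None \<in> V")
    case False
    have "{x. stereo x \<in> V} = Some ` ((\<lambda>w. stereo (Some w)) -` V)"
    proof (intro set_eqI iffI)
      fix x assume "x \<in> {x. stereo x \<in> V}"
      with False show "x \<in> Some ` ((\<lambda>w. stereo (Some w)) -` V)" by (cases x) auto
    qed auto
    moreover have "{x \<in> topspace (Alexandroff_compactification euclidean). stereo x \<in> V} = {x :: ecomplex. stereo x \<in> V}"
      by (auto simp: notin_range_Some)
    ultimately show ?thesis using op by simp
  next
    case True
    define C where "C = - ((\<lambda>w. stereo (Some w)) -` V)"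
    have "closed C" using op by (simp add: C_def closed_def)
    moreover have "bounded C"
    proof -
      obtain e where e: "e > 0" "ball (stereo None) e \<subseteq> V" using V True open_contains_ball by blast
      have "cmod w \<le> 1 / e" if "w \<in> C" for w
      proof -
        have "\<not> dist (stereo None) (stereo (Some w)) < e" using that e(2) by (auto simp: C_def)
        then have "e \<le> 1 / sqrt (1 + (cmod w)\<^sup>2)" by (simp only: not_less chordal_eq_dist[symmetric] chordal.simps)
        moreover have s: "sqrt (1 + (cmod w)\<^sup>2) > 0" by (smt (verit) real_sqrt_gt_zero zero_le_power2)
        ultimately have "sqrt (1 + (cmod w)\<^sup>2) \<le> 1 / e" using e(1) by (simp add: field_simps)
        moreover have "cmod w \<le> sqrt (1 + (cmod w)\<^sup>2)" by (rule real_le_rsqrt) simp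
        ultimately show ?thesis by simp
      qed
      then show ?thesis unfolding bounded_iff by blast
    qed
    ultimately have "compact C" by (simp add: compact_eq_bounded_closed)
    moreover have "{x \<in> topspace (Alexandroff_compactification euclidean). stereo x \<in> V} = insert None (Some ` (UNIV - C))"
    proof (intro set_eqI iffI)
      fix x :: ecomplex assume "x \<in> {x \<in> topspace (Alexandroff_compactification euclidean). stereo x \<in> V}"
      then show "x \<in> insert None (Some ` (UNIV - C))" by (cases x) (auto simp: C_def)
    qed (use True in \<open>auto simp: C_def\<close>)
    ultimately show ?thesis
      unfolding openin_Alexandroff_compactification using compact_imp_closed
      by (intro disjI2 exI[of _ C]) auto
  qed
qed simp

text \<open>A continuous injection of a compact space into a Hausdorff space is closed, hence
  \<open>stereo\<close> is a topological embedding.\<close>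

lemma continuous_map_sphere_iff:
  "continuous_map X (Alexandroff_compactification euclidean) g \<longleftrightarrow>
   continuous_map X euclidean (\<lambda>p. stereo (g p))" (is "?l \<longleftrightarrow> ?r")
proof
  assume ?l
  from continuous_map_compose[OF this continuous_map_stereo] show ?r by (simp add: o_def)
next
  assume r: ?r
  have top: "topspace (Alexandroff_compactification (euclidean :: complex topology)) = UNIV"
    by (auto simp: notin_range_Some)
  show ?l
    unfolding continuous_map_closedin
  proof (intro conjI allI impI)
    fix C :: "ecomplex set" assume "closedin (Alexandroff_compactification euclidean) C"
    then have "compactin (Alexandroff_compactification euclidean) C"
      using closedin_compact_space compact_space_Alexandroff_compactification by blast
    then have "compactin euclidean (stereo ` C)" using image_compactin continuous_map_stereo by blast
    then have "closedin euclidean (stereo ` C)" by (simp add: compact_imp_closed)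
    then have "closedin X {p \<in> topspace X. stereo (g p) \<in> stereo ` C}"
      using r unfolding continuous_map_closedin by blast
    moreover have "{p \<in> topspace X. stereo (g p) \<in> stereo ` C} = {p \<in> topspace X. g p \<in> C}"
      by (auto simp: stereo_inject)
    ultimately show "closedin X {p \<in> topspace X. g p \<in> C}" by simp
  qed (simp only: top, simp)
qed

lemma hprod_chart_simps:
  "hprod (Some 0) x \<noteq> 0 \<longleftrightarrow> x \<noteq> None" "hprod None x \<noteq> 0 \<longleftrightarrow> x \<noteq> Some 0"
  by (cases x; auto simp: hprod_def)+

text \<open>The two charts of \<open>riemann_sphere\<close> are, up to sign, the rotated coordinates
  centred at 0 and at infinity; \<open>hprod_chart_simps\<close> identifies their domains.\<close>

lemma rot_chart_simps:
  "x \<noteq> None \<Longrightarrow> rot (Some 0) x = the x"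
  "rot None x = - (case x of None \<Rightarrow> 0 | Some z \<Rightarrow> inverse z)"
  by (cases x; auto simp: rot_def hdet_def hprod_def inverse_eq_divide)+

lemma openin_sphere_charts:
  "openin (Alexandroff_compactification euclidean) (range Some :: ecomplex set)"
  "openin (Alexandroff_compactification euclidean) (- {Some 0} :: ecomplex set)"
proof -
  show "openin (Alexandroff_compactification euclidean) (range Some :: ecomplex set)" by simp
  have "- {Some (0 :: complex)} = insert None (Some ` (UNIV - {0}))"
  proof (intro set_eqI iffI)
    fix x assume "x \<in> - {Some (0 :: complex)}"
    then show "x \<in> insert None (Some ` (UNIV - {0}))" by (cases x) auto
  qed auto
  then show "openin (Alexandroff_compactification euclidean) (- {Some 0} :: ecomplex set)"
    unfolding openin_Alexandroff_compactification by (intro disjI2 exI[of _ "{0}"]) auto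
qed

lemma mero_sph_analytic:
  assumes S: "atlas S" and g: "g \<in> mero S" and c: "(U, z) \<in> charts S" and x: "x \<in> z ` U"
  shows "sph_analytic (g \<circ> inv_into U z) x"
proof -
  note cp = chart_props[OF S c]
  have gc: "continuous_map (surf_top S) (Alexandroff_compactification euclidean) g"
    and gh: "\<And>V w. (V, w) \<in> charts riemann_sphere \<Longrightarrow> (w \<circ> g \<circ> inv_into U z) holomorphic_on z ` (U \<inter> g -` V)"
    using g c by (auto simp: mero_def holomorphic_map_def riemann_sphere_def)
  have op: "open (z ` (U \<inter> g -` V))" if "openin (Alexandroff_compactification euclidean) V" for V
  proof (rule chart_image_open[OF S c])
    have "openin (surf_top S) (U \<inter> {p \<in> pts S. g p \<in> V})"
      using cp(1) openin_continuous_map_preimage[OF gc that] by blast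
    moreover have "U \<inter> {p \<in> pts S. g p \<in> V} = U \<inter> g -` V" using cp(2) by auto
    ultimately show "openin (surf_top S) (U \<inter> g -` V)" by simp
  qed simp
  \<comment> \<open>The factor c is the sign, 1 for the finite chart and -1 for the chart at
    infinity.\<close>
  have main: "sph_analytic (g \<circ> inv_into U z) x"
    if V: "(V, w) \<in> charts riemann_sphere" "openin (Alexandroff_compactification euclidean) V"
      and xV: "g (inv_into U z x) \<in> V" and b: "\<And>y. y \<in> V \<Longrightarrow> hprod b y \<noteq> 0 \<and> rot b y = c * w y" for V w b c
  proof (rule sph_analyticI)
    let ?O = "z ` (U \<inter> g -` V)"
    have xO: "x \<in> ?O" using x xV cp(4) by auto
    have yO: "g (inv_into U z y) \<in> V" if "y \<in> ?O" for y using that cp(4) by auto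
    have ev: "\<forall>\<^sub>F y in nhds x. y \<in> ?O" using op[OF V(2)] xO by (rule eventually_nhds_in_open)
    then show "\<forall>\<^sub>F y in nhds x. hprod b ((g \<circ> inv_into U z) y) \<noteq> 0"
      by eventually_elim (use b yO in auto)
    have "(\<lambda>y. c * (w \<circ> g \<circ> inv_into U z) y) holomorphic_on ?O"
      by (intro holomorphic_intros gh V(1))
    then have "(\<lambda>y. rot b ((g \<circ> inv_into U z) y)) holomorphic_on ?O"
      by (rule holomorphic_transform) (use b yO in auto)
    then have "(\<lambda>y. rot b ((g \<circ> inv_into U z) y)) analytic_on ?O"
      using analytic_on_open[OF op[OF V(2)]] by simp
    then show "(\<lambda>y. rot b ((g \<circ> inv_into U z) y)) analytic_on {x}"
      by (rule analytic_on_subset) (use xO in simp)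
  qed
  show ?thesis
  proof (cases "g (inv_into U z x) = None")
    case False
    show ?thesis
    proof (rule main[OF _ openin_sphere_charts(1), of the "Some 0" 1])
      show "(range Some, the) \<in> charts riemann_sphere" by (simp add: riemann_sphere_def)
      show "g (inv_into U z x) \<in> range Some" using False by auto
    qed (auto simp: hprod_chart_simps rot_chart_simps)
  next
    case True
    show ?thesis
    proof (rule main[OF _ openin_sphere_charts(2), of "\<lambda>x. case x of None \<Rightarrow> 0 | Some z \<Rightarrow> inverse z" None "-1"])
      show "(- {Some 0}, \<lambda>x. case x of None \<Rightarrow> 0 | Some z \<Rightarrow> inverse z) \<in> charts riemann_sphere"
        by (simp add: riemann_sphere_def)
      show "g (inv_into U z x) \<in> - {Some 0}" using True by simp
    qed (auto simp: hprod_chart_simps rot_chart_simps)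
  qed
qed

text \<open>Continuity into the sphere comes with \<open>sph_analytic\<close>, which makes
  \<open>stereo\<close> of the map continuous; holomorphy in each sphere chart is a change of
  rotated coordinate.\<close>

lemma meroI:
  assumes S: "atlas S" and ext: "g \<in> extensional (pts S)"
    and an: "\<And>U z x. (U, z) \<in> charts S \<Longrightarrow> x \<in> z ` U \<Longrightarrow> sph_analytic (g \<circ> inv_into U z) x"
  shows "g \<in> mero S"
proof -
  have "continuous_map (surf_top S) euclidean (\<lambda>p. stereo (g p))"
    unfolding continuous_map_def
  proof (intro conjI allI impI)
    fix V :: "(complex \<times> real) set" assume V: "openin euclidean V"
    show "openin (surf_top S) {p \<in> pts S. stereo (g p) \<in> V}"
    proof (subst openin_subopen, intro ballI)
      fix p assume p: "p \<in> {p \<in> pts S. stereo (g p) \<in> V}"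
      then obtain U z where c: "(U, z) \<in> charts S" "p \<in> U" using atlas_chart[OF S] by blast
      note cp = chart_props[OF S c(1)]
      define h where "h = g \<circ> inv_into U z"
      have "continuous_on (z ` U) (\<lambda>x. stereo (h x))"
      proof (intro continuous_at_imp_continuous_on ballI)
        fix x assume "x \<in> z ` U"
        from sph_analytic_stereo[OF an[OF c(1) this]] show "isCont (\<lambda>x. stereo (h x)) x"
          by (simp add: h_def)
      qed
      then have W: "open (z ` U \<inter> (\<lambda>x. stereo (h x)) -` V)"
        using cp(3) V continuous_open_preimage by auto
      have "openin (surf_top S) (inv_into U z ` (z ` U \<inter> (\<lambda>x. stereo (h x)) -` V))"
        by (rule chart_preimage_open[OF S c(1) W]) simp
      moreover have "p \<in> inv_into U z ` (z ` U \<inter> (\<lambda>x. stereo (h x)) -` V)"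
        using p c(2) cp(4) by (intro image_eqI[of _ _ "z p"]) (auto simp: h_def)
      moreover have "inv_into U z ` (z ` U \<inter> (\<lambda>x. stereo (h x)) -` V) \<subseteq> {p \<in> pts S. stereo (g p) \<in> V}"
        using cp(2,4) by (auto simp: h_def)
      ultimately show "\<exists>T. openin (surf_top S) T \<and> p \<in> T \<and> T \<subseteq> {p \<in> pts S. stereo (g p) \<in> V}" by blast
    qed
  qed simp
  then have cont: "continuous_map (surf_top S) (Alexandroff_compactification euclidean) g"
    by (simp add: continuous_map_sphere_iff)
  have hol: "(w \<circ> g \<circ> inv_into U z) holomorphic_on z ` (U \<inter> g -` V)"
    if c: "(U, z) \<in> charts S" and b: "\<And>y. y \<in> V \<longleftrightarrow> hprod b y \<noteq> 0" "\<And>y. y \<in> V \<Longrightarrow> w y = c * rot b y"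
    for U z V w b c
  proof -
    have "(w \<circ> g \<circ> inv_into U z) analytic_on {x}" if x: "x \<in> z ` (U \<inter> g -` V)" for x
    proof -
      have "x \<in> z ` U" using x by auto
      note h = an[OF c this]
      have gx: "g (inv_into U z x) \<in> V" using x chart_props(4)[OF S c] by auto
      note r = sph_analytic_rot[OF h, of b]
      have an': "(\<lambda>y. c * rot b ((g \<circ> inv_into U z) y)) analytic_on {x}"
        using r(2) gx b(1) by (intro analytic_intros) auto
      have "\<forall>\<^sub>F y in nhds x. c * rot b ((g \<circ> inv_into U z) y) = (w \<circ> g \<circ> inv_into U z) y"
        using r(1) gx b by (auto elim!: eventually_mono)
      from iffD1[OF analytic_at_cong[OF this refl] an'] show ?thesis .
    qed
    then have "(w \<circ> g \<circ> inv_into U z) analytic_on z ` (U \<inter> g -` V)" using analytic_on_analytic_at by blast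
    then show ?thesis by (rule analytic_imp_holomorphic)
  qed
  have h1: "(the \<circ> g \<circ> inv_into U z) holomorphic_on z ` (U \<inter> g -` range Some)" if "(U, z) \<in> charts S" for U z
    by (rule hol[OF that, of _ "Some 0" _ 1]) (auto simp: hprod_chart_simps rot_chart_simps)
  have h2: "((\<lambda>x. case x of None \<Rightarrow> 0 | Some z \<Rightarrow> inverse z) \<circ> g \<circ> inv_into U z) holomorphic_on z ` (U \<inter> g -` (- {Some 0}))"
    if "(U, z) \<in> charts S" for U z
    by (rule hol[OF that, of _ None _ "-1"]) (auto simp: hprod_chart_simps rot_chart_simps)
  show ?thesis
    using ext cont h1 h2 unfolding mero_def holomorphic_map_def by (auto simp: riemann_sphere_def)
qed

section \<open>Multiplicities in charts\<close>

text \<open>The right-hand side is \<open>root_mult\<close> read in a chart. Let k = (w - x)^n G be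
  the coordinate centred at h x. Then k is (h - a) / (h \<open>cnj a\<close> + 1) at a finite value
  a and -1/h at a pole, so \<open>zorder\<close> is n and -n respectively.\<close>

lemma ramified_iff_zorder:
  assumes an: "sph_analytic h x"
  shows "ramified h x m \<longleftrightarrow> enat m \<le>
    (if \<forall>\<^sub>F u in at x. h u = h x then \<infinity>
     else case h x of Some a \<Rightarrow> enat (nat (zorder (\<lambda>u. the (h u) - a) x))
                    | None \<Rightarrow> enat (nat (- zorder (\<lambda>u. the (h u)) x)))"
proof -
  define k where "k = (\<lambda>w. rot (h x) (h w))"
  note r = sph_analytic_rot[OF an hprod_self]
  have kan: "k analytic_on {x}" using r(2) by (simp add: k_def)
  have kx: "k x = 0" by (simp add: k_def)
  from kan kx show ?thesis
  proof (cases rule: analytic_order_cases)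
    case zero
    have ev: "\<forall>\<^sub>F w in nhds x. h w = h x"
      using zero(1) r(1)
    proof eventually_elim
      case (elim w)
      then show ?case using rot_inject[OF elim(2) hprod_self] by (simp add: k_def)
    qed
    then have "ramified h x m" by (rule ramified_const)
    then show ?thesis using ev by (simp add: eventually_nhds_conv_at)
  next
    case (order n G)
    have ram: "ramified h x m \<longleftrightarrow> m \<le> n"
      unfolding ramified_iff_bound[OF an]
      using power_bound_iff[OF order(4) analytic_at_imp_isCont[OF order(2)] order(3), of m]
      by (simp only: k_def)
    have G: "\<forall>\<^sub>F w in nhds x. G w \<noteq> 0"
      using analytic_at_imp_isCont[OF order(2)] order(3) by (rule isCont_eventually_nonzero)
    have k0: "\<forall>\<^sub>F w in at x. k w \<noteq> 0 \<and> w \<noteq> x"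
    proof -
      have "\<forall>\<^sub>F w in at x. k w = (w - x) ^ n * G w \<and> G w \<noteq> 0 \<and> w \<noteq> x"
        using order(4) G unfolding eventually_at_filter by eventually_elim simp
      then show ?thesis by eventually_elim simp
    qed
    have "\<not> (\<forall>\<^sub>F u in at x. h u = h x)"
    proof
      assume "\<forall>\<^sub>F u in at x. h u = h x"
      with k0 have "\<forall>\<^sub>F u in at x. False" by eventually_elim (simp add: k_def)
      then show False by simp
    qed
    moreover have "zorder f x = l"
      if fH: "\<forall>\<^sub>F w in at x. f w = H w * (w - x) powi l" "H analytic_on {x}" "H x \<noteq> 0" for f H l
    proof -
      obtain e where e: "e > 0" "H holomorphic_on ball x e" using analytic_at_ball[THEN iffD1, OF fH(2)] by blast
      obtain d where d: "d > 0" "\<And>w. w \<noteq> x \<Longrightarrow> dist w x < d \<Longrightarrow> f w = H w * (w - x) powi l"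
        using fH(1) unfolding eventually_at by auto
      show ?thesis
        by (rule zorder_eqI[of "ball x (min d e)" x H])
          (use e d fH(3) in \<open>auto simp: dist_commute intro: holomorphic_on_subset\<close>)
    qed
    note zo = this
    have "(case h x of Some a \<Rightarrow> enat (nat (zorder (\<lambda>u. the (h u) - a) x))
                    | None \<Rightarrow> enat (nat (- zorder (\<lambda>u. the (h u)) x))) = enat n"
    proof (cases "h x")
      case None
      have "\<forall>\<^sub>F w in at x. the (h w) = (- inverse (G w)) * (w - x) powi (- int n)"
        using k0 order(4)[unfolded eventually_nhds_conv_at, THEN conjunct1]
      proof eventually_elim
        case (elim w)
        have "k w = - (case h w of None \<Rightarrow> 0 | Some z \<Rightarrow> inverse z)"
          by (simp add: k_def None rot_chart_simps)
        then obtain u where u: "h w = Some u" "k w = - inverse u" using elim(1) by (cases "h w") auto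
        then have "u = - inverse (k w)" by simp
        also have "\<dots> = (- inverse (G w)) * inverse ((w - x) ^ n)" by (simp add: elim(2))
        finally show ?case using u(1) by (simp add: power_int_minus)
      qed
      moreover have "(\<lambda>w. - inverse (G w)) analytic_on {x}" using order(2,3) by (intro analytic_intros) auto
      ultimately have "zorder (\<lambda>u. the (h u)) x = - int n" by (rule zo) (use order(3) in simp)
      then show ?thesis by (simp add: None)
    next
      case (Some a)
      have hp: "hprod (Some 0) (h x) \<noteq> 0" by (simp add: Some hprod_chart_simps)
      note r0 = sph_analytic_rot[OF an hp]
      have ev0: "\<forall>\<^sub>F w in nhds x. h w \<noteq> None" using r0(1) by (simp add: hprod_chart_simps)
      then have "\<forall>\<^sub>F w in nhds x. rot (Some 0) (h w) = the (h w)"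
        by eventually_elim (rule rot_chart_simps)
      from analytic_at_cong[OF this refl] r0(2) have tan: "(\<lambda>w. the (h w)) analytic_on {x}" by blast
      define H where "H w = G w * (the (h w) * cnj a + 1)" for w
      have "\<forall>\<^sub>F w in nhds x. the (h w) - a = H w * (w - x) powi int n"
        using ev0 order(4) r(1)
      proof eventually_elim
        case (elim w)
        obtain u where u: "h w = Some u" using elim(1) by auto
        have nz: "u * cnj a + 1 \<noteq> 0" using elim(3) by (simp add: u Some hprod_def)
        have "k w = (u - a) / (u * cnj a + 1)" by (simp add: k_def u Some rot_def hdet_def hprod_def)
        then have "u - a = k w * (u * cnj a + 1)" using nz by simp
        then show ?case by (simp add: H_def u elim(2) mult_ac)
      qed
      then have "\<forall>\<^sub>F w in at x. the (h w) - a = H w * (w - x) powi int n"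
        by (simp add: eventually_nhds_conv_at)
      moreover have "H analytic_on {x}" unfolding H_def using tan order(2) by (intro analytic_intros)
      moreover have "H x \<noteq> 0"
        using order(3) hprod_self[of "Some a"] by (simp add: H_def Some hprod_def)
      ultimately have "zorder (\<lambda>u. the (h u) - a) x = int n" by (rule zo)
      then show ?thesis by (simp add: Some)
    qed
    ultimately show ?thesis by (simp add: ram)
  qed
qed

lemma ramified_chart_independent:
  assumes S: "atlas S" and c: "(U, z) \<in> charts S" "(V, w) \<in> charts S" and p: "p \<in> U" "p \<in> V"
    and ram: "ramified (g \<circ> inv_into U z) (z p) m"
  shows "ramified (g \<circ> inv_into V w) (w p) m"
proof -
  define \<phi> where "\<phi> = z \<circ> inv_into V w"
  have an: "\<phi> analytic_on {w p}" unfolding \<phi>_def by (rule transition_analytic[OF S c(2,1) p(2,1)])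
  note cU = chart_props[OF S c(1)] and cV = chart_props[OF S c(2)]
  have \<phi>p: "\<phi> (w p) = z p" using cV(4) p(2) by (simp add: \<phi>_def)
  have "openin (surf_top S) (V \<inter> U)" using cU(1) cV(1) by blast
  then have op: "open (w ` (V \<inter> U))" by (rule chart_image_open[OF S c(2)]) simp
  have "w p \<in> w ` (V \<inter> U)" using p by blast
  with op have "\<forall>\<^sub>F x in nhds (w p). x \<in> w ` (V \<inter> U)" by (rule eventually_nhds_in_open)
  then have "\<forall>\<^sub>F x in nhds (w p). ((g \<circ> inv_into U z) \<circ> \<phi>) x = (g \<circ> inv_into V w) x"
    by eventually_elim (use cU(4) cV(4) in \<open>auto simp: \<phi>_def\<close>)
  moreover have "ramified ((g \<circ> inv_into U z) \<circ> \<phi>) (w p) m"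
    by (rule ramified_compose[OF _ an]) (simp add: \<phi>p ram)
  ultimately show ?thesis using ramified_cong by blast
qed

text \<open>\<open>root_mult\<close> is computed in a chart picked by Hilbert choice; this releases
  it from that choice.\<close>

lemma root_mult_iff_ramified:
  assumes S: "atlas S" and g: "g \<in> mero S" and c: "(U, z) \<in> charts S" and p: "p \<in> U"
  shows "enat m \<le> root_mult S g p \<longleftrightarrow> ramified (g \<circ> inv_into U z) (z p) m"
proof -
  obtain V w where vw: "chart_at S p = (V, w)" by (cases "chart_at S p")
  have "chart_at S p \<in> charts S \<and> p \<in> fst (chart_at S p)"
    using someI[of "\<lambda>c. c \<in> charts S \<and> p \<in> fst c" "(U, z)"] c p by (simp add: chart_at_def)
  then have V: "(V, w) \<in> charts S" "p \<in> V" by (simp_all add: vw)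
  have inv: "inv_into V w (w p) = p" using chart_props(4)[OF S V(1)] V(2) by simp
  have "enat m \<le> root_mult S g p \<longleftrightarrow> ramified (g \<circ> inv_into V w) (w p) m"
    using mero_sph_analytic[OF S g V(1), of "w p"] V(2)
    by (subst ramified_iff_zorder) (auto simp: root_mult_def vw Let_def inv)
  also have "\<dots> \<longleftrightarrow> ramified (g \<circ> inv_into U z) (z p) m"
    using ramified_chart_independent[OF S] c p V by blast
  finally show ?thesis .
qed

text \<open>Finite and infinite orders share one formula: when \<mu> = \<infinity> the existence of
  a root is already a contradiction, and \<open>the_enat\<close> is consulted only alongside \<mu>
  \<noteq> \<infinity>.\<close>

lemma totally_ramified_value_iff:
  assumes "atlas S" "g \<in> mero S"
  shows "totally_ramified_value S g a \<mu> \<longleftrightarrow>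
    (\<forall>p\<in>pts S. g p = a \<longrightarrow> \<mu> \<noteq> \<infinity> \<and> (\<forall>U z. (U, z) \<in> charts S \<and> p \<in> U \<longrightarrow>
       ramified (g \<circ> inv_into U z) (z p) (the_enat \<mu>)))"
proof (cases \<mu>)
  case (enat m)
  have "\<mu> \<le> root_mult S g p \<longleftrightarrow> (\<forall>U z. (U, z) \<in> charts S \<and> p \<in> U \<longrightarrow> ramified (g \<circ> inv_into U z) (z p) m)"
    if p: "p \<in> pts S" for p
  proof -
    obtain V w where V: "(V, w) \<in> charts S" "p \<in> V" using atlas_chart[OF assms(1) p] by blast
    then show ?thesis unfolding enat using root_mult_iff_ramified[OF assms] by blast
  qed
  then show ?thesis by (auto simp: totally_ramified_value_def enat not_less)
next
  case infinity
  then show ?thesis by (auto simp: totally_ramified_value_def)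
qed

lemma ex_totally_ramified_iff:
  assumes "atlas S" "g \<in> mero S"
  shows "(\<exists>m\<ge>\<mu>. totally_ramified_value S g a m) \<longleftrightarrow> totally_ramified_value S g a \<mu>"
proof
  assume "\<exists>m\<ge>\<mu>. totally_ramified_value S g a m"
  then obtain m where m: "m \<ge> \<mu>" "totally_ramified_value S g a m" by blast
  have "root_mult S g p < m" if "root_mult S g p < \<mu>" for p
    using that m(1) by (rule less_le_trans)
  then show "totally_ramified_value S g a \<mu>"
    using m unfolding totally_ramified_value_def by (auto split: if_splits)
qed auto

section \<open>The identity theorem\<close>

text \<open>The union A of all open sets on which g = a is closed: a chart disc meeting A, small
  enough for one rotated coordinate to be finite on it, lies in A by analytic continuation.
  Connectedness does the rest.\<close>

lemma mero_identity:
  assumes S: "riemann_surface S" and g: "g \<in> mero S"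
    and V: "openin (surf_top S) V" "V \<noteq> {}" "\<And>x. x \<in> V \<Longrightarrow> g x = a"
  shows "g constant_on pts S"
proof -
  note at = riemann_surface_atlas[OF S]
  define A where "A = \<Union>{V. openin (surf_top S) V \<and> (\<forall>x\<in>V. g x = a)}"
  have opA: "openin (surf_top S) A" unfolding A_def by (rule openin_Union) blast
  have "openin (surf_top S) (pts S - A)"
  proof (subst openin_subopen, intro ballI)
    fix p assume p: "p \<in> pts S - A"
    obtain U z where c: "(U, z) \<in> charts S" "p \<in> U" using atlas_chart[OF at] p by blast
    note cp = chart_props[OF at c(1)]
    define h where "h = g \<circ> inv_into U z"
    have an: "sph_analytic h x" if "x \<in> z ` U" for x
      unfolding h_def by (rule mero_sph_analytic[OF at g c(1) that])
    define b where "b = h (z p)"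
    have "\<forall>\<^sub>F x in nhds (z p). hprod b (h x) \<noteq> 0 \<and> x \<in> z ` U"
      using sph_analytic_rot(1)[OF an, of "z p" b] c(2) cp(3)
      by (intro eventually_conj eventually_nhds_in_open) (auto simp: b_def hprod_self)
    then obtain r where r: "r > 0" "\<And>x. x \<in> ball (z p) r \<Longrightarrow> hprod b (h x) \<noteq> 0 \<and> x \<in> z ` U"
      unfolding eventually_nhds_metric by (metis dist_commute mem_ball)
    have sub: "ball (z p) r \<subseteq> z ` U" using r(2) by blast
    define W where "W = inv_into U z ` ball (z p) r"
    have opW: "openin (surf_top S) W"
      unfolding W_def by (rule chart_preimage_open[OF at c(1) _ sub]) simp
    have pW: "p \<in> W" unfolding W_def using c(2) cp(4) r(1) by (intro image_eqI[of _ _ "z p"]) auto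
    have "W \<inter> A = {}"
    proof (rule ccontr)
      assume "W \<inter> A \<noteq> {}"
      then obtain V' where V': "openin (surf_top S) V'" "\<forall>x\<in>V'. g x = a" "W \<inter> V' \<noteq> {}"
        unfolding A_def by blast
      have WU: "W \<subseteq> U" using sub unfolding W_def by (auto simp: inv_into_into subset_iff)
      define O' where "O' = z ` (W \<inter> V')"
      have opO: "open O'" unfolding O'_def
        using WU opW V'(1) by (intro chart_image_open[OF at c(1)]) auto
      have O'b: "O' \<subseteq> ball (z p) r"
        using sub by (auto simp: O'_def W_def f_inv_into_f subset_iff)
      have hO: "h x = a" if "x \<in> O'" for x
        using that WU V'(2) cp(4) by (auto simp: O'_def h_def)
      obtain y where y: "y \<in> O'" using V'(3) by (auto simp: O'_def)
      have hol: "(\<lambda>x. rot b (h x)) holomorphic_on ball (z p) r"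
      proof -
        have "(\<lambda>x. rot b (h x)) analytic_on {x}" if "x \<in> ball (z p) r" for x
          using r(2)[OF that] an by (intro sph_analytic_rot(2)) auto
        then show ?thesis using analytic_on_analytic_at analytic_imp_holomorphic by blast
      qed
      have hb: "h x = a" if x: "x \<in> ball (z p) r" for x
      proof -
        have "rot b (h x) = rot b a"
          by (rule analytic_continuation_open[OF opO _ _ _ O'b hol _ _ x, of "\<lambda>_. rot b a"])
             (use y hO in auto)
        moreover have "hprod b a \<noteq> 0" using r(2)[of y] y O'b hO[OF y] by auto
        ultimately show ?thesis using rot_inject r(2)[OF x] by blast
      qed
      have "\<forall>x\<in>W. g x = a" using hb by (auto simp: W_def h_def)
      then have "p \<in> A" unfolding A_def using opW pW by blast
      then show False using p by blast
    qed
    then show "\<exists>T. openin (surf_top S) T \<and> p \<in> T \<and> T \<subseteq> pts S - A"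
      using opW pW openin_subset[OF opW] by blast
  qed
  then have "closedin (surf_top S) A" using opA openin_subset by (auto simp: closedin_def)
  moreover have "A \<noteq> {}" unfolding A_def using V by blast
  moreover have "connected_space (surf_top S)" using S by (simp add: riemann_surface_def)
  ultimately have "A = pts S" using opA connected_space_clopen_in by blast
  then show ?thesis unfolding A_def constant_on_def by blast
qed

lemma mero_identity_chart:
  assumes S: "riemann_surface S" and g: "g \<in> mero S" and c: "(U, z) \<in> charts S" "p \<in> U"
    and ev: "\<forall>\<^sub>F x in nhds (z p). (g \<circ> inv_into U z) x = a"
  shows "g constant_on pts S"
proof -
  note at = riemann_surface_atlas[OF S]
  note cp = chart_props[OF at c(1)]
  have "\<forall>\<^sub>F x in nhds (z p). (g \<circ> inv_into U z) x = a \<and> x \<in> z ` U"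
    using ev c(2) cp(3) by (intro eventually_conj eventually_nhds_in_open) auto
  then obtain W where W: "open W" "z p \<in> W" "\<And>x. x \<in> W \<Longrightarrow> g (inv_into U z x) = a \<and> x \<in> z ` U"
    unfolding eventually_nhds by auto
  show ?thesis
  proof (rule mero_identity[OF S g])
    show "openin (surf_top S) (inv_into U z ` W)"
      using W by (intro chart_preimage_open[OF at c(1)]) auto
    show "inv_into U z ` W \<noteq> {}" using W(2) by blast
    show "g x = a" if "x \<in> inv_into U z ` W" for x using that W(3) by auto
  qed
qed

section \<open>The closed property\<close>

lemma P_ramified_iff:
  assumes "atlas S" "g \<in> mero S"
  shows "P_ramified q \<alpha> \<mu> S g \<longleftrightarrow>
    (\<forall>j\<in>{1..q}. totally_ramified_value S g (\<alpha> j) (\<mu> j)) \<or> g constant_on pts S"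
  unfolding P_ramified_def ex_totally_ramified_iff[OF assms] ..

lemma prop_P1_ramified:
  "prop_P1 (P_ramified q \<alpha> \<mu> :: 'a map_property) (P_ramified q \<alpha> \<mu> :: 'b map_property)"
  unfolding prop_P1_def
proof (intro allI impI ballI, elim conjE)
  fix S :: "'a surface" and T :: "'b surface" and \<phi> g
  assume S: "riemann_surface S" and T: "riemann_surface T" and \<phi>: "holomorphic_map S T \<phi>"
    and gs: "g \<in> sat (P_ramified q \<alpha> \<mu>) T"
  note atS = riemann_surface_atlas[OF S] and atT = riemann_surface_atlas[OF T]
  have g: "g \<in> mero T" "P_ramified q \<alpha> \<mu> T g" using gs by (auto simp: sat_def)
  have \<phi>c: "continuous_map (surf_top S) (surf_top T) \<phi>" using \<phi> by (simp add: holomorphic_map_def)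
  have \<phi>p: "\<phi> p \<in> pts T" if "p \<in> pts S" for p
    using continuous_map_image_subset_topspace[OF \<phi>c] that by blast
  define f where "f = compose (pts S) g \<phi>"
  have fp: "f p = g (\<phi> p)" if "p \<in> pts S" for p using that by (simp add: f_def compose_eq)
  \<comment> \<open>The witness is \<phi> read in the charts. Analyticity and ramification of g then
    pass to f through the lemmas on composition.\<close>
  have key: "\<exists>\<psi>. \<psi> analytic_on {z p} \<and> \<psi> (z p) = w (\<phi> p) \<and>
      (\<forall>\<^sub>F x in nhds (z p). ((g \<circ> inv_into V w) \<circ> \<psi>) x = (f \<circ> inv_into U z) x)"
    if c: "(U, z) \<in> charts S" "p \<in> U" and d: "(V, w) \<in> charts T" "\<phi> p \<in> V" for U z V w p
  proof -
    note cS = chart_props[OF atS c(1)] and cT = chart_props[OF atT d(1)]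
    define \<psi> where "\<psi> = w \<circ> \<phi> \<circ> inv_into U z"
    let ?O = "z ` (U \<inter> \<phi> -` V)"
    have "openin (surf_top S) (U \<inter> {p \<in> pts S. \<phi> p \<in> V})"
      using cS(1) openin_continuous_map_preimage[OF \<phi>c cT(1)] by blast
    moreover have "U \<inter> {p \<in> pts S. \<phi> p \<in> V} = U \<inter> \<phi> -` V" using cS(2) by auto
    ultimately have "openin (surf_top S) (U \<inter> \<phi> -` V)" by simp
    then have op: "open ?O" by (rule chart_image_open[OF atS c(1)]) simp
    have zO: "z p \<in> ?O" using c d by blast
    have "\<psi> holomorphic_on ?O" using \<phi> c(1) d(1) by (auto simp: holomorphic_map_def \<psi>_def)
    then have "\<psi> analytic_on ?O" using analytic_on_open[OF op] by simp
    then have "\<psi> analytic_on {z p}" by (rule analytic_on_subset) (use zO in simp)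
    moreover have "\<psi> (z p) = w (\<phi> p)" using c(2) cS(4) by (simp add: \<psi>_def)
    moreover have "\<forall>\<^sub>F x in nhds (z p). x \<in> ?O" using op zO by (rule eventually_nhds_in_open)
    then have "\<forall>\<^sub>F x in nhds (z p). ((g \<circ> inv_into V w) \<circ> \<psi>) x = (f \<circ> inv_into U z) x"
      by eventually_elim (use cS(2,4) cT(4) in \<open>auto simp: \<psi>_def fp subset_iff\<close>)
    ultimately show ?thesis by blast
  qed
  have fm: "f \<in> mero S"
  proof (rule meroI[OF atS])
    show "f \<in> extensional (pts S)" by (simp add: f_def compose_extensional)
    fix U z x assume c: "(U, z) \<in> charts S" and "x \<in> z ` U"
    then obtain p where p: "p \<in> U" "x = z p" by blast
    then have "\<phi> p \<in> pts T" using \<phi>p chart_props(2)[OF atS c] by blast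
    then obtain V w where d: "(V, w) \<in> charts T" "\<phi> p \<in> V" using atlas_chart[OF atT] by blast
    obtain \<psi> where \<psi>: "\<psi> analytic_on {z p}" "\<psi> (z p) = w (\<phi> p)"
        "\<forall>\<^sub>F x in nhds (z p). ((g \<circ> inv_into V w) \<circ> \<psi>) x = (f \<circ> inv_into U z) x"
      using key[OF c p(1) d] by blast
    have "sph_analytic (g \<circ> inv_into V w) (\<psi> (z p))"
      unfolding \<psi>(2) using d(2) by (intro mero_sph_analytic[OF atT g(1) d(1)]) auto
    from sph_analytic_compose[OF this \<psi>(1)] sph_analytic_cong[OF \<psi>(3)]
    show "sph_analytic (f \<circ> inv_into U z) x" unfolding p(2) by blast
  qed
  have "P_ramified q \<alpha> \<mu> S f"
    using g(2) unfolding P_ramified_iff[OF atS fm] P_ramified_iff[OF atT g(1)]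
  proof (elim disjE)
    assume "g constant_on pts T"
    then have "f constant_on pts S" unfolding constant_on_def using fp \<phi>p by metis
    then show "(\<forall>j\<in>{1..q}. totally_ramified_value S f (\<alpha> j) (\<mu> j)) \<or> f constant_on pts S" ..
  next
    assume *: "\<forall>j\<in>{1..q}. totally_ramified_value T g (\<alpha> j) (\<mu> j)"
    have "totally_ramified_value S f (\<alpha> j) (\<mu> j)" if j: "j \<in> {1..q}" for j
      unfolding totally_ramified_value_iff[OF atS fm]
    proof (intro ballI impI conjI allI, goal_cases)
      case (1 p)
      then show ?case
        using bspec[OF * j] \<phi>p fp unfolding totally_ramified_value_iff[OF atT g(1)] by metis
    next
      case (2 p U z)
      then have c: "(U, z) \<in> charts S" "p \<in> U" and p: "p \<in> pts S" "g (\<phi> p) = \<alpha> j" using fp by auto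
      obtain V w where d: "(V, w) \<in> charts T" "\<phi> p \<in> V"
        using atlas_chart[OF atT \<phi>p[OF p(1)]] by blast
      obtain \<psi> where \<psi>: "\<psi> analytic_on {z p}" "\<psi> (z p) = w (\<phi> p)"
        "\<forall>\<^sub>F x in nhds (z p). ((g \<circ> inv_into V w) \<circ> \<psi>) x = (f \<circ> inv_into U z) x"
        using key[OF c d] by blast
      have "ramified (g \<circ> inv_into V w) (\<psi> (z p)) (the_enat (\<mu> j))"
        using bspec[OF * j] \<phi>p[OF p(1)] p(2) d unfolding \<psi>(2) totally_ramified_value_iff[OF atT g(1)] by blast
      from ramified_compose[OF this \<psi>(1)] ramified_cong[OF \<psi>(3)] show ?case by blast
    qed
    then show "(\<forall>j\<in>{1..q}. totally_ramified_value S f (\<alpha> j) (\<mu> j)) \<or> f constant_on pts S" by blast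
  qed
  then show "compose (pts S) g \<phi> \<in> sat (P_ramified q \<alpha> \<mu>) S"
    using fm by (simp add: sat_def f_def)
qed

lemma atlas_restrict_surface:
  assumes S: "atlas S" and \<Omega>: "openin (surf_top S) \<Omega>"
  shows "atlas (restrict_surface S \<Omega>)"
proof -
  have sub: "\<Omega> \<subseteq> pts S" using \<Omega> by (rule openin_subset)
  have pts: "pts (restrict_surface S \<Omega>) = \<Omega>"
    using sub by (auto simp: restrict_surface_def)
  have 1: "(\<Union>(U, z)\<in>charts (restrict_surface S \<Omega>). U) = \<Omega>"
  proof -
    have "(\<Union>(U, z)\<in>charts (restrict_surface S \<Omega>). U) = (\<Union>(U, z)\<in>charts S. U) \<inter> \<Omega>"
      unfolding restrict_surface_def by auto
    also have "(\<Union>(U, z)\<in>charts S. U) = pts S" using S by (simp add: atlas_def)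
    also have "pts S \<inter> \<Omega> = \<Omega>" using sub by blast
    finally show ?thesis .
  qed
  have 2: "openin (subtopology (surf_top S) \<Omega>) (U \<inter> \<Omega>) \<and> open (z ` (U \<inter> \<Omega>)) \<and>
      homeomorphic_map (subtopology (subtopology (surf_top S) \<Omega>) (U \<inter> \<Omega>)) (top_of_set (z ` (U \<inter> \<Omega>))) z"
    if c: "(U, z) \<in> charts S" for U z
  proof (intro conjI)
    note cp = chart_props[OF S c]
    show "openin (subtopology (surf_top S) \<Omega>) (U \<inter> \<Omega>)"
      using cp(1) by (auto simp: openin_subtopology)
    show "open (z ` (U \<inter> \<Omega>))"
      using cp(1) \<Omega> by (intro chart_image_open[OF S c]) auto
    have "homeomorphic_map (subtopology (surf_top S) U) (top_of_set (z ` U)) z"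
      using S c by (auto simp: atlas_def)
    from homeomorphic_map_subtopologies[OF this, of "U \<inter> \<Omega>" "z ` (U \<inter> \<Omega>)"]
    have "homeomorphic_map (subtopology (subtopology (surf_top S) U) (U \<inter> \<Omega>))
        (subtopology (top_of_set (z ` U)) (z ` (U \<inter> \<Omega>))) z"
      using cp(2,4) sub by (auto simp: inj_on_def)
    moreover have "subtopology (subtopology (surf_top S) U) (U \<inter> \<Omega>) =
        subtopology (subtopology (surf_top S) \<Omega>) (U \<inter> \<Omega>)"
      by (simp add: subtopology_subtopology Int_commute Int_left_commute)
    moreover have "subtopology (top_of_set (z ` U)) (z ` (U \<inter> \<Omega>)) = top_of_set (z ` (U \<inter> \<Omega>))"
      by (simp add: subtopology_subtopology image_mono inf.absorb2)
    ultimately show "homeomorphic_map (subtopology (subtopology (surf_top S) \<Omega>) (U \<inter> \<Omega>))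
        (top_of_set (z ` (U \<inter> \<Omega>))) z" by simp
  qed
  have 3: "(w \<circ> inv_into (U \<inter> \<Omega>) z) holomorphic_on z ` ((U \<inter> \<Omega>) \<inter> (V \<inter> \<Omega>))"
    if c: "(U, z) \<in> charts S" and d: "(V, w) \<in> charts S" for U z V w
  proof -
    have "(w \<circ> inv_into U z) holomorphic_on z ` (U \<inter> V)" using S c d by (auto simp: atlas_def)
    then have "(w \<circ> inv_into U z) holomorphic_on z ` ((U \<inter> \<Omega>) \<inter> (V \<inter> \<Omega>))"
      by (rule holomorphic_on_subset) auto
    then show ?thesis
      by (rule holomorphic_transform)
        (use chart_props(4)[OF S c] in \<open>auto simp: inj_on_Int\<close>)
  qed
  show ?thesis
    unfolding atlas_def pts
    using 1 2 3 by (auto simp: restrict_surface_def)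
qed

text \<open>A small chart disc about a root is a relatively compact domain. By the identity theorem
  a nonconstant g is not constant there, so the restriction must satisfy the other alternative,
  which is a local condition at the root.\<close>

lemma prop_P2_ramified: "prop_P2 (P_ramified q \<alpha> \<mu>)"
  unfolding prop_P2_def
proof (intro allI impI, elim conjE)
  fix S :: "'a surface" and g
  assume S: "riemann_surface S" and g: "g \<in> mero S"
    and *: "\<forall>\<Omega>. rel_compact_domain S \<Omega> \<longrightarrow> restrict g \<Omega> \<in> sat (P_ramified q \<alpha> \<mu>) (restrict_surface S \<Omega>)"
  note at = riemann_surface_atlas[OF S]
  have "totally_ramified_value S g (\<alpha> j) (\<mu> j)" if nc: "\<not> g constant_on pts S" and j: "j \<in> {1..q}" for j
  proof -
    have main: "\<mu> j \<noteq> \<infinity> \<and> ramified (g \<circ> inv_into U z) (z p) (the_enat (\<mu> j))"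
      if p: "p \<in> pts S" "g p = \<alpha> j" and c: "(U, z) \<in> charts S" "p \<in> U" for p U z
    proof -
      note cp = chart_props[OF at c(1)]
      obtain r where r: "r > 0" "cball (z p) r \<subseteq> z ` U" by (rule chart_ball[OF at c])
      define \<Omega> where "\<Omega> = inv_into U z ` ball (z p) r"
      have bU: "ball (z p) r \<subseteq> z ` U" using r(2) ball_subset_cball by blast
      have op: "openin (surf_top S) \<Omega>"
        unfolding \<Omega>_def by (rule chart_preimage_open[OF at c(1) _ bU]) simp
      have p\<Omega>: "p \<in> \<Omega>" unfolding \<Omega>_def using c(2) cp(4) r(1) by (intro image_eqI[of _ _ "z p"]) auto
      have "connectedin (surf_top S) \<Omega>"
        unfolding \<Omega>_def using bU
        by (intro connectedin_continuous_map_image[OF cp(6)]) (auto simp: connectedin_subtopology)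
      \<comment> \<open>The closure lies in the image of the closed coordinate disc, which is
        compact and, in a Hausdorff space, closed.\<close>
      moreover have "compactin (surf_top S) (surf_top S closure_of \<Omega>)"
      proof -
        define K where "K = inv_into U z ` cball (z p) r"
        have K: "compactin (surf_top S) K"
          unfolding K_def by (rule chart_preimage_compact[OF at c(1) _ r(2)]) simp
        moreover have "Hausdorff_space (surf_top S)" using S by (simp add: riemann_surface_def)
        ultimately have "closedin (surf_top S) K" using compactin_imp_closedin by blast
        then have "surf_top S closure_of \<Omega> \<subseteq> K"
          by (rule closure_of_minimal[rotated]) (auto simp: \<Omega>_def K_def)
        then show ?thesis using closed_compactin[OF K] closedin_closure_of by blast
      qed
      ultimately have "rel_compact_domain S \<Omega>"
        using op p\<Omega> by (auto simp: rel_compact_domain_def)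
      then have r\<Omega>: "restrict g \<Omega> \<in> mero (restrict_surface S \<Omega>)"
          "P_ramified q \<alpha> \<mu> (restrict_surface S \<Omega>) (restrict g \<Omega>)"
        using * by (auto simp: sat_def)
      note at\<Omega> = atlas_restrict_surface[OF at op]
      have pts: "pts (restrict_surface S \<Omega>) = \<Omega>"
        using openin_subset[OF op] by (auto simp: restrict_surface_def)
      have "\<not> restrict g \<Omega> constant_on \<Omega>"
      proof
        assume "restrict g \<Omega> constant_on \<Omega>"
        then obtain a where "\<And>x. x \<in> \<Omega> \<Longrightarrow> g x = a" by (auto simp: constant_on_def)
        then show False using mero_identity[OF S g op] p\<Omega> nc by blast
      qed
      then have "totally_ramified_value (restrict_surface S \<Omega>) (restrict g \<Omega>) (\<alpha> j) (\<mu> j)"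
        using r\<Omega>(2) j unfolding P_ramified_iff[OF at\<Omega> r\<Omega>(1)] pts by blast
      moreover have "(U \<inter> \<Omega>, z) \<in> charts (restrict_surface S \<Omega>)"
        using c(1) by (force simp: restrict_surface_def)
      ultimately have 1: "\<mu> j \<noteq> \<infinity> \<and> ramified (restrict g \<Omega> \<circ> inv_into (U \<inter> \<Omega>) z) (z p) (the_enat (\<mu> j))"
        unfolding totally_ramified_value_iff[OF at\<Omega> r\<Omega>(1)] pts using p\<Omega> p(2) c(2) by auto
      have "open (z ` (U \<inter> \<Omega>))" using cp(1) op by (intro chart_image_open[OF at c(1)]) auto
      moreover have "z p \<in> z ` (U \<inter> \<Omega>)" using p\<Omega> c(2) by blast
      ultimately have "\<forall>\<^sub>F x in nhds (z p). x \<in> z ` (U \<inter> \<Omega>)" by (rule eventually_nhds_in_open)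
      then have "\<forall>\<^sub>F x in nhds (z p). (restrict g \<Omega> \<circ> inv_into (U \<inter> \<Omega>) z) x = (g \<circ> inv_into U z) x"
        by eventually_elim (use cp(4) in \<open>auto simp: inj_on_Int\<close>)
      from ramified_cong[OF this] 1 show ?thesis by blast
    qed
    show ?thesis
      unfolding totally_ramified_value_iff[OF at g] using main atlas_chart[OF at] by metis
  qed
  then show "g \<in> sat (P_ramified q \<alpha> \<mu>) S"
    using g P_ramified_iff[OF at g] by (auto simp: sat_def)
qed

text \<open>The complement is open: a map violating the property is nonconstant and has a root of
  too small multiplicity, and both defects persist under uniformly small changes on one compact
  set.\<close>

lemma prop_P3_ramified: "prop_P3 (P_ramified q \<alpha> \<mu>)"
  unfolding prop_P3_def
proof (intro allI impI)
  fix S :: "'a surface"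
  assume S: "riemann_surface S"
  note at = riemann_surface_atlas[OF S]
  have "cc_open S (mero S - sat (P_ramified q \<alpha> \<mu>) S)"
    unfolding cc_open_def
  proof (intro conjI ballI)
    fix g assume "g \<in> mero S - sat (P_ramified q \<alpha> \<mu>) S"
    then have g: "g \<in> mero S" and nP: "\<not> P_ramified q \<alpha> \<mu> S g" by (auto simp: sat_def)
    then obtain j where j: "j \<in> {1..q}" "\<not> totally_ramified_value S g (\<alpha> j) (\<mu> j)"
      and nc: "\<not> g constant_on pts S"
      using P_ramified_iff[OF at g] by blast
    then obtain p U z where p: "p \<in> pts S" "g p = \<alpha> j" and c: "(U, z) \<in> charts S" "p \<in> U"
      and nr: "\<mu> j = \<infinity> \<or> \<not> ramified (g \<circ> inv_into U z) (z p) (the_enat (\<mu> j))"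
      unfolding totally_ramified_value_iff[OF at g] using atlas_chart[OF at] by metis
    obtain p1 p2 where p12: "p1 \<in> pts S" "p2 \<in> pts S" "g p1 \<noteq> g p2"
      using nc p(1) unfolding constant_on_def by metis
    note cp = chart_props[OF at c(1)]
    obtain r where r: "r > 0" "cball (z p) r \<subseteq> z ` U" by (rule chart_ball[OF at c])
    define h where "h = g \<circ> inv_into U z"
    have hp: "h (z p) = \<alpha> j" using cp(4) c(2) p(2) by (simp add: h_def)
    have an: "sph_analytic h x" if "x \<in> ball (z p) r" for x
      unfolding h_def using that r(2) by (intro mero_sph_analytic[OF at g c(1)]) auto
    have ncl: "\<not> (\<forall>\<^sub>F x in nhds (z p). h x = h (z p))"
      using mero_identity_chart[OF S g c] nc unfolding h_def by blast
    obtain \<rho> e where \<rho>: "0 < \<rho>" "cball (z p) \<rho> \<subseteq> ball (z p) r" "0 < e"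
      "\<And>k. (\<And>w. w \<in> cball (z p) \<rho> \<Longrightarrow> sph_analytic k w) \<Longrightarrow>
         (\<And>w. w \<in> cball (z p) \<rho> \<Longrightarrow> chordal (k w) (h w) < e) \<Longrightarrow>
         \<exists>y\<in>cball (z p) \<rho>. k y = h (z p) \<and> (ramified k y (the_enat (\<mu> j)) \<longrightarrow> ramified h (z p) (the_enat (\<mu> j)))"
      using roots_persist[OF r(1) an ncl, of "the_enat (\<mu> j)"] by blast
    have sub: "cball (z p) \<rho> \<subseteq> z ` U" using \<rho>(2) r(2) ball_subset_cball by blast
    \<comment> \<open>The disc preserves the defective root. The two extra points keep k from being
      constant, as d is half the distance between the values of g at them.\<close>
    define K where "K = inv_into U z ` cball (z p) \<rho> \<union> {p1, p2}"
    have "compactin (surf_top S) (inv_into U z ` cball (z p) \<rho>)"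
      by (rule chart_preimage_compact[OF at c(1) _ sub]) simp
    moreover have "compactin (surf_top S) {p1, p2}" using p12 by (intro finite_imp_compactin) auto
    ultimately have K: "compactin (surf_top S) K" unfolding K_def by (rule compactin_Un)
    define d where "d = chordal (g p1) (g p2) / 2"
    have d: "d > 0" using p12(3) by (simp add: d_def chordal_pos_iff)
    have "k \<notin> sat (P_ramified q \<alpha> \<mu>) S"
      if k: "k \<in> mero S" and close: "\<And>x. x \<in> K \<Longrightarrow> chordal (k x) (g x) < min e d" for k
    proof
      assume "k \<in> sat (P_ramified q \<alpha> \<mu>) S"
      then have Pk: "(\<forall>j\<in>{1..q}. totally_ramified_value S k (\<alpha> j) (\<mu> j)) \<or> k constant_on pts S"
        using P_ramified_iff[OF at k] by (auto simp: sat_def)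
      have "k p1 \<noteq> k p2"
      proof
        assume eq: "k p1 = k p2"
        have "chordal (g p1) (g p2) \<le> chordal (g p1) (k p1) + chordal (k p1) (g p2)"
          by (rule chordal_triangle)
        also have "\<dots> < d + d"
          using close[of p1] close[of p2] eq chordal_commute[of "g p1"] by (auto simp: K_def)
        finally show False by (simp add: d_def)
      qed
      then have "\<not> k constant_on pts S" using p12 unfolding constant_on_def by metis
      then have tr: "totally_ramified_value S k (\<alpha> j) (\<mu> j)" using Pk j(1) by blast
      have "\<exists>y\<in>cball (z p) \<rho>. (k \<circ> inv_into U z) y = h (z p) \<and>
          (ramified (k \<circ> inv_into U z) y (the_enat (\<mu> j)) \<longrightarrow> ramified h (z p) (the_enat (\<mu> j)))"
      proof (rule \<rho>(4))
        fix w assume w: "w \<in> cball (z p) \<rho>"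
        then show "sph_analytic (k \<circ> inv_into U z) w"
          using sub by (intro mero_sph_analytic[OF at k c(1)]) auto
        show "chordal ((k \<circ> inv_into U z) w) (h w) < e"
          using close[of "inv_into U z w"] w by (auto simp: K_def h_def)
      qed
      then obtain y where y: "y \<in> cball (z p) \<rho>" "k (inv_into U z y) = \<alpha> j"
        "ramified (k \<circ> inv_into U z) y (the_enat (\<mu> j)) \<longrightarrow> ramified h (z p) (the_enat (\<mu> j))"
        by (auto simp: hp)
      have yU: "y \<in> z ` U" using y(1) sub by blast
      then have iU: "inv_into U z y \<in> U" "z (inv_into U z y) = y"
        by (auto intro: inv_into_into f_inv_into_f)
      \<comment> \<open>The mere existence of the root y rules out \<mu> j = \<infinity>; in the
        finite case its multiplicity contradicts that of the original root.\<close>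
      have "\<mu> j \<noteq> \<infinity> \<and> ramified (k \<circ> inv_into U z) y (the_enat (\<mu> j))"
        using tr y(2) iU c(1) cp(2) unfolding totally_ramified_value_iff[OF at k] by (metis subsetD)
      then show False using y(3) nr by (auto simp: h_def)
    qed
    then show "\<exists>K e. compactin (surf_top S) K \<and> 0 < e \<and>
        {k \<in> mero S. \<forall>x\<in>K. chordal (k x) (g x) < e} \<subseteq> mero S - sat (P_ramified q \<alpha> \<mu>) S"
      using K \<rho>(3) d by (intro exI[of _ K] exI[of _ "min e d"]) auto
  qed auto
  moreover have "sat (P_ramified q \<alpha> \<mu>) S \<subseteq> mero S" by (auto simp: sat_def)
  ultimately show "closedin (mero_top S) (sat (P_ramified q \<alpha> \<mu>) S)"
    by (simp add: closedin_def topspace_mero_top openin_mero_top)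
qed

section \<open>Normality\<close>

text \<open>Second countability supplies countably many discs, as the diagonal argument demands:
  keep the basic open sets that fit into a half disc and choose one disc for each. The half discs
  cover, while the full discs leave room for interior estimates.\<close>

lemma countable_chart_discs:
  assumes S: "riemann_surface S"
  shows "\<exists>(U :: nat \<Rightarrow> 'a set) z c (r :: nat \<Rightarrow> real).
    (\<forall>n. (U n, z n) \<in> charts S \<and> r n > 0 \<and> cball (c n) (r n) \<subseteq> z n ` U n) \<and>
    (\<forall>p\<in>pts S. \<exists>n. p \<in> inv_into (U n) (z n) ` ball (c n) (r n / 2))"
proof -
  note at = riemann_surface_atlas[OF S]
  have "second_countable_space (surf_top S)" using S by (simp add: riemann_surface_def)
  then obtain \<B> where \<B>: "countable \<B>"
    "\<forall>U x. openin (surf_top S) U \<and> x \<in> U \<longrightarrow> (\<exists>V\<in>\<B>. x \<in> V \<and> V \<subseteq> U)"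
    unfolding second_countable_space_def by blast
  define good where "good V U z c r \<longleftrightarrow> (U, z) \<in> charts S \<and> r > 0 \<and> cball c r \<subseteq> z ` U \<and>
      V \<subseteq> inv_into U z ` ball c (r / 2)" for V U z c and r :: real
  define \<C> where "\<C> = {V \<in> \<B>. \<exists>U z c r. good V U z c r}"
  have cover: "\<exists>V\<in>\<C>. p \<in> V" if p: "p \<in> pts S" for p
  proof -
    obtain U z where c: "(U, z) \<in> charts S" "p \<in> U" using atlas_chart[OF at p] by blast
    obtain r where r: "r > 0" "cball (z p) r \<subseteq> z ` U" by (rule chart_ball[OF at c])
    have sub: "ball (z p) (r / 2) \<subseteq> z ` U" using r by (intro order_trans[OF _ r(2)]) auto
    have "openin (surf_top S) (inv_into U z ` ball (z p) (r / 2))"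
      by (rule chart_preimage_open[OF at c(1) _ sub]) simp
    moreover have "p \<in> inv_into U z ` ball (z p) (r / 2)"
      using c(2) chart_props(4)[OF at c(1)] r(1) by (intro image_eqI[of _ _ "z p"]) auto
    ultimately obtain V where "V \<in> \<B>" "p \<in> V" "V \<subseteq> inv_into U z ` ball (z p) (r / 2)"
      using \<B>(2) by blast
    then show ?thesis using c(1) r unfolding \<C>_def good_def by blast
  qed
  have ne: "\<C> \<noteq> {}" using S cover unfolding riemann_surface_def by blast
  have ct: "countable \<C>" using \<B>(1) unfolding \<C>_def by (rule countable_subset[rotated]) blast
  define N where "N = from_nat_into \<C>"
  have "\<exists>U z c r. good (N n) U z c r" for n
    using from_nat_into[OF ne, of n] unfolding \<C>_def N_def by blast
  then obtain U z c r where g: "\<And>n. good (N n) (U n) (z n) (c n) (r n)" by metis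
  have "\<exists>n. p \<in> inv_into (U n) (z n) ` ball (c n) (r n / 2)" if p: "p \<in> pts S" for p
  proof -
    obtain V where V: "V \<in> \<C>" "p \<in> V" using cover[OF p] by blast
    obtain n where "N n = V" using from_nat_into_surj[OF ct V(1)] unfolding N_def by blast
    then show ?thesis using V(2) g[of n] unfolding good_def by blast
  qed
  with g show ?thesis
    unfolding good_def by (intro exI[of _ U] exI[of _ z] exI[of _ c] exI[of _ r]) blast
qed

lemma norm_stereo_le_1: "norm (stereo x) \<le> 1"
  using chordal_le_1[of x None] by (simp add: chordal_eq_dist zero_prod_def[symmetric])

lemma closed_range_stereo: "closed (range stereo)"
proof -
  have "compactin (Alexandroff_compactification euclidean) (UNIV :: ecomplex set)"
    using compact_space_Alexandroff_compactification[of "euclidean :: complex topology"]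
    unfolding compact_space_def topspace_Alexandroff_compactification by (simp add: UNIV_option_conv)
  from image_compactin[OF this continuous_map_stereo] show ?thesis
    by (simp add: compact_imp_closed)
qed

text \<open>Under \<open>stereo\<close> the maps are bounded and equi-Lipschitz on each compact half
  disc, so Arzela-Ascoli applies there and a diagonal sequence converges on all of them. Finite
  subcovers give uniform convergence on every compact set.\<close>

lemma equi_Lipschitz_normal:
  fixes f :: "nat \<Rightarrow> 'a \<Rightarrow> ecomplex"
  assumes S: "riemann_surface S" and f: "\<And>m. f m \<in> mero S"
    and lip: "\<And>U z c r. (U, z) \<in> charts S \<Longrightarrow> r > 0 \<Longrightarrow> cball c r \<subseteq> z ` U \<Longrightarrow>
      \<exists>L. \<forall>m. \<forall>x\<in>cball c (r / 2). \<forall>y\<in>cball c (r / 2).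
        chordal ((f m \<circ> inv_into U z) x) ((f m \<circ> inv_into U z) y) \<le> L * cmod (x - y)"
  shows "\<exists>d g. strict_mono d \<and> limitin (mero_top S) (f \<circ> d) g sequentially"
proof -
  note at = riemann_surface_atlas[OF S]
  obtain U z c and r :: "nat \<Rightarrow> real" where
    disc0: "\<forall>n. (U n, z n) \<in> charts S \<and> r n > 0 \<and> cball (c n) (r n) \<subseteq> z n ` U n"
      "\<forall>p\<in>pts S. \<exists>n. p \<in> inv_into (U n) (z n) ` ball (c n) (r n / 2)"
    using countable_chart_discs[OF S] by blast
  then have disc: "\<And>n. (U n, z n) \<in> charts S" "\<And>n. r n > 0" "\<And>n. cball (c n) (r n) \<subseteq> z n ` U n"
    "\<And>p. p \<in> pts S \<Longrightarrow> \<exists>n. p \<in> inv_into (U n) (z n) ` ball (c n) (r n / 2)"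
    by blast+
  define B where "B n = cball (c n) (r n / 2)" for n
  define F where "F n m x = stereo (f m (inv_into (U n) (z n) x))" for n m x
  have BU: "B n \<subseteq> z n ` U n" for n
    using disc(2)[of n] by (intro order_trans[OF _ disc(3)[of n]]) (auto simp: B_def)
  define P where "P n d \<longleftrightarrow> (\<exists>G. uniform_limit (B n) (\<lambda>m. F n (d m)) G sequentially)"
    for n and d :: "nat \<Rightarrow> nat"
  interpret subseqs P
  proof
    fix n and d :: "nat \<Rightarrow> nat" assume "strict_mono d"
    obtain L where L: "\<And>m x y. x \<in> B n \<Longrightarrow> y \<in> B n \<Longrightarrow>
        chordal (f m (inv_into (U n) (z n) x)) (f m (inv_into (U n) (z n) y)) \<le> L * cmod (x - y)"
      using lip[OF disc(1)[of n] disc(2)[of n] disc(3)[of n]] unfolding B_def[symmetric] o_def by blast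
    have eq: "\<exists>\<delta>>0. \<forall>m y. y \<in> B n \<and> norm (x - y) < \<delta> \<longrightarrow> norm (F n (d m) x - F n (d m) y) < e"
      if x: "x \<in> B n" and e: "0 < e" for x e
    proof (intro exI[of _ "e / (\<bar>L\<bar> + 1)"] conjI allI impI)
      show "0 < e / (\<bar>L\<bar> + 1)" using e by simp
      fix m y assume y: "y \<in> B n \<and> norm (x - y) < e / (\<bar>L\<bar> + 1)"
      have "norm (F n (d m) x - F n (d m) y) \<le> L * cmod (x - y)"
        using L[OF x, of y "d m"] y by (simp add: F_def chordal_eq_dist dist_norm)
      also have "\<dots> \<le> (\<bar>L\<bar> + 1) * cmod (x - y)" by (intro mult_right_mono) auto
      also have "\<dots> < e" using y by (simp add: field_simps)
      finally show "norm (F n (d m) x - F n (d m) y) < e" .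
    qed
    obtain G k where k: "strict_mono (k :: nat \<Rightarrow> nat)"
      "\<And>e. 0 < e \<Longrightarrow> \<exists>N. \<forall>m x. N \<le> m \<and> x \<in> B n \<longrightarrow> norm (F n (d (k m)) x - G x) < e"
    proof (rule Arzela_Ascoli[of "B n" "\<lambda>m. F n (d m)" 1])
      show "compact (B n)" by (simp add: B_def)
    qed (use eq norm_stereo_le_1 in \<open>auto simp: F_def\<close>)
    have "uniform_limit (B n) (\<lambda>m. F n ((d \<circ> k) m)) G sequentially"
      unfolding uniform_limit_sequentially_iff dist_norm o_def using k(2) by meson
    then have "P n (d \<circ> k)" unfolding P_def by blast
    with k(1) show "\<exists>r'. strict_mono r' \<and> P n (d \<circ> r')" by blast
  qed
  define d where "d = diagseq"
  have d: "strict_mono d" unfolding d_def by (rule subseq_diagseq)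
  have "\<exists>G. uniform_limit (B n) (\<lambda>m. F n (d m)) G sequentially" for n
  proof -
    \<comment> \<open>The diagonal sequence is a subsequence of the n-th one only from index n + 1
      on; the shift is undone below, since uniform convergence ignores finitely many terms.\<close>
    have "P n (diagseq \<circ> ((+) (Suc n)))"
    proof (rule diagseq_holds)
      fix s' :: "nat \<Rightarrow> nat" and s n assume s': "strict_mono s'" and "P n s"
      then obtain G where "uniform_limit (B n) (\<lambda>m. F n (s m)) G sequentially" by (auto simp: P_def)
      from filterlim_compose[OF this filterlim_subseq[OF s']]
      show "P n (s \<circ> s')" by (auto simp: P_def o_def)
    qed
    then obtain G where G: "uniform_limit (B n) (\<lambda>m. F n (d (Suc n + m))) G sequentially"
      by (auto simp: P_def d_def o_def)
    have "uniform_limit (B n) (\<lambda>m. F n (d m)) G sequentially"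
      unfolding uniform_limit_iff
    proof (intro allI impI)
      fix e :: real assume "e > 0"
      then have "\<forall>\<^sub>F m in sequentially. \<forall>x\<in>B n. dist (F n (d (m + Suc n)) x) (G x) < e"
        using G unfolding uniform_limit_iff by (simp add: add.commute)
      then show "\<forall>\<^sub>F m in sequentially. \<forall>x\<in>B n. dist (F n (d m) x) (G x) < e"
        by (rule eventually_sequentially_seg[THEN iffD1])
    qed
    then show ?thesis by blast
  qed
  then obtain G where G: "\<And>n. uniform_limit (B n) (\<lambda>m. F n (d m)) (G n) sequentially" by metis
  have ptlim: "\<exists>x. (\<lambda>m. stereo (f (d m) p)) \<longlonglongrightarrow> stereo x" if p: "p \<in> pts S" for p
  proof -
    obtain n w where w: "p = inv_into (U n) (z n) w" "w \<in> ball (c n) (r n / 2)" using disc(4)[OF p] by blast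
    then have "w \<in> B n" by (simp add: B_def)
    from tendsto_uniform_limitI[OF G this]
    have lim: "(\<lambda>m. stereo (f (d m) p)) \<longlonglongrightarrow> G n w" by (simp add: F_def w(1))
    \<comment> \<open>Arzela-Ascoli yields a limit in Euclidean space; closedness of the image of
      the sphere brings it back to a point of the sphere.\<close>
    have "G n w \<in> range stereo"
      by (rule closed_sequentially[OF closed_range_stereo _ lim]) simp
    then show ?thesis using lim by auto
  qed
  define g where "g = restrict (\<lambda>p. SOME x. (\<lambda>m. stereo (f (d m) p)) \<longlonglongrightarrow> stereo x) (pts S)"
  have glim: "(\<lambda>m. stereo (f (d m) p)) \<longlonglongrightarrow> stereo (g p)" if p: "p \<in> pts S" for p
    using someI_ex[OF ptlim[OF p]] p by (simp add: g_def)
  have disc_lim: "\<forall>\<^sub>F m in sequentially. \<forall>p\<in>inv_into (U n) (z n) ` B n. chordal (f (d m) p) (g p) < e"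
    if e: "e > 0" for n e
  proof -
    have Gg: "G n w = stereo (g (inv_into (U n) (z n) w))" if w: "w \<in> B n" for w
    proof -
      have "inv_into (U n) (z n) w \<in> pts S"
        using BU[of n] w chart_props(2)[OF at disc(1)[of n]] by (blast intro: inv_into_into)
      from glim[OF this] tendsto_uniform_limitI[OF G w] show ?thesis
        unfolding F_def by (rule LIMSEQ_unique[rotated])
    qed
    have "\<forall>\<^sub>F m in sequentially. \<forall>w\<in>B n. dist (F n (d m) w) (G n w) < e"
      using G[of n] e unfolding uniform_limit_iff by blast
    then show ?thesis
      by eventually_elim (auto simp: Gg F_def chordal_eq_dist)
  qed
  have comp_lim: "\<forall>\<^sub>F m in sequentially. \<forall>p\<in>K. chordal (f (d m) p) (g p) < e"
    if K: "compactin (surf_top S) K" and e: "e > 0" for K e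
  proof -
    define V where "V n = inv_into (U n) (z n) ` ball (c n) (r n / 2)" for n
    have op: "openin (surf_top S) (V n)" for n
      unfolding V_def using BU[of n] by (intro chart_preimage_open[OF at disc(1)]) (auto simp: B_def)
    have "\<exists>n. p \<in> V n" if "p \<in> K" for p
      unfolding V_def using disc(4) compactin_subset_topspace[OF K] that by blast
    then have "K \<subseteq> \<Union>(range V)" by blast
    then obtain \<F> where \<F>: "finite \<F>" "\<F> \<subseteq> range V" "K \<subseteq> \<Union>\<F>"
      using compactinD[OF K, of "range V"] op by auto
    obtain I where "finite I" "\<F> = V ` I" using finite_subset_image[OF \<F>(1,2)] by blast
    with \<F>(3) have I: "finite I" "K \<subseteq> (\<Union>n\<in>I. V n)" by auto
    have "\<forall>\<^sub>F m in sequentially. \<forall>n\<in>I. \<forall>p\<in>inv_into (U n) (z n) ` B n. chordal (f (d m) p) (g p) < e"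
      using I(1) disc_lim[OF e] by (simp add: eventually_ball_finite_distrib)
    then show ?thesis
    proof eventually_elim
      case (elim m)
      have "V n \<subseteq> inv_into (U n) (z n) ` B n" for n unfolding V_def B_def by (intro image_mono) auto
      then show ?case using elim I(2) by blast
    qed
  qed
  have "g \<in> mero S"
  proof (rule meroI[OF at])
    show "g \<in> extensional (pts S)" by (simp add: g_def)
    fix U z x assume ch: "(U, z) \<in> charts S" and x: "x \<in> z ` U"
    note cp = chart_props[OF at ch]
    obtain \<rho> where \<rho>: "\<rho> > 0" "cball x \<rho> \<subseteq> z ` U" using cp(3) x open_contains_cball by blast
    have K: "compactin (surf_top S) (inv_into U z ` cball x \<rho>)"
      by (rule chart_preimage_compact[OF at ch _ \<rho>(2)]) simp
    show "sph_analytic (g \<circ> inv_into U z) x"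
    proof (rule sph_analytic_uniform_limit[OF \<rho>(1)])
      have "\<forall>w\<in>ball x \<rho>. sph_analytic (f (d m) \<circ> inv_into U z) w" for m
        using \<rho>(2) by (intro ballI mero_sph_analytic[OF at f ch]) auto
      then show "\<forall>\<^sub>F m in sequentially. \<forall>w\<in>ball x \<rho>. sph_analytic (f (d m) \<circ> inv_into U z) w"
        by (intro always_eventually allI)
      fix e :: real assume "e > 0"
      from comp_lim[OF K this]
      show "\<forall>\<^sub>F m in sequentially. \<forall>w\<in>ball x \<rho>. chordal ((f (d m) \<circ> inv_into U z) w) ((g \<circ> inv_into U z) w) < e"
        by eventually_elim auto
    qed
  qed
  then have "limitin (mero_top S) (f \<circ> d) g sequentially"
    unfolding limitin_mero_top using f comp_lim by auto
  with d show ?thesis by blast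
qed

lemma prop_P4_ramified:
  assumes q: "q > 0" and inj: "inj_on \<alpha> {1..q}" and \<mu>: "\<forall>j\<in>{1..q}. \<mu> j \<ge> 2"
    and sum: "(\<Sum>j=1..q. 1 - recip (\<mu> j)) > 2"
  shows "prop_P4 (P_ramified q \<alpha> \<mu>)"
  unfolding prop_P4_def normal_family_def
proof (intro allI impI)
  fix S :: "'a surface" and f :: "nat \<Rightarrow> 'a \<Rightarrow> ecomplex"
  assume S: "riemann_surface S" and rf: "range f \<subseteq> sat (P_ramified q \<alpha> \<mu>) S"
  note at = riemann_surface_atlas[OF S]
  have f: "f m \<in> mero S" "P_ramified q \<alpha> \<mu> S (f m)" for m using rf by (auto simp: sat_def)
  define \<gamma> where "\<gamma> = (\<Sum>j=1..q. 1 - recip (\<mu> j))"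
  \<comment> \<open>Since reciprocals are at most 1/2, the bound 1/4 keeps s_j positive. The other
    entry loses at most half of the excess \<gamma> - 2 in the sum.\<close>
  define \<delta> where "\<delta> = min (1/4) ((\<gamma> - 2) / (2 * real q))"
  define s where "s j = 1 - recip (\<mu> j) - \<delta>" for j
  have \<delta>: "\<delta> > 0" "\<delta> \<le> 1/4" using sum q by (auto simp: \<delta>_def \<gamma>_def)
  have rec: "0 \<le> recip (\<mu> j) \<and> recip (\<mu> j) \<le> 1/2" if "j \<in> {1..q}" for j
  proof (cases "\<mu> j")
    case (enat m)
    have "enat 2 \<le> enat m" using \<mu> that enat by (metis numeral_eq_enat)
    then show ?thesis by (simp add: enat field_simps)
  qed simp
  interpret cone_metric "{1..q}" \<alpha> s
  proof
    show "inj_on \<alpha> {1..q}" by (rule inj)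
    show "0 < s j \<and> s j < 1" if "j \<in> {1..q}" for j
      using rec[OF that] \<delta> by (auto simp: s_def)
    have "real q * \<delta> \<le> real q * ((\<gamma> - 2) / (2 * real q))"
      by (intro mult_left_mono) (auto simp: \<delta>_def)
    also have "\<dots> = (\<gamma> - 2) / 2" using q by simp
    finally have "real q * \<delta> \<le> (\<gamma> - 2) / 2" .
    moreover have "(\<Sum>j=1..q. s j) = \<gamma> - real q * \<delta>"
      unfolding s_def \<gamma>_def by (simp add: sum_subtractf)
    ultimately show "(\<Sum>j=1..q. s j) > 2" using sum by (simp add: \<gamma>_def)
  qed simp
  obtain C where C: "C > 0" "\<And>h c R z. 0 < R \<Longrightarrow> (\<And>z. z \<in> cball c R \<Longrightarrow> sph_analytic h z) \<Longrightarrow>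
      (\<And>z j. z \<in> cball c R \<Longrightarrow> j \<in> {1..q} \<Longrightarrow> h z = \<alpha> j \<Longrightarrow> \<exists>m. real m * (1 - s j) > 1 \<and> ramified h z m) \<Longrightarrow>
      z \<in> cball c R \<Longrightarrow> sph_deriv h z * (R\<^sup>2 - (cmod (z - c))\<^sup>2) \<le> C * R"
    using sph_deriv_estimate by blast
  show "\<exists>d g. strict_mono d \<and> limitin (mero_top S) (f \<circ> d) g sequentially"
  proof (rule equi_Lipschitz_normal[OF S f(1)])
    fix U z c and r :: real
    assume ch: "(U, z) \<in> charts S" and r: "r > 0" and sub: "cball c r \<subseteq> z ` U"
    note cp = chart_props[OF at ch]
    \<comment> \<open>On the half disc r^2 - |x - c|^2 is at least 3 r^2 / 4, which turns the bound
      C r of the Ahlfors-Schwarz estimate into 4 C / (3 r), a constant independent of m.\<close>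
    have "chordal ((f m \<circ> inv_into U z) x) ((f m \<circ> inv_into U z) y) \<le> 4 * C / (3 * r) * cmod (x - y)"
      if xy: "x \<in> cball c (r / 2)" "y \<in> cball c (r / 2)" for m x y
    proof -
      define h where "h = f m \<circ> inv_into U z"
      have an: "sph_analytic h x" if "x \<in> z ` U" for x
        unfolding h_def by (rule mero_sph_analytic[OF at f(1) ch that])
      have ram: "\<exists>N. real N * (1 - s j) > 1 \<and> ramified h x N"
        if x: "x \<in> cball c r" and j: "j \<in> {1..q}" and hx: "h x = \<alpha> j" for x j
      proof -
        have xU: "x \<in> z ` U" using x sub by blast
        define p where "p = inv_into U z x"
        have p: "p \<in> U" "z p = x" "p \<in> pts S"
          using xU cp(2) by (auto simp: p_def inv_into_into f_inv_into_f)
        show ?thesis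
        proof (cases "f m constant_on pts S")
          \<comment> \<open>A constant map may take the value \<alpha>_j, but it is ramified to
            every order, so some N is large enough.\<close>
          case True
          then obtain a where a: "\<And>p. p \<in> pts S \<Longrightarrow> f m p = a" by (auto simp: constant_on_def)
          have "\<forall>\<^sub>F w in nhds x. w \<in> z ` U" using cp(3) xU by (rule eventually_nhds_in_open)
          then have "\<forall>\<^sub>F w in nhds x. h w = h x"
          proof eventually_elim
            case (elim w)
            have "inv_into U z w \<in> pts S" using elim cp(2) inv_into_into by (metis subsetD)
            then show ?case using a p(3) by (simp add: h_def p_def)
          qed
          then have "ramified h x N" for N by (rule ramified_const)
          moreover have "1 - s j > 0" using rec[OF j] \<delta> by (auto simp: s_def)
          then obtain N where "1 < real N * (1 - s j)" using reals_Archimedean3 by blast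
          ultimately show ?thesis by blast
        next
          case False
          then have "totally_ramified_value S (f m) (\<alpha> j) (\<mu> j)"
            using f(2)[of m] j P_ramified_iff[OF at f(1)] by blast
          moreover have "f m p = \<alpha> j" using hx by (simp add: h_def p_def)
          ultimately have tr: "\<mu> j \<noteq> \<infinity>" "ramified h x (the_enat (\<mu> j))"
            unfolding totally_ramified_value_iff[OF at f(1)] h_def using p ch by blast+
          obtain N where N: "\<mu> j = enat N" using tr(1) by auto
          have "enat 2 \<le> enat N" using \<mu> j N by (metis numeral_eq_enat)
          \<comment> \<open>Here 1 - s_j = 1/N + \<delta>: the positive \<delta> yields the strict
            inequality required by the cone metric.\<close>
          then have "real N * (1 - s j) = 1 + real N * \<delta>" "real N * \<delta> > 0"
            using \<delta>(1) by (auto simp: s_def N field_simps)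
          then have "real N * (1 - s j) > 1" by simp
          then show ?thesis using tr(2) N by auto
        qed
      qed
      have bd: "sph_deriv h x \<le> 4 * C / (3 * r)" if x: "x \<in> cball c (r / 2)" for x
      proof -
        have x': "x \<in> cball c r" using x r by auto
        have "sph_deriv h x * (r\<^sup>2 - (cmod (x - c))\<^sup>2) \<le> C * r"
          using C(2)[OF r, of c h x] an sub ram x' by blast
        moreover have "(cmod (x - c))\<^sup>2 \<le> (r / 2)\<^sup>2"
          using x by (intro power_mono) (auto simp: dist_norm norm_minus_commute)
        then have "3 / 4 * r\<^sup>2 \<le> r\<^sup>2 - (cmod (x - c))\<^sup>2" by (simp add: power2_eq_square)
        then have "sph_deriv h x * (3 / 4 * r\<^sup>2) \<le> sph_deriv h x * (r\<^sup>2 - (cmod (x - c))\<^sup>2)"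
          by (intro mult_left_mono) auto
        ultimately have "sph_deriv h x * (3 / 4 * r) * r \<le> C * r" by (simp add: power2_eq_square)
        then have "sph_deriv h x * (3 / 4 * r) \<le> C" using r by simp
        then show ?thesis using r by (simp add: field_simps)
      qed
      show ?thesis
        unfolding h_def[symmetric]
      proof (rule chordal_le_of_sph_deriv_le[OF convex_cball _ bd xy])
        fix w assume "w \<in> cball c (r / 2)"
        then have "w \<in> cball c r" using r by auto
        then show "sph_analytic h w" using an sub by blast
      qed
    qed
    then show "\<exists>L. \<forall>m. \<forall>x\<in>cball c (r / 2). \<forall>y\<in>cball c (r / 2).
        chordal ((f m \<circ> inv_into U z) x) ((f m \<circ> inv_into U z) y) \<le> L * cmod (x - y)" by blast
  qed
qed

theorem theorem3p3:
  fixes q :: nat and \<alpha> :: "nat \<Rightarrow> ecomplex" and \<mu> :: "nat \<Rightarrow> enat"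
  assumes "q > 0"
    and "inj_on \<alpha> {1..q}"
    and "\<forall>j\<in>{1..q}. \<mu> j \<ge> 2"
  shows "closed_property (P_ramified q \<alpha> \<mu> :: 'a map_property) (P_ramified q \<alpha> \<mu> :: 'b map_property)
    \<and> ((\<Sum>j=1..q. 1 - recip (\<mu> j)) > 2 \<longrightarrow>
       compact_property (P_ramified q \<alpha> \<mu> :: 'a map_property) (P_ramified q \<alpha> \<mu> :: 'b map_property))"
  unfolding closed_property_def compact_property_def
  using prop_P1_ramified prop_P2_ramified prop_P3_ramified prop_P4_ramified[OF assms] by blast

end
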